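(* Let $g\geq2$ and let $\mathcal{P}$ be a generic configuration of $g-2$ points in a tropical abelian surface $\mathbb{T}A=N_{\mathbb{R}}/\Lambda$. Let $h:\Gamma\to\mathbb{T}A$ be a (genus $g$, irreducible) parametrized tropical curve in the class $C$ belonging to a fixed linear system and passing through $\mathcal{P}$. Let $\Sigma\subset\Gamma$ be the genus $2$ subgraph onto which $\Gamma\setminus\mathcal{P}$ retracts. Then the multiplicity $m_\Gamma^{\mathbb{C}}=|\ker\Psi_{\mathbb{C}^*}|\prod_{e\in E(\Gamma')}w_e$ splits as the product $$m_\Gamma^{\mathbb{C}}=\delta_\Gamma\,\Lambda_\Gamma^\Sigma\,m_\Gamma .$$
   Context: $N$ and $\Lambda$ are rank $2$ lattices, $M=N^*$, $N_{\mathbb{R}}=N\otimes\mathbb{R}$, $S:\Lambda\hookrightarrow N_{\mathbb{R}}$ is an inclusion as a lattice, and $\mathbb{T}A=N_{\mathbb{R}}/\Lambda$; $H_1(\mathbb{T}A,\mathbb{Z})\simeq\Lambda$. A parametrized tropical curve is a map $h:\Gamma\to\mathbb{T}A$ from a finite metric graph, affine with integer slope $w_eu_e$ on each edge $e$ ($w_e\geq1$ an integer called the weight, $u_e\in N$ primitive), with $\sum_{e\ni V}w_eu_e=0$ (outgoing slopes) at each vertex $V$. It is irreducible if $\Gamma$ is connected; its genus is then $b_1(\Gamma)$; its class (degree) $C\in\Lambda\otimes N\simeq H_1(\mathbb{T}A,N)$ is the class of the cycle $\sum_eh(e)\otimes w_eu_e$. It is simple if $\Gamma$ is trivalent and $h$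 is an immersion. A curve belongs to the linear system of a tropical line bundle $\mathcal{L}$, given as the quotient of $N_{\mathbb{R}}\times\mathbb{R}$ by an action $\lambda\cdot(x,\xi)=(x+\lambda,\xi+c(\lambda)(x)+\beta_\lambda)$ with $c:\Lambda\to M$, $\beta_\lambda\in\mathbb{R}$, if its periodic lift to $N_{\mathbb{R}}$ (with weights) is the corner locus of a convex piecewise affine function $\Theta$ with integer slopes satisfying $\Theta(x+\lambda)=\Theta(x)+c(\lambda)(x)+\beta_\lambda$. For generic $\mathcal{P}$ (i.e. in a dense open set of configurations), each such curve $h$ through $\mathcal{P}$ is simple, and $\Gamma\setminus\mathcal{P}$ (identifying $\mathcal{P}$ with its preimage in $\Gamma$, the marked points) is connected of genus $2$ with $H_1(\Gamma\setminus\mathcal{P},\mathbb{Z})\to H_1(\mathbb{T}A,\mathbb{Z})$ injective; it retracts onto a genus $2$ subgraph $\Sigma$. $\delta_\Gamma=\gcd_ew_e$ is the gcd of the weights of the edges of $\Gamma$. $\Lambda_\Gamma^\Sigma$ is the index of (the image of) $H_1(\Sigma,\mathbb{Z})$ in $H_1(\mathbb{T}A,\mathbb{Z})\simeq\Lambda$. $m_\Gamma=\prod_Vm_V$ over the trivalent vertices of $\Gamma$, with $m_V=|\det(a_V,b_V)|$ for $a_V,b_V$ two of the three outgoing slopes at $V$. Let $\Gamma'$ be $\Gamma$ with the marked points $V_1,\dots,V_{g-2}$ added as bivalent vertices (edges of $\Gamma'$ inherit weights and slopes), and for an edge $e$ let $N_e=\mathbb{Z}u_e\subset N$. Orient the edges.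 Then $$\Psi:\bigoplus_{V\in V(\Gamma')}N\to\bigoplus_{e\in E(\Gamma')}N/N_e\ \oplus\ \bigoplus_{1}^{g-2}N\ \oplus\ \Lambda^*$$ sends $(\phi_V)_V$ to the element with: $N/N_e$-coordinate the class of $\phi_{\partial^+e}-\phi_{\partial^-e}$; $i$-th coordinate in $\bigoplus_1^{g-2}N$ equal to $\phi_{V_i}$; and $\Lambda^*$-coordinate defined on a basis $(\lambda_1,\lambda_2)$ of $\Lambda$ as follows: choose a loop in $\mathbb{T}A$ representing $\lambda_k$ and transverse to $\Gamma$, let $E_i$ be the edges it meets, oriented consistently with respect to their intersection sign with the loop, $W_i$ their sources and $w_iu_i$ their slopes; the value on $\lambda_k$ is $\sum_i\det(w_iu_i,\phi_{W_i})$. (Other choices change $\Psi$ by a change of basis of the codomain.) $\Psi_{\mathbb{C}^*}=\Psi\otimes\mathbb{C}^*$. *)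

theory Defs
  imports "HOL-Analysis.Analysis" "HOL-Algebra.Product_Groups" "HOL-Algebra.FiniteProduct"
begin

section \<open>Lattices and the torus\<close>

text \<open>
  A basis of \<open>N\<close> is fixed throughout: \<open>N\<close> is \<open>int \<times> int\<close>, \<open>M\<close> is \<open>int \<times> int\<close> acting through
  \<open>pairing\<close>, and \<open>N\<^sub>\<real>\<close> is \<open>real \<times> real\<close>.  The lattice \<open>\<Lambda>\<close> is given by its image in \<open>N\<^sub>\<real>\<close>.
  Points of the torus \<open>N\<^sub>\<real>/\<Lambda>\<close> are handled through representatives in \<open>N\<^sub>\<real>\<close>.
\<close>

definition det2 :: "'a::comm_ring \<times> 'a \<Rightarrow> 'a \<times> 'a \<Rightarrow> 'a" where
  "det2 a b = fst a * snd b - snd a * fst b"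

definition rvec :: "int \<times> int \<Rightarrow> real \<times> real" where
  "rvec v = (real_of_int (fst v), real_of_int (snd v))"

definition smul :: "int \<Rightarrow> int \<times> int \<Rightarrow> int \<times> int" where
  "smul k v = (k * fst v, k * snd v)"

definition pairing :: "int \<times> int \<Rightarrow> real \<times> real \<Rightarrow> real" where
  "pairing m x = real_of_int (fst m) * fst x + real_of_int (snd m) * snd x"

definition lattice_basis :: "(real \<times> real) set \<Rightarrow> (nat \<Rightarrow> real \<times> real) \<Rightarrow> bool" where
  "lattice_basis \<Lambda> b \<longleftrightarrow> det2 (b 0) (b 1) \<noteq> 0 \<and>
     \<Lambda> = {of_int i *\<^sub>R b 0 + of_int j *\<^sub>R b 1 | i j :: int. True}"

section \<open>Parametrized tropical curves\<close>

text \<open>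
  A record describes a finite metric graph together with a map to \<open>N\<^sub>\<real>/\<Lambda>\<close> that is affine on the
  edges.  Every edge is oriented from \<open>src\<close> to \<open>tgt\<close>; \<open>dir e\<close> is the primitive vector \<open>u\<^sub>e\<close>
  for that orientation, \<open>wt e\<close> the weight and \<open>len e\<close> the length.  \<open>pos v\<close> is a representative
  of \<open>h(v)\<close> in \<open>N\<^sub>\<real>\<close>, so the point at distance \<open>t\<close> from the source on \<open>e\<close> is sent to the class of
  \<open>edge_pt \<Gamma> e t\<close>.
\<close>

record ('v, 'e) tcurve =
  verts :: "'v set"
  edges :: "'e set"
  src :: "'e \<Rightarrow> 'v"
  tgt :: "'e \<Rightarrow> 'v"
  len :: "'e \<Rightarrow> real"
  wt :: "'e \<Rightarrow> nat"
  dir :: "'e \<Rightarrow> int \<times> int"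
  pos :: "'v \<Rightarrow> real \<times> real"

definition slope :: "('v, 'e) tcurve \<Rightarrow> 'e \<Rightarrow> int \<times> int" where
  "slope \<Gamma> e = smul (int (wt \<Gamma> e)) (dir \<Gamma> e)"

definition edge_pt :: "('v, 'e) tcurve \<Rightarrow> 'e \<Rightarrow> real \<Rightarrow> real \<times> real" where
  "edge_pt \<Gamma> e t = pos \<Gamma> (src \<Gamma> e) + t *\<^sub>R rvec (slope \<Gamma> e)"

definition displacement :: "('v, 'e) tcurve \<Rightarrow> 'e \<Rightarrow> real \<times> real" where
  "displacement \<Gamma> e = len \<Gamma> e *\<^sub>R rvec (slope \<Gamma> e)"

text \<open>Outgoing half-edges at a vertex; a loop contributes two of them.\<close>

definition flags :: "('v, 'e) tcurve \<Rightarrow> 'v \<Rightarrow> ('e \<times> bool) set" where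
  "flags \<Gamma> v = {(e, True) | e. e \<in> edges \<Gamma> \<and> src \<Gamma> e = v} \<union>
               {(e, False) | e. e \<in> edges \<Gamma> \<and> tgt \<Gamma> e = v}"

definition flag_dir :: "('v, 'e) tcurve \<Rightarrow> 'e \<times> bool \<Rightarrow> int \<times> int" where
  "flag_dir \<Gamma> f = (if snd f then dir \<Gamma> (fst f) else - dir \<Gamma> (fst f))"

definition flag_slope :: "('v, 'e) tcurve \<Rightarrow> 'e \<times> bool \<Rightarrow> int \<times> int" where
  "flag_slope \<Gamma> f = smul (int (wt \<Gamma> (fst f))) (flag_dir \<Gamma> f)"

definition valence :: "('v, 'e) tcurve \<Rightarrow> 'v \<Rightarrow> nat" where
  "valence \<Gamma> v = card (flags \<Gamma> v)"

text \<open>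
  Bivalent vertices would only subdivide the metric graph (balancing makes \<open>h\<close> affine across them),
  and univalent ones are excluded by balancing.  The last condition therefore selects the unique
  coarsest combinatorial model of a metric graph whose components have genus at least two.
\<close>

definition parametrized_curve :: "(real \<times> real) set \<Rightarrow> ('v, 'e) tcurve \<Rightarrow> bool" where
  "parametrized_curve \<Lambda> \<Gamma> \<longleftrightarrow>
     finite (verts \<Gamma>) \<and> verts \<Gamma> \<noteq> {} \<and> finite (edges \<Gamma>) \<and>
     (\<forall>e\<in>edges \<Gamma>. src \<Gamma> e \<in> verts \<Gamma> \<and> tgt \<Gamma> e \<in> verts \<Gamma> \<and> len \<Gamma> e > 0 \<and> wt \<Gamma> e \<ge> 1 \<and>
        coprime (fst (dir \<Gamma> e)) (snd (dir \<Gamma> e)) \<and>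
        edge_pt \<Gamma> e (len \<Gamma> e) - pos \<Gamma> (tgt \<Gamma> e) \<in> \<Lambda>) \<and>
     (\<forall>v\<in>verts \<Gamma>. (\<Sum>f\<in>flags \<Gamma> v. flag_slope \<Gamma> f) = 0) \<and>
     (\<forall>v\<in>verts \<Gamma>. valence \<Gamma> v \<ge> 3)"

text \<open>
  On the interior of an edge \<open>h\<close> is an immersion because the weight is positive; at a vertex it is
  locally injective iff the outgoing directions are pairwise distinct.
\<close>

definition simple_curve :: "('v, 'e) tcurve \<Rightarrow> bool" where
  "simple_curve \<Gamma> \<longleftrightarrow>
     (\<forall>v\<in>verts \<Gamma>. valence \<Gamma> v = 3 \<and> inj_on (flag_dir \<Gamma>) (flags \<Gamma> v))"

section \<open>Connectedness and homology\<close>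

text \<open>
  For a set \<open>Q\<close> of vertices, \<open>\<Gamma> \<setminus> Q\<close> is the space obtained by removing these points and nothing
  else: it is the union of the open edges and of the remaining vertices, and it is connected iff
  any two of these cells are linked by incidences.
\<close>

definition cells :: "('v, 'e) tcurve \<Rightarrow> 'v set \<Rightarrow> ('v + 'e) set" where
  "cells \<Gamma> Q = Inl ` (verts \<Gamma> - Q) \<union> Inr ` edges \<Gamma>"

definition incidence :: "('v, 'e) tcurve \<Rightarrow> 'v set \<Rightarrow> (('v + 'e) \<times> ('v + 'e)) set" where
  "incidence \<Gamma> Q = {(Inl v, Inr e) | v e.
     v \<in> verts \<Gamma> - Q \<and> e \<in> edges \<Gamma> \<and> (v = src \<Gamma> e \<or> v = tgt \<Gamma> e)}"

definition connected_off :: "('v, 'e) tcurve \<Rightarrow> 'v set \<Rightarrow> bool" where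
  "connected_off \<Gamma> Q \<longleftrightarrow> cells \<Gamma> Q \<noteq> {} \<and>
     (\<forall>x\<in>cells \<Gamma> Q. \<forall>y\<in>cells \<Gamma> Q. (x, y) \<in> (incidence \<Gamma> Q \<union> (incidence \<Gamma> Q)\<inverse>)\<^sup>*)"

text \<open>
  \<open>H\<^sub>1(\<Gamma> \<setminus> Q, \<int>)\<close> as a group of cellular 1-cycles: an edge ending at a removed vertex is a half-open
  end of \<open>\<Gamma> \<setminus> Q\<close> and does not occur in a cycle.
\<close>

definition H1_off :: "('v, 'e) tcurve \<Rightarrow> 'v set \<Rightarrow> ('e \<Rightarrow> int) set" where
  "H1_off \<Gamma> Q = {z. (\<forall>e. z e \<noteq> 0 \<longrightarrow> e \<in> edges \<Gamma> \<and> src \<Gamma> e \<notin> Q \<and> tgt \<Gamma> e \<notin> Q) \<and>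
     (\<forall>v\<in>verts \<Gamma>. (\<Sum>e | e \<in> edges \<Gamma> \<and> tgt \<Gamma> e = v. z e) = (\<Sum>e | e \<in> edges \<Gamma> \<and> src \<Gamma> e = v. z e))}"

definition free_of_rank :: "('e \<Rightarrow> int) set \<Rightarrow> nat \<Rightarrow> bool" where
  "free_of_rank A r \<longleftrightarrow> (\<exists>b :: nat \<Rightarrow> 'e \<Rightarrow> int.
     bij_betw (\<lambda>a e. \<Sum>i<r. a i * b i e) {a :: nat \<Rightarrow> int. \<forall>i\<ge>r. a i = 0} A)"

definition genus_off :: "('v, 'e) tcurve \<Rightarrow> 'v set \<Rightarrow> nat \<Rightarrow> bool" where
  "genus_off \<Gamma> Q r \<longleftrightarrow> free_of_rank (H1_off \<Gamma> Q) r"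

text \<open>
  The image of a cycle in \<open>H\<^sub>1(N\<^sub>\<real>/\<Lambda>, \<int>) \<cong> \<Lambda>\<close> is the total displacement of a lift to \<open>N\<^sub>\<real>\<close>.
\<close>

definition hclass :: "('v, 'e) tcurve \<Rightarrow> ('e \<Rightarrow> int) \<Rightarrow> real \<times> real" where
  "hclass \<Gamma> z = (\<Sum>e\<in>edges \<Gamma>. of_int (z e) *\<^sub>R displacement \<Gamma> e)"

text \<open>
  \<open>\<Lambda> \<otimes> N\<close> is \<open>\<Lambda> \<times> \<Lambda>\<close> via the basis of \<open>N\<close>.  By balancing, each coordinate of the cycle
  \<open>\<Sum> e \<otimes> w\<^sub>e u\<^sub>e\<close> is an integral 1-cycle on the graph; its image is taken by \<open>hclass\<close>.
\<close>

definition curve_class :: "('v, 'e) tcurve \<Rightarrow> (real \<times> real) \<times> (real \<times> real)" where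
  "curve_class \<Gamma> = (hclass \<Gamma> (\<lambda>e. fst (slope \<Gamma> e)), hclass \<Gamma> (\<lambda>e. snd (slope \<Gamma> e)))"

definition irreducible_curve ::
  "(real \<times> real) set \<Rightarrow> nat \<Rightarrow> (real \<times> real) \<times> (real \<times> real) \<Rightarrow> ('v, 'e) tcurve \<Rightarrow> bool" where
  "irreducible_curve \<Lambda> g C \<Gamma> \<longleftrightarrow> parametrized_curve \<Lambda> \<Gamma> \<and> connected_off \<Gamma> {} \<and>
     genus_off \<Gamma> {} g \<and> curve_class \<Gamma> = C"

section \<open>Linear systems\<close>

text \<open>The condition on \<open>\<beta>\<close> says that the formula for \<open>\<lambda> \<cdot> (x, \<xi>)\<close> defines an action of \<open>\<Lambda>\<close>.\<close>

definition tropical_line_bundle ::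
  "(real \<times> real) set \<Rightarrow> (real \<times> real \<Rightarrow> int \<times> int) \<Rightarrow> (real \<times> real \<Rightarrow> real) \<Rightarrow> bool" where
  "tropical_line_bundle \<Lambda> c \<beta> \<longleftrightarrow>
     (\<forall>l\<in>\<Lambda>. \<forall>m\<in>\<Lambda>. c (l + m) = c l + c m \<and> \<beta> (l + m) = \<beta> l + \<beta> m + pairing (c l) m)"

definition lifted_vertices :: "(real \<times> real) set \<Rightarrow> ('v, 'e) tcurve \<Rightarrow> (real \<times> real) set" where
  "lifted_vertices \<Lambda> \<Gamma> = {x. \<exists>v\<in>verts \<Gamma>. x - pos \<Gamma> v \<in> \<Lambda>}"

text \<open>The points in the interiors of edges, with their parameter, lying over the class of \<open>x\<close>.\<close>

definition edge_fibre :: "(real \<times> real) set \<Rightarrow> ('v, 'e) tcurve \<Rightarrow> real \<times> real \<Rightarrow> ('e \<times> real) set" where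
  "edge_fibre \<Lambda> \<Gamma> x =
     {(e, t). e \<in> edges \<Gamma> \<and> 0 < t \<and> t < len \<Gamma> e \<and> x - edge_pt \<Gamma> e t \<in> \<Lambda>}"

definition periodic_lift :: "(real \<times> real) set \<Rightarrow> ('v, 'e) tcurve \<Rightarrow> (real \<times> real) set" where
  "periodic_lift \<Lambda> \<Gamma> = lifted_vertices \<Lambda> \<Gamma> \<union> {x. edge_fibre \<Lambda> \<Gamma> x \<noteq> {}}"

definition convex_pw_affine :: "(real \<times> real \<Rightarrow> real) \<Rightarrow> bool" where
  "convex_pw_affine \<theta> \<longleftrightarrow> convex_on UNIV \<theta> \<and>
     (\<forall>x. \<exists>A :: ((int \<times> int) \<times> real) set. finite A \<and>
        (\<forall>\<^sub>F y in nhds x. \<exists>(m, a)\<in>A. \<theta> y = pairing m y + a))"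

definition corner_locus :: "(real \<times> real \<Rightarrow> real) \<Rightarrow> (real \<times> real) set" where
  "corner_locus \<theta> = {x. \<not> (\<exists>m a. \<forall>\<^sub>F y in nhds x. \<theta> y = pairing m y + a)}"

text \<open>
  At a point in the interior of an edge of the corner locus \<open>\<theta>\<close> is the maximum of two affine
  functions, and the weight of the edge is the lattice length of the difference of their slopes.
\<close>

definition corner_weight :: "(real \<times> real \<Rightarrow> real) \<Rightarrow> real \<times> real \<Rightarrow> nat \<Rightarrow> bool" where
  "corner_weight \<theta> x k \<longleftrightarrow> (\<exists>m m' a a'. m \<noteq> m' \<and>
     pairing m x + a = pairing m' x + a' \<and>
     (\<forall>\<^sub>F y in nhds x. \<theta> y = max (pairing m y + a) (pairing m' y + a')) \<and>
     k = nat (gcd (fst (m - m')) (snd (m - m'))))"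

definition in_linear_system ::
  "(real \<times> real) set \<Rightarrow> (real \<times> real \<Rightarrow> int \<times> int) \<Rightarrow> (real \<times> real \<Rightarrow> real) \<Rightarrow> ('v, 'e) tcurve \<Rightarrow> bool"
where
  "in_linear_system \<Lambda> c \<beta> \<Gamma> \<longleftrightarrow> (\<exists>\<theta>. convex_pw_affine \<theta> \<and>
     (\<forall>l\<in>\<Lambda>. \<forall>x. \<theta> (x + l) = \<theta> x + pairing (c l) x + \<beta> l) \<and>
     corner_locus \<theta> = periodic_lift \<Lambda> \<Gamma> \<and>
     (\<forall>x k. x \<notin> lifted_vertices \<Lambda> \<Gamma> \<and> corner_weight \<theta> x k \<longrightarrow>
        k = (\<Sum>(e, t)\<in>edge_fibre \<Lambda> \<Gamma> x. wt \<Gamma> e)))"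

section \<open>Marked points\<close>

definition passes_through ::
  "(real \<times> real) set \<Rightarrow> ('v, 'e) tcurve \<Rightarrow> nat \<Rightarrow> (nat \<Rightarrow> real \<times> real) \<Rightarrow> bool" where
  "passes_through \<Lambda> \<Gamma> n P \<longleftrightarrow> (\<forall>i<n. P i \<in> periodic_lift \<Lambda> \<Gamma>)"

text \<open>
  \<open>h\<close> identifies the preimage of the configuration \<open>P\<close> with \<open>P\<close>: the only preimage of \<open>P i\<close> is the
  point at distance \<open>snd (mk i)\<close> from the source in the interior of the edge \<open>fst (mk i)\<close>.
\<close>

definition marking ::
  "(real \<times> real) set \<Rightarrow> ('v, 'e) tcurve \<Rightarrow> nat \<Rightarrow> (nat \<Rightarrow> real \<times> real) \<Rightarrow> (nat \<Rightarrow> 'e \<times> real) \<Rightarrow> bool"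
where
  "marking \<Lambda> \<Gamma> n P mk \<longleftrightarrow> inj_on mk {..<n} \<and>
     (\<forall>i<n. P i \<notin> lifted_vertices \<Lambda> \<Gamma> \<and> edge_fibre \<Lambda> \<Gamma> (P i) = {mk i})"

text \<open>
  The graph \<open>\<Gamma>'\<close>: the \<open>i\<close>-th marked point becomes the vertex \<open>Inr i\<close>.  The piece \<open>(e, None)\<close> of an
  edge \<open>e\<close> starts at the source of \<open>e\<close> and \<open>(e, Some i)\<close> starts at the \<open>i\<close>-th marked point; each
  piece extends to the next marked point on \<open>e\<close>, or to the target of \<open>e\<close> if there is none.
\<close>

definition piece_start :: "(nat \<Rightarrow> 'e \<times> real) \<Rightarrow> 'e \<times> nat option \<Rightarrow> real" where
  "piece_start mk p = (case snd p of None \<Rightarrow> 0 | Some i \<Rightarrow> snd (mk i))"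

definition later_marks :: "nat \<Rightarrow> (nat \<Rightarrow> 'e \<times> real) \<Rightarrow> 'e \<times> nat option \<Rightarrow> nat set" where
  "later_marks n mk p = {j. j < n \<and> fst (mk j) = fst p \<and> snd (mk j) > piece_start mk p}"

definition next_mark :: "nat \<Rightarrow> (nat \<Rightarrow> 'e \<times> real) \<Rightarrow> 'e \<times> nat option \<Rightarrow> nat" where
  "next_mark n mk p = (ARG_MIN (\<lambda>j. snd (mk j)) j. j \<in> later_marks n mk p)"

definition subdivide ::
  "('v, 'e) tcurve \<Rightarrow> nat \<Rightarrow> (nat \<Rightarrow> 'e \<times> real) \<Rightarrow> ('v + nat, 'e \<times> nat option) tcurve" where
  "subdivide \<Gamma> n mk = \<lparr>
     verts = Inl ` verts \<Gamma> \<union> Inr ` {..<n},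
     edges = {(e, None) | e. e \<in> edges \<Gamma>} \<union> {(fst (mk i), Some i) | i. i < n},
     src = (\<lambda>p. case snd p of None \<Rightarrow> Inl (src \<Gamma> (fst p)) | Some i \<Rightarrow> Inr i),
     tgt = (\<lambda>p. if later_marks n mk p = {} then Inl (tgt \<Gamma> (fst p)) else Inr (next_mark n mk p)),
     len = (\<lambda>p. (if later_marks n mk p = {} then len \<Gamma> (fst p) else snd (mk (next_mark n mk p)))
                - piece_start mk p),
     wt = (\<lambda>p. wt \<Gamma> (fst p)),
     dir = (\<lambda>p. dir \<Gamma> (fst p)),
     pos = (\<lambda>v. case v of Inl v' \<Rightarrow> pos \<Gamma> v' | Inr i \<Rightarrow> edge_pt \<Gamma> (fst (mk i)) (snd (mk i)))\<rparr>"

abbreviation marked_vertices :: "nat \<Rightarrow> ('v + nat) set" where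
  "marked_vertices n \<equiv> Inr ` {..<n}"

text \<open>
  Configurations of \<open>n\<close> points of the torus are given by lifts to \<open>N\<^sub>\<real>\<close>, and open dense sets of
  configurations by \<open>\<Lambda>\<close>-periodic open dense subsets of \<open>N\<^sub>\<real>\<^sup>n\<close>.  Every finite graph can be labelled
  by natural numbers, so the quantification covers all curves.
\<close>

definition config_space :: "nat \<Rightarrow> (nat \<Rightarrow> real \<times> real) topology" where
  "config_space n = product_topology (\<lambda>_. euclidean) {..<n}"

definition generic_config ::
  "(real \<times> real) set \<Rightarrow> (real \<times> real \<Rightarrow> int \<times> int) \<Rightarrow> (real \<times> real \<Rightarrow> real) \<Rightarrow>
   nat \<Rightarrow> (real \<times> real) \<times> (real \<times> real) \<Rightarrow> (nat \<Rightarrow> real \<times> real) \<Rightarrow> bool" where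
  "generic_config \<Lambda> c \<beta> g C P \<longleftrightarrow>
     (\<exists>U. P \<in> U \<and> openin (config_space (g - 2)) U \<and>
        config_space (g - 2) closure_of U = topspace (config_space (g - 2)) \<and>
        (\<forall>Q\<in>U. \<forall>Q'\<in>topspace (config_space (g - 2)). (\<forall>i<g - 2. Q' i - Q i \<in> \<Lambda>) \<longrightarrow> Q' \<in> U) \<and>
        (\<forall>Q\<in>U. \<forall>\<Gamma> :: (nat, nat) tcurve.
           irreducible_curve \<Lambda> g C \<Gamma> \<and> in_linear_system \<Lambda> c \<beta> \<Gamma> \<and> passes_through \<Lambda> \<Gamma> (g - 2) Q \<longrightarrow>
           simple_curve \<Gamma> \<and>
           (\<exists>mk. marking \<Lambda> \<Gamma> (g - 2) Q mk \<and>
              connected_off (subdivide \<Gamma> (g - 2) mk) (marked_vertices (g - 2)) \<and>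
              genus_off (subdivide \<Gamma> (g - 2) mk) (marked_vertices (g - 2)) 2 \<and>
              inj_on (hclass (subdivide \<Gamma> (g - 2) mk))
                (H1_off (subdivide \<Gamma> (g - 2) mk) (marked_vertices (g - 2))))))"

section \<open>The factors of the multiplicity\<close>

definition weight_gcd :: "('v, 'e) tcurve \<Rightarrow> nat" where
  "weight_gcd \<Gamma> = Gcd (wt \<Gamma> ` edges \<Gamma>)"

definition vertex_mult :: "('v, 'e) tcurve \<Rightarrow> 'v \<Rightarrow> nat" where
  "vertex_mult \<Gamma> v = (THE m. \<exists>a\<in>flags \<Gamma> v. \<exists>b\<in>flags \<Gamma> v. a \<noteq> b \<and>
     m = nat \<bar>det2 (flag_slope \<Gamma> a) (flag_slope \<Gamma> b)\<bar>)"

definition curve_mult :: "('v, 'e) tcurve \<Rightarrow> nat" where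
  "curve_mult \<Gamma> = (\<Prod>v\<in>verts \<Gamma>. vertex_mult \<Gamma> v)"

definition subgroup_index :: "(real \<times> real) set \<Rightarrow> (real \<times> real) set \<Rightarrow> nat" where
  "subgroup_index \<Lambda> A = card ((\<lambda>x. (\<lambda>a. x + a) ` A) ` \<Lambda>)"

definition sub_curve :: "('v, 'e) tcurve \<Rightarrow> 'v set \<Rightarrow> 'e set \<Rightarrow> ('v, 'e) tcurve" where
  "sub_curve \<Gamma> VS ES = \<Gamma>\<lparr>verts := VS, edges := ES\<rparr>"

text \<open>
  \<open>\<Gamma> \<setminus> Q\<close> (deformation) retracts onto the connected subgraph \<open>(VS, ES)\<close> contained in it; for a
  connected subgraph of a connected graph this means that the inclusion is an isomorphism on \<open>H\<^sub>1\<close>.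
\<close>

definition retracts_onto :: "('v, 'e) tcurve \<Rightarrow> 'v set \<Rightarrow> 'v set \<Rightarrow> 'e set \<Rightarrow> bool" where
  "retracts_onto \<Gamma> Q VS ES \<longleftrightarrow>
     VS \<subseteq> verts \<Gamma> - Q \<and> ES \<subseteq> edges \<Gamma> \<and> (\<forall>e\<in>ES. src \<Gamma> e \<in> VS \<and> tgt \<Gamma> e \<in> VS) \<and>
     connected_off \<Gamma> Q \<and> connected_off (sub_curve \<Gamma> VS ES) {} \<and>
     H1_off (sub_curve \<Gamma> VS ES) {} = H1_off \<Gamma> Q"

section \<open>The map \<open>\<Psi>\<close>\<close>

text \<open>
  A loop in \<open>N\<^sub>\<real>/\<Lambda>\<close> in the class \<open>l\<close> is given by a periodic lift to \<open>N\<^sub>\<real>\<close>.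
\<close>

definition loop_in_class :: "(real \<Rightarrow> real \<times> real) \<Rightarrow> real \<times> real \<Rightarrow> bool" where
  "loop_in_class \<rho> l \<longleftrightarrow> continuous_on UNIV \<rho> \<and> (\<forall>t. \<rho> (t + 1) = \<rho> t + l)"

text \<open>The triples \<open>(t, e, s)\<close> such that the loop at time \<open>t\<close> meets \<open>e\<close> at parameter \<open>s\<close>.\<close>

definition crossings ::
  "(real \<times> real) set \<Rightarrow> ('v, 'e) tcurve \<Rightarrow> (real \<Rightarrow> real \<times> real) \<Rightarrow> (real \<times> 'e \<times> real) set" where
  "crossings \<Lambda> \<Gamma> \<rho> = {(t, e, s). 0 \<le> t \<and> t < 1 \<and> (e, s) \<in> edge_fibre \<Lambda> \<Gamma> (\<rho> t)}"

definition transverse :: "(real \<times> real) set \<Rightarrow> ('v, 'e) tcurve \<Rightarrow> (real \<Rightarrow> real \<times> real) \<Rightarrow> bool" where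
  "transverse \<Lambda> \<Gamma> \<rho> \<longleftrightarrow> (\<forall>t. \<rho> t \<notin> lifted_vertices \<Lambda> \<Gamma>) \<and>
     (\<forall>(t, e, s)\<in>crossings \<Lambda> \<Gamma> \<rho>. \<rho> differentiable at t \<and>
        det2 (vector_derivative \<rho> (at t)) (rvec (dir \<Gamma> e)) \<noteq> 0)"

text \<open>
  \<open>\<Psi> \<otimes> K\<close> for an abelian group \<open>K\<close> (a multiplicative \<open>comm_group\<close>); \<open>\<Psi>\<close> itself is the case
  \<open>K = integer_group\<close>.  With the bases of \<open>N\<close> and \<open>\<Lambda>\<close>, both \<open>N \<otimes> K\<close> and \<open>\<Lambda>\<^sup>* \<otimes> K\<close> are \<open>K \<times> K\<close>.
  By right exactness \<open>(N/N\<^sub>e) \<otimes> K\<close> is the quotient of \<open>N \<otimes> K\<close> by \<open>line_tensor K u\<^sub>e\<close>, the image of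
  \<open>N\<^sub>e \<otimes> K\<close>.  \<open>det_tensor K v\<close> is \<open>det(v, -) \<otimes> K\<close>, a homomorphism from \<open>N \<otimes> K\<close> to \<open>K\<close>.
\<close>

definition line_tensor :: "('k, 'm) monoid_scheme \<Rightarrow> int \<times> int \<Rightarrow> ('k \<times> 'k) set" where
  "line_tensor K u = {(t [^]\<^bsub>K\<^esub> fst u, t [^]\<^bsub>K\<^esub> snd u) | t. t \<in> carrier K}"

definition det_tensor :: "('k, 'm) monoid_scheme \<Rightarrow> int \<times> int \<Rightarrow> 'k \<times> 'k \<Rightarrow> 'k" where
  "det_tensor K v z = (snd z [^]\<^bsub>K\<^esub> fst v) \<otimes>\<^bsub>K\<^esub> (fst z [^]\<^bsub>K\<^esub> (- snd v))"

definition Psi_dom :: "('k, 'm) monoid_scheme \<Rightarrow> ('v, 'e) tcurve \<Rightarrow> ('v \<Rightarrow> 'k \<times> 'k) monoid" where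
  "Psi_dom K \<Gamma> = product_group (verts \<Gamma>) (\<lambda>_. K \<times>\<times> K)"

definition Psi_cod ::
  "('k, 'm) monoid_scheme \<Rightarrow> ('v, 'e) tcurve \<Rightarrow> nat \<Rightarrow>
   (('e \<Rightarrow> ('k \<times> 'k) set) \<times> (nat \<Rightarrow> 'k \<times> 'k) \<times> ('k \<times> 'k)) monoid" where
  "Psi_cod K \<Gamma> n =
     product_group (edges \<Gamma>) (\<lambda>e. (K \<times>\<times> K) Mod line_tensor K (dir \<Gamma> e)) \<times>\<times>
     product_group {..<n} (\<lambda>_. K \<times>\<times> K) \<times>\<times> (K \<times>\<times> K)"

text \<open>
  At a crossing the edge is reoriented so that it crosses the loop positively; source and slope are
  taken for this orientation.
\<close>

definition loop_value ::
  "('k, 'm) monoid_scheme \<Rightarrow> (real \<times> real) set \<Rightarrow> ('v, 'e) tcurve \<Rightarrow> (real \<Rightarrow> real \<times> real) \<Rightarrow>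
   ('v \<Rightarrow> 'k \<times> 'k) \<Rightarrow> 'k" where
  "loop_value K \<Lambda> \<Gamma> \<rho> \<phi> = finprod K
     (\<lambda>(t, e, s). if det2 (vector_derivative \<rho> (at t)) (rvec (dir \<Gamma> e)) > 0
        then det_tensor K (slope \<Gamma> e) (\<phi> (src \<Gamma> e))
        else det_tensor K (- slope \<Gamma> e) (\<phi> (tgt \<Gamma> e)))
     (crossings \<Lambda> \<Gamma> \<rho>)"

text \<open>\<open>V i\<close> is the \<open>i\<close>-th marked vertex and \<open>\<rho> 0\<close>, \<open>\<rho> 1\<close> are the loops for the basis of \<open>\<Lambda>\<close>.\<close>

definition Psi ::
  "('k, 'm) monoid_scheme \<Rightarrow> (real \<times> real) set \<Rightarrow> ('v, 'e) tcurve \<Rightarrow> nat \<Rightarrow> (nat \<Rightarrow> 'v) \<Rightarrow>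
   (nat \<Rightarrow> real \<Rightarrow> real \<times> real) \<Rightarrow> ('v \<Rightarrow> 'k \<times> 'k) \<Rightarrow>
   ('e \<Rightarrow> ('k \<times> 'k) set) \<times> (nat \<Rightarrow> 'k \<times> 'k) \<times> ('k \<times> 'k)" where
  "Psi K \<Lambda> \<Gamma> n V \<rho> \<phi> =
     ((\<lambda>e\<in>edges \<Gamma>. line_tensor K (dir \<Gamma> e) #>\<^bsub>K \<times>\<times> K\<^esub>
         (\<phi> (tgt \<Gamma> e) \<otimes>\<^bsub>K \<times>\<times> K\<^esub> inv\<^bsub>K \<times>\<times> K\<^esub> \<phi> (src \<Gamma> e))),
      (\<lambda>i\<in>{..<n}. \<phi> (V i)),
      (loop_value K \<Lambda> \<Gamma> (\<rho> 0) \<phi>, loop_value K \<Lambda> \<Gamma> (\<rho> 1) \<phi>))"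

definition Cstar :: "complex monoid" where
  "Cstar = \<lparr>carrier = {z. z \<noteq> 0}, monoid.mult = (*), one = 1\<rparr>"

definition complex_mult ::
  "(real \<times> real) set \<Rightarrow> ('v, 'e) tcurve \<Rightarrow> nat \<Rightarrow> (nat \<Rightarrow> 'v) \<Rightarrow> (nat \<Rightarrow> real \<Rightarrow> real \<times> real) \<Rightarrow> nat"
where
  "complex_mult \<Lambda> \<Gamma>' n V \<rho> =
     card (kernel (Psi_dom Cstar \<Gamma>') (Psi_cod Cstar \<Gamma>' n) (Psi Cstar \<Lambda> \<Gamma>' n V \<rho>)) *
     (\<Prod>e\<in>edges \<Gamma>'. wt \<Gamma>' e)"

end

theory Submission
  imports Defs
begin

text \<open>
  Let \<open>\<phi>\<close> be in the kernel of \<open>\<Psi>\<close> over the multiplicative group.  The numbers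
  \<open>\<mu>\<^sub>e = det(w\<^sub>e u\<^sub>e, \<phi>)\<close>, evaluated at either end of \<open>e\<close>, form by balancing a flow on \<open>\<Gamma>'\<close> with
  values in the multiplicative group.  It vanishes next to the marked points, so it lives on
  \<open>\<Sigma>\<close>, and the condition on the loops says that its class in \<open>\<Lambda>\<close> with these coefficients is
  trivial, because the intersection pairing of the torus is perfect.  As the cycles of \<open>\<Sigma>\<close> embed in
  \<open>\<Lambda>\<close> with finite index, there are exactly \<open>\<Lambda>\<^sub>\<Gamma>\<^sup>\<Sigma>\<close> such flows.  Conversely, each such flow comes from
  \<open>m\<^sub>V\<close> values of \<open>\<phi>\<close> at each trivalent vertex \<open>V\<close>.  The group of all these \<open>\<phi>\<close> thus has order
  \<open>\<Lambda>\<^sub>\<Gamma>\<^sup>\<Sigma> m\<^sub>\<Gamma>\<close>, and inside it the kernel is cut out by the equations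
  \<open>\<eta>\<^sub>e = det(u\<^sub>e, \<phi>\<^sub>t\<^sub>g\<^sub>t / \<phi>\<^sub>s\<^sub>r\<^sub>c) = 1\<close>, where \<open>\<eta>\<^sub>e\<close> is a root of unity of order dividing \<open>w\<^sub>e\<close>.  By orthogonality of
  characters the order of the kernel times \<open>\<Prod>\<^sub>e w\<^sub>e\<close> is the order of the group times the number
  of exponents \<open>0 \<le> k\<^sub>e < w\<^sub>e\<close> for which \<open>\<Prod>\<^sub>e \<eta>\<^sub>e ^ k\<^sub>e\<close> is identically \<open>1\<close>.  At a trivalent vertex
  this forces the fractions \<open>k\<^sub>e / w\<^sub>e\<close> to agree, hence they agree on the connected graph
  \<open>\<Gamma>'\<close> minus the marked points, which leaves \<open>\<delta>\<^sub>\<Gamma>\<close> possibilities.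
\<close>

section \<open>Crossing numbers of loops with cycles\<close>

text \<open>In the kernel itself the edge equations tie the values at neighbouring vertices
  together, so it does not split over the vertices. Raised to the power \<open>w_e\<close>, such an
  equation only says that \<open>\<mu>_e\<close> is the same at both ends; once the flow is fixed,
  the conditions on \<open>\<phi>\<close> are independent from vertex to vertex. This is why a
  larger group is counted and the kernel is found inside it. Perfectness of the intersection pairing
  is needed in a quantitative form: the crossing number of a loop in class \<open>l\<close> with a
  cycle \<open>z\<close> is the determinant of \<open>l\<close> and the class of \<open>z\<close>,
  divided by the covolume of the lattice. The loops are arbitrary continuous curves, differentiable
  only where they meet the graph, so straightening them is not a convenient route. Instead an
  integer-valued potential of the lifted cycle is written down on the plane. It is locally constant
  off the graph, it jumps across edges by the coefficients of \<open>z\<close>, and its periods are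
  given by the class of \<open>z\<close>. Computing its change along one period of the loop in two
  ways yields the formula.\<close>

definition height_step :: "real \<Rightarrow> real \<Rightarrow> real \<Rightarrow> int" where
  "height_step tp tq h = of_bool (tp \<le> h) - of_bool (tq \<le> h)"

text \<open>Signed horizontal distance to \<open>x\<close>, moved up by \<open>k\<close>, from the
  line through \<open>p\<close> of inverse slope \<open>m\<close>. Using the inverse slope makes the
  edge a graph over its height.\<close>

definition edge_offset :: "real \<times> real \<Rightarrow> real \<Rightarrow> int \<Rightarrow> real \<times> real \<Rightarrow> real" where
  "edge_offset p m k x = fst x - fst p - (snd x + of_int k - snd p) * m"

text \<open>The floor stands for the infinite number of integer horizontal translates of the edge to
  the left of \<open>x\<close>, normalized so that moving \<open>x\<close> by one to the right adds
  one. Since \<open>height_step\<close> includes the lower end and excludes the upper one, edges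
  stacked at a vertex are not counted twice at its height.\<close>

definition edge_count :: "real \<times> real \<Rightarrow> real \<Rightarrow> real \<Rightarrow> real \<times> real \<Rightarrow> int" where
  "edge_count p m tq x =
     (\<Sum>k | height_step (snd p) tq (snd x + of_int k) \<noteq> 0.
      height_step (snd p) tq (snd x + of_int k) * \<lfloor>edge_offset p m k x\<rfloor>)"

definition edge_hits :: "real \<times> real \<Rightarrow> real \<Rightarrow> real \<Rightarrow> real \<times> real \<Rightarrow> int set" where
  "edge_hits p m tq x =
     {k. (snd p < snd x + of_int k \<and> snd x + of_int k < tq \<or> tq < snd x + of_int k \<and> snd x + of_int k < snd p) \<and>
      edge_offset p m k x \<in> \<int>}"

lemma continuous_edge_offset: "continuous (at x) (edge_offset p m k)"
  unfolding edge_offset_def by (intro continuous_intros)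

lemma finite_int_shift: "finite {k::int. a \<le> t + of_int k \<and> t + of_int k \<le> (b::real)}"
proof (rule finite_subset)
  show "{k::int. a \<le> t + of_int k \<and> t + of_int k \<le> b} \<subseteq> {\<lfloor>a - t\<rfloor>..\<lceil>b - t\<rceil>}"
    by (auto, linarith+)
qed simp

lemma finite_edge_hits: "finite (edge_hits p m tq x)"
  by (rule finite_subset[OF _ finite_int_shift[of "min (snd p) tq" "snd x" "max (snd p) tq"]])
     (auto simp: edge_hits_def)

lemma edge_count_superset:
  assumes "finite K" "{k. height_step (snd p) tq (snd x + of_int k) \<noteq> 0} \<subseteq> K"
  shows "edge_count p m tq x =
     (\<Sum>k\<in>K. height_step (snd p) tq (snd x + of_int k) * \<lfloor>edge_offset p m k x\<rfloor>)"
  unfolding edge_count_def by (rule sum.mono_neutral_left) (use assms in auto)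

lemma eventually_floor_nonint:
  fixes f :: "'a::t2_space \<Rightarrow> real"
  assumes "continuous (at x) f" "f x \<notin> \<int>"
  shows "\<forall>\<^sub>F y in nhds x. \<lfloor>f y\<rfloor> = \<lfloor>f x\<rfloor> \<and> f y \<notin> \<int>"
proof -
  have l: "(f \<longlongrightarrow> f x) (nhds x)"
    using assms(1) by (simp add: continuous_at tendsto_nhds_iff)
  have "of_int \<lfloor>f x\<rfloor> < f x" using assms(2)
    by (metis Ints_of_int floor_correct order_le_less)
  moreover have "f x < of_int \<lfloor>f x\<rfloor> + 1" by linarith
  ultimately have "\<forall>\<^sub>F y in nhds x. of_int \<lfloor>f x\<rfloor> < f y" "\<forall>\<^sub>F y in nhds x. f y < of_int \<lfloor>f x\<rfloor> + 1"
    using l by (auto intro: order_tendstoD)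
  then show ?thesis
  proof eventually_elim
    case (elim y)
    then have "\<lfloor>f y\<rfloor> = \<lfloor>f x\<rfloor>" by linarith
    moreover have "f y \<notin> \<int>" using elim
      by (auto elim!: Ints_cases)
    ultimately show ?case by simp
  qed
qed

lemma eventually_floor_int:
  fixes f :: "'a::t2_space \<Rightarrow> real"
  assumes "continuous (at x) f" "f x \<in> \<int>"
  shows "\<forall>\<^sub>F y in nhds x. \<lfloor>f y\<rfloor> = \<lfloor>f x\<rfloor> - of_bool (f y < f x) \<and> (f y \<in> \<int> \<longrightarrow> f y = f x)"
proof -
  have l: "(f \<longlongrightarrow> f x) (nhds x)"
    using assms(1) by (simp add: continuous_at tendsto_nhds_iff)
  obtain n where n: "f x = of_int n" using assms(2) by (auto elim: Ints_cases)
  have "\<forall>\<^sub>F y in nhds x. of_int n - 1 < f y" "\<forall>\<^sub>F y in nhds x. f y < of_int n + 1"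
    using l n by (auto intro: order_tendstoD)
  then show ?thesis
  proof eventually_elim
    case (elim y)
    have "\<lfloor>f y\<rfloor> = n - of_bool (f y < f x)"
      using elim n by (auto simp: floor_eq_iff)
    moreover have "f y = f x" if "f y \<in> \<int>" 
      using that elim n by (auto elim!: Ints_cases)
    ultimately show ?case using n by auto
  qed
qed

lemma eventually_less_snd:
  fixes x :: "real \<times> real"
  assumes "snd x + c < d"
  shows "\<forall>\<^sub>F y in nhds x. snd y + c < d"
proof -
  have "((\<lambda>y. snd y + c) \<longlongrightarrow> snd x + c) (nhds x)"
    by (intro tendsto_intros) (simp add: filterlim_ident)
  then show ?thesis using assms by (rule order_tendstoD)
qed

lemma eventually_greater_snd:
  fixes x :: "real \<times> real"
  assumes "d < snd x + c"
  shows "\<forall>\<^sub>F y in nhds x. d < snd y + c"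
proof -
  have "((\<lambda>y. snd y + c) \<longlongrightarrow> snd x + c) (nhds x)"
    by (intro tendsto_intros) (simp add: filterlim_ident)
  then show ?thesis using assms by (rule order_tendstoD)
qed

text \<open>
  Near a point \<open>x\<close>, one term of \<open>edge_count\<close> changes in two ways: through the height passing an end of
  the edge, and through \<open>x\<close> lying on a translate of the edge itself.
\<close>

lemma eventually_edge_term:
  fixes x :: "real \<times> real" and p m tq k
  defines "q \<equiv> (fst p + (tq - snd p) * m, tq)"
  defines "T \<equiv> \<lambda>y. height_step (snd p) tq (snd y + of_int k) * \<lfloor>edge_offset p m k y\<rfloor>"
  assumes ne: "snd p \<noteq> tq"
    and p: "\<not> (fst x - fst p \<in> \<int> \<and> snd x - snd p \<in> \<int>)"
    and q: "\<not> (fst x - fst q \<in> \<int> \<and> snd x - snd q \<in> \<int>)"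
  shows "\<forall>\<^sub>F y in nhds x.
     T y = T x + of_bool (snd y < snd x) *
      (of_bool (snd x + of_int k = tq) * \<lfloor>fst x - fst q\<rfloor> -
      of_bool (snd x + of_int k = snd p) * \<lfloor>fst x - fst p\<rfloor>)
      - (if k \<in> edge_hits p m tq x
      then (if snd p < tq then 1 else -1) * of_bool (edge_offset p m k y < edge_offset p m k x)
      else 0) \<and>
     (k \<in> edge_hits p m tq y \<longrightarrow>
      k \<in> edge_hits p m tq x \<and> edge_offset p m k y = edge_offset p m k x)"
proof -
  let ?h = "snd x + of_int k" and ?f = "edge_offset p m k"
  consider (below) "?h < min (snd p) tq" | (above) "?h > max (snd p) tq"
    | (p) "?h = snd p" | (q) "?h = tq"
    | (hit) "min (snd p) tq < ?h" "?h < max (snd p) tq" "?f x \<in> \<int>"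
    | (nohit) "min (snd p) tq < ?h" "?h < max (snd p) tq" "?f x \<notin> \<int>"
    by linarith
  then show ?thesis
  proof cases
    case below
    have "\<forall>\<^sub>F y in nhds x. snd y + of_int k < min (snd p) tq"
      by (rule eventually_less_snd[OF below])
    then show ?thesis
      by eventually_elim (use below in \<open>auto simp: T_def height_step_def edge_hits_def\<close>)
  next
    case above
    have "\<forall>\<^sub>F y in nhds x. snd y + of_int k > max (snd p) tq"
      by (rule eventually_greater_snd[OF above])
    then show ?thesis
      by eventually_elim (use above in \<open>auto simp: T_def height_step_def edge_hits_def\<close>)
  next
    case p': p
    \<comment> \<open>At the height of an end the offset is the horizontal distance to that end. It
      is not an integer, because \<open>x\<close> is not congruent to the end; so the floor is
      constant near \<open>x\<close> and only the height step changes.\<close>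
    have f: "?f x = fst x - fst p" using p' by (simp add: edge_offset_def)
    have "snd x - snd p \<in> \<int>" using p' by (metis Ints_minus Ints_of_int add_diff_cancel_left' minus_diff_eq)
    then have "?f x \<notin> \<int>" using p f by simp
    note ev = eventually_floor_nonint[OF continuous_edge_offset this]
    have "\<forall>\<^sub>F y in nhds x. snd y + of_int k < tq \<longleftrightarrow> snd p < tq"
      using eventually_less_snd[of x "of_int k" tq] eventually_greater_snd[of tq x "of_int k"] ne p'
      by (cases "snd p < tq") (auto elim: eventually_mono)
    then show ?thesis using ev
      by eventually_elim (use p' ne f in \<open>auto simp: T_def height_step_def edge_hits_def of_bool_def\<close>)
  next
    case q': q
    have f: "?f x = fst x - fst q" using q' by (simp add: edge_offset_def q_def)
    have "snd x - snd q \<in> \<int>" using q' unfolding q_def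
      by (metis Ints_minus Ints_of_int add_diff_cancel_left' minus_diff_eq snd_conv)
    then have "?f x \<notin> \<int>" using q f by simp
    note ev = eventually_floor_nonint[OF continuous_edge_offset this]
    have "\<forall>\<^sub>F y in nhds x. snd y + of_int k < snd p \<longleftrightarrow> tq < snd p"
      using eventually_less_snd[of x "of_int k" "snd p"] eventually_greater_snd[of "snd p" x "of_int k"] ne q'
      by (cases "tq < snd p") (auto elim: eventually_mono)
    then show ?thesis using ev
      by eventually_elim (use q' ne f in \<open>auto simp: T_def height_step_def edge_hits_def of_bool_def\<close>)
  next
    case hit
    note ev = eventually_floor_int[OF continuous_edge_offset hit(3)]
    have "\<forall>\<^sub>F y in nhds x. min (snd p) tq < snd y + of_int k" "\<forall>\<^sub>F y in nhds x. snd y + of_int k < max (snd p) tq"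
      using eventually_greater_snd[OF hit(1)] eventually_less_snd[OF hit(2)] by auto
    then show ?thesis using ev
      by eventually_elim (use hit ne in \<open>auto simp: T_def height_step_def edge_hits_def of_bool_def min_def max_def split: if_splits\<close>)
  next
    case nohit
    note ev = eventually_floor_nonint[OF continuous_edge_offset nohit(3)]
    have "\<forall>\<^sub>F y in nhds x. min (snd p) tq < snd y + of_int k" "\<forall>\<^sub>F y in nhds x. snd y + of_int k < max (snd p) tq"
      using eventually_greater_snd[OF nohit(1)] eventually_less_snd[OF nohit(2)] by auto
    then show ?thesis using ev
      by eventually_elim (use nohit ne in \<open>auto simp: T_def height_step_def edge_hits_def of_bool_def min_def max_def split: if_splits\<close>)
  qed
qed

text \<open>The jumps at the heights of the ends do not vanish for a single edge. They are kept as a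
  term of the end \<open>q\<close> minus a term of the start \<open>p\<close>, the form in which
  conservation at the vertices can cancel them.\<close>

lemma eventually_edge_count:
  fixes x :: "real \<times> real" and p m tq
  defines "q \<equiv> (fst p + (tq - snd p) * m, tq)"
  assumes ne: "snd p \<noteq> tq"
    and p: "\<not> (fst x - fst p \<in> \<int> \<and> snd x - snd p \<in> \<int>)"
    and q: "\<not> (fst x - fst q \<in> \<int> \<and> snd x - snd q \<in> \<int>)"
  shows "\<forall>\<^sub>F y in nhds x.
     edge_count p m tq y = edge_count p m tq x + of_bool (snd y < snd x) *
      (of_bool (snd x - snd q \<in> \<int>) * \<lfloor>fst x - fst q\<rfloor> -
      of_bool (snd x - snd p \<in> \<int>) * \<lfloor>fst x - fst p\<rfloor>)
      - (if snd p < tq then 1 else -1) *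
      (\<Sum>k\<in>edge_hits p m tq x. of_bool (edge_offset p m k y < edge_offset p m k x)) \<and>
     (\<forall>k\<in>edge_hits p m tq y. k \<in> edge_hits p m tq x \<and> edge_offset p m k y = edge_offset p m k x)"
proof -
  \<comment> \<open>The window exceeds the heights of the edge by one on both sides, so that it
    serves all \<open>y\<close> whose height differs from that of \<open>x\<close> by less than
    one.\<close>
  define K where "K = {k::int. min (snd p) tq - 1 \<le> snd x + of_int k \<and> snd x + of_int k \<le> max (snd p) tq + 1}"
  have finK: "finite K" unfolding K_def by (rule finite_int_shift)
  have near: "\<forall>\<^sub>F y in nhds x. snd y < snd x + 1" "\<forall>\<^sub>F y in nhds x. snd x - 1 < snd y"
    using eventually_less_snd[of x 0 "snd x + 1"] eventually_greater_snd[of "snd x - 1" x 0] by auto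
  have pK: "(\<Sum>k\<in>K. of_bool (snd x + of_int k = c) * d) = of_bool (snd x - c \<in> \<int>) * d"
    if c: "min (snd p) tq \<le> c" "c \<le> max (snd p) tq" for c :: real and d :: int
  proof (cases "snd x - c \<in> \<int>")
    case True
    then obtain n where n: "snd x - c = of_int n" by (auto elim: Ints_cases)
    have *: "snd x + of_int k = c \<longleftrightarrow> k = - n" for k
    proof -
      have "snd x + of_int k = c \<longleftrightarrow> (of_int k :: real) = of_int (- n)" using n by (auto simp: algebra_simps)
      then show ?thesis by (simp only: of_int_eq_iff)
    qed
    have "- n \<in> K" using n c unfolding K_def by (auto simp: algebra_simps)
    then show ?thesis using True finK unfolding *
      by (simp add: sum_distrib_right[symmetric] of_bool_def sum.delta)
  next
    case False
    have "snd x + of_int k \<noteq> c" for k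
    proof
      assume "snd x + of_int k = c"
      then have "snd x - c = of_int (- k)" by simp
      then show False using False Ints_of_int by metis
    qed
    then show ?thesis using False by simp
  qed
  have "\<forall>\<^sub>F y in nhds x. \<forall>k\<in>K. 
     height_step (snd p) tq (snd y + of_int k) * \<lfloor>edge_offset p m k y\<rfloor> =
     height_step (snd p) tq (snd x + of_int k) * \<lfloor>edge_offset p m k x\<rfloor> + of_bool (snd y < snd x) *
      (of_bool (snd x + of_int k = tq) * \<lfloor>fst x - fst q\<rfloor> -
      of_bool (snd x + of_int k = snd p) * \<lfloor>fst x - fst p\<rfloor>)
      - (if k \<in> edge_hits p m tq x
      then (if snd p < tq then 1 else -1) * of_bool (edge_offset p m k y < edge_offset p m k x)
      else 0) \<and>
     (k \<in> edge_hits p m tq y \<longrightarrow>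
      k \<in> edge_hits p m tq x \<and> edge_offset p m k y = edge_offset p m k x)"
    using eventually_edge_term[OF ne p] q unfolding q_def
    by (intro eventually_ball_finite[OF finK]) auto
  then show ?thesis using near
  proof eventually_elim
    case (elim y)
    have sub: "{k. height_step (snd p) tq (snd y' + of_int k) \<noteq> 0} \<subseteq> K" "edge_hits p m tq y' \<subseteq> K"
      if "y' = y \<or> y' = x" for y'
      using elim(2,3) that unfolding K_def height_step_def edge_hits_def
      by (auto simp: min_def max_def split: if_splits)
    let ?sg = "if snd p < tq then 1 else -1 :: int"
    have "edge_count p m tq y = 
       (\<Sum>k\<in>K. height_step (snd p) tq (snd y + of_int k) * \<lfloor>edge_offset p m k y\<rfloor>)"
      using edge_count_superset[OF finK] sub by blast
    also have "\<dots> = (\<Sum>k\<in>K. height_step (snd p) tq (snd x + of_int k) * \<lfloor>edge_offset p m k x\<rfloor>)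
       + of_bool (snd y < snd x) *
        ((\<Sum>k\<in>K. of_bool (snd x + of_int k = tq) * \<lfloor>fst x - fst q\<rfloor>) -
        (\<Sum>k\<in>K. of_bool (snd x + of_int k = snd p) * \<lfloor>fst x - fst p\<rfloor>))
       - (\<Sum>k\<in>K. if k \<in> edge_hits p m tq x
        then ?sg * of_bool (edge_offset p m k y < edge_offset p m k x)
        else 0)"
      using elim(1) by (simp add: sum.distrib sum_subtractf sum_distrib_left right_diff_distrib cong: sum.cong)
    also have "(\<Sum>k\<in>K. if k \<in> edge_hits p m tq x
        then ?sg * of_bool (edge_offset p m k y < edge_offset p m k x) else 0)
        = (\<Sum>k\<in>edge_hits p m tq x. ?sg * of_bool (edge_offset p m k y < edge_offset p m k x))"
      using sub[of x] finK by (simp add: sum.If_cases Int_absorb1)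
    also have "\<dots> = ?sg * (\<Sum>k\<in>edge_hits p m tq x. of_bool (edge_offset p m k y < edge_offset p m k x))"
      by (simp only: sum_distrib_left)
    finally have "edge_count p m tq y = edge_count p m tq x + of_bool (snd y < snd x) *
        (of_bool (snd x - snd q \<in> \<int>) * \<lfloor>fst x - fst q\<rfloor> -
        of_bool (snd x - snd p \<in> \<int>) * \<lfloor>fst x - fst p\<rfloor>)
        - ?sg * (\<Sum>k\<in>edge_hits p m tq x. of_bool (edge_offset p m k y < edge_offset p m k x))"
      using edge_count_superset[OF finK, of p tq x m] sub(1)[of x] pK[of tq] pK[of "snd p"]
      by (simp add: q_def)
    moreover have "\<forall>k\<in>edge_hits p m tq y. k \<in> edge_hits p m tq x \<and> edge_offset p m k y = edge_offset p m k x"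
      using elim(1) sub(2)[of y] by blast
    ultimately show ?case by blast
  qed
qed

lemma sum_height_step:
  "(\<Sum>k | height_step tp tq (t + of_int k) \<noteq> 0. height_step tp tq (t + of_int k)) = \<lfloor>t - tp\<rfloor> - \<lfloor>t - tq\<rfloor>"
proof -
  have lec: "c \<le> t + of_int k \<longleftrightarrow> - \<lfloor>t - c\<rfloor> \<le> k" for c k by linarith
  have lec': "t + of_int k < c \<longleftrightarrow> k < - \<lfloor>t - c\<rfloor>" for c k by linarith
  show ?thesis
  proof (cases "tp \<le> tq")
    case True
    then have mono: "\<lfloor>t - tq\<rfloor> \<le> \<lfloor>t - tp\<rfloor>" by (intro floor_mono) simp
    then have s: "{k. height_step tp tq (t + of_int k) \<noteq> 0} = {- \<lfloor>t - tp\<rfloor>..< - \<lfloor>t - tq\<rfloor>}"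
      using True
      by (auto simp: height_step_def lec split: if_splits)
    have "(\<Sum>k\<in>{- \<lfloor>t - tp\<rfloor>..< - \<lfloor>t - tq\<rfloor>}. height_step tp tq (t + of_int k)) = (\<Sum>k\<in>{- \<lfloor>t - tp\<rfloor>..< - \<lfloor>t - tq\<rfloor>}. 1)"
      by (rule sum.cong) (auto simp: height_step_def lec)
    then show ?thesis unfolding s using mono by simp
  next
    case False
    then have mono: "\<lfloor>t - tp\<rfloor> \<le> \<lfloor>t - tq\<rfloor>" by (intro floor_mono) simp
    then have s: "{k. height_step tp tq (t + of_int k) \<noteq> 0} = {- \<lfloor>t - tq\<rfloor>..< - \<lfloor>t - tp\<rfloor>}"
      by (auto simp: height_step_def lec split: if_splits)
    have "(\<Sum>k\<in>{- \<lfloor>t - tq\<rfloor>..< - \<lfloor>t - tp\<rfloor>}. height_step tp tq (t + of_int k)) = (\<Sum>k\<in>{- \<lfloor>t - tq\<rfloor>..< - \<lfloor>t - tp\<rfloor>}. -1)"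
      by (rule sum.cong) (auto simp: height_step_def lec)
    then show ?thesis unfolding s using mono by simp
  qed
qed

text \<open>A vertical shift only reindexes \<open>k\<close>; a horizontal one adds \<open>i\<close>
  to every floor, weighted by the height steps.\<close>

lemma edge_count_shift:
  "edge_count p m tq (fst x + of_int i, snd x + of_int j) =
     edge_count p m tq x + i * (\<lfloor>snd x - snd p\<rfloor> - \<lfloor>snd x - tq\<rfloor>)"
proof -
  let ?S = "{k. height_step (snd p) tq (snd x + of_int k) \<noteq> 0}"
  have off: "edge_offset p m k (fst x + of_int i, snd x + of_int j) = edge_offset p m (k + j) x + of_int i" for k
    by (simp add: edge_offset_def algebra_simps)
  have "edge_count p m tq (fst x + of_int i, snd x + of_int j) =
     (\<Sum>k\<in>?S. height_step (snd p) tq (snd x + of_int k) * \<lfloor>edge_offset p m k x + of_int i\<rfloor>)"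
    unfolding edge_count_def off
    by (rule sum.reindex_bij_witness[where i="\<lambda>k. k - j" and j="\<lambda>k. k + j"]) (auto simp: add_ac)
  also have "\<dots> = edge_count p m tq x + i * (\<Sum>k\<in>?S. height_step (snd p) tq (snd x + of_int k))"
    unfolding edge_count_def by (simp add: sum.distrib sum_distrib_left algebra_simps)
  finally show ?thesis by (simp add: sum_height_step)
qed

section \<open>Coordinates with respect to a basis of the lattice\<close>

definition lattice_coord :: "(nat \<Rightarrow> real \<times> real) \<Rightarrow> real \<times> real \<Rightarrow> real \<times> real" where
  "lattice_coord b x = (det2 x (b 1) / det2 (b 0) (b 1), det2 (b 0) x / det2 (b 0) (b 1))"

lemma lattice_coord_add: "lattice_coord b (x + y) = lattice_coord b x + lattice_coord b y"
  and lattice_coord_diff: "lattice_coord b (x - y) = lattice_coord b x - lattice_coord b y"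
  and lattice_coord_scaleR: "lattice_coord b (r *\<^sub>R x) = r *\<^sub>R lattice_coord b x"
  and lattice_coord_0: "lattice_coord b 0 = 0"
  by (simp_all add: lattice_coord_def det2_def add_divide_distrib diff_divide_distrib
        algebra_simps prod_eq_iff)

lemma lattice_coord_sum: "lattice_coord b (sum f A) = (\<Sum>i\<in>A. lattice_coord b (f i))"
  by (induction A rule: infinite_finite_induct) (simp_all add: lattice_coord_add lattice_coord_0)

lemma lattice_coord_eq:
  assumes "det2 (b 0) (b 1) \<noteq> 0"
  shows "x = fst (lattice_coord b x) *\<^sub>R b 0 + snd (lattice_coord b x) *\<^sub>R b 1"
  using assms by (simp add: lattice_coord_def prod_eq_iff field_simps) (simp add: det2_def algebra_simps)

lemma lattice_coord_combination:
  assumes "det2 (b 0) (b 1) \<noteq> 0"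
  shows "lattice_coord b (i *\<^sub>R b 0 + j *\<^sub>R b 1) = (i, j)"
  using assms by (simp add: lattice_coord_def prod_eq_iff field_simps) (simp add: det2_def algebra_simps)

lemma lattice_mem_iff:
  assumes "lattice_basis \<Lambda> b"
  shows "x \<in> \<Lambda> \<longleftrightarrow> fst (lattice_coord b x) \<in> \<int> \<and> snd (lattice_coord b x) \<in> \<int>"
proof -
  have D: "det2 (b 0) (b 1) \<noteq> 0" and L: "\<Lambda> = {of_int i *\<^sub>R b 0 + of_int j *\<^sub>R b 1 | i j :: int. True}"
    using assms by (auto simp: lattice_basis_def)
  show ?thesis
  proof
    assume "x \<in> \<Lambda>"
    then show "fst (lattice_coord b x) \<in> \<int> \<and> snd (lattice_coord b x) \<in> \<int>"
      unfolding L using lattice_coord_combination[OF D] by auto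
  next
    assume "fst (lattice_coord b x) \<in> \<int> \<and> snd (lattice_coord b x) \<in> \<int>"
    then obtain i j where "fst (lattice_coord b x) = of_int i" "snd (lattice_coord b x) = of_int j"
      by (auto elim!: Ints_cases)
    then show "x \<in> \<Lambda>" unfolding L using lattice_coord_eq[where x = x, OF D] by auto
  qed
qed

lemma det2_lattice_coord:
  assumes "det2 (b 0) (b 1) \<noteq> 0"
  shows "det2 (lattice_coord b x) (lattice_coord b y) = det2 x y / det2 (b 0) (b 1)"
proof -
  have "det2 x (b 1) * det2 (b 0) y - det2 (b 0) x * det2 y (b 1) = det2 x y * det2 (b 0) (b 1)"
    by (simp add: det2_def algebra_simps)
  moreover have "det2 (lattice_coord b x) (lattice_coord b y) =
      (det2 x (b 1) * det2 (b 0) y - det2 (b 0) x * det2 y (b 1)) / (det2 (b 0) (b 1) * det2 (b 0) (b 1))"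
    unfolding det2_def[of "lattice_coord b x"] by (simp add: lattice_coord_def diff_divide_distrib)
  ultimately show ?thesis using assms by simp
qed

lemma lattice_coord_vector_derivative:
  assumes "(f has_vector_derivative v) F"
  shows "((\<lambda>t. lattice_coord b (f t)) has_vector_derivative lattice_coord b v) F"
proof -
  have "bounded_linear (lattice_coord b)"
    by (rule linear_conv_bounded_linear[THEN iffD1])
       (rule linearI; rule lattice_coord_add lattice_coord_scaleR)
  then show ?thesis using assms by (rule bounded_linear.has_vector_derivative)
qed

lemma lattice_coord_continuous: "continuous_on S f \<Longrightarrow> continuous_on S (\<lambda>t. lattice_coord b (f t))"
  unfolding lattice_coord_def det2_def divide_inverse by (intro continuous_intros)

text \<open>For fixed \<open>v\<close> the determinant is affine in \<open>n\<close>. If it vanished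
  for two values of \<open>n\<close>, then \<open>v\<close> would be parallel to both
  \<open>x\<close> and \<open>y\<close>, hence zero; so each \<open>v\<close> excludes at most one
  \<open>n\<close>.\<close>

lemma finite_vectors_nonparallel:
  assumes "finite A" "\<And>v. v \<in> A \<Longrightarrow> v \<noteq> 0" "det2 x y \<noteq> (0::real)"
  shows "\<exists>n::int. \<forall>v\<in>A. det2 (x + of_int n *\<^sub>R y) v \<noteq> 0"
proof -
  have lin: "det2 (x + of_int n *\<^sub>R y) v = det2 x v + of_int n * det2 y v" for n :: int and v
    by (simp add: det2_def algebra_simps)
  have one: "n = n'" if "v \<in> A" "det2 (x + of_int n *\<^sub>R y) v = 0" "det2 (x + of_int n' *\<^sub>R y) v = 0" for v and n n' :: int
  proof (rule ccontr)
    assume "n \<noteq> n'"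
    have "(of_int n - of_int n') * det2 y v = 0" using that unfolding lin by algebra
    then have y: "det2 y v = 0" using \<open>n \<noteq> n'\<close> by simp
    then have x: "det2 x v = 0" using that lin by simp
    have "fst v * det2 x y = 0" "snd v * det2 x y = 0"
      using x y unfolding det2_def by algebra+
    then show False using assms that by (auto simp: prod_eq_iff)
  qed
  have "finite {n::int. det2 (x + of_int n *\<^sub>R y) v = 0}" if "v \<in> A" for v
  proof (cases "{n::int. det2 (x + of_int n *\<^sub>R y) v = 0} = {}")
    case False
    then obtain n where "det2 (x + of_int n *\<^sub>R y) v = 0" by auto
    then have "{n::int. det2 (x + of_int n *\<^sub>R y) v = 0} \<subseteq> {n}" using one[OF that] by auto
    then show ?thesis using finite_subset by blast
  qed simp
  then have "finite (\<Union>v\<in>A. {n::int. det2 (x + of_int n *\<^sub>R y) v = 0})" using assms by auto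
  then have "\<exists>n. n \<notin> (\<Union>v\<in>A. {n::int. det2 (x + of_int n *\<^sub>R y) v = 0})"
    using ex_new_if_finite infinite_UNIV_int by blast
  then show ?thesis by auto
qed

lemma lattice_basis_shear:
  assumes "lattice_basis \<Lambda> b"
  shows "lattice_basis \<Lambda> (\<lambda>i. if i = 0 then b 0 + of_int n *\<^sub>R b 1 else b i)"
proof -
  have "(\<exists>i j::int. x = of_int i *\<^sub>R b 0 + of_int j *\<^sub>R b 1) \<longleftrightarrow>
      (\<exists>i j::int. x = of_int i *\<^sub>R (b 0 + of_int n *\<^sub>R b 1) + of_int j *\<^sub>R b 1)" for x
  proof safe
    fix i j :: int
    show "\<exists>i' j'::int. of_int i *\<^sub>R b 0 + of_int j *\<^sub>R b 1 = of_int i' *\<^sub>R (b 0 + of_int n *\<^sub>R b 1) + of_int j' *\<^sub>R b 1"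
      by (rule exI[of _ i], rule exI[of _ "j - i * n"]) (simp add: algebra_simps)
    show "\<exists>i' j'::int. of_int i *\<^sub>R (b 0 + of_int n *\<^sub>R b 1) + of_int j *\<^sub>R b 1 = of_int i' *\<^sub>R b 0 + of_int j' *\<^sub>R b 1"
      by (rule exI[of _ i], rule exI[of _ "j + i * n"]) (simp add: algebra_simps)
  qed
  moreover have "det2 (b 0 + of_int n *\<^sub>R b 1) (b 1) = det2 (b 0) (b 1)"
    by (simp add: det2_def algebra_simps)
  ultimately show ?thesis using assms by (simp add: lattice_basis_def)
qed

section \<open>Graphs mapped to the torus and the potential of a cycle\<close>

definition integral_cycle :: "('v, 'e) tcurve \<Rightarrow> ('e \<Rightarrow> int) \<Rightarrow> bool" where
  "integral_cycle G z \<longleftrightarrow> (\<forall>v\<in>verts G.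
     (\<Sum>e | e \<in> edges G \<and> tgt G e = v. z e) = (\<Sum>e | e \<in> edges G \<and> src G e = v. z e))"

text \<open>At a transverse crossing the determinant is nonzero, so the value \<open>-1\<close> is
  taken exactly at the negative crossings.\<close>

definition crossing_sign :: "('v, 'e) tcurve \<Rightarrow> (real \<Rightarrow> real \<times> real) \<Rightarrow> real \<Rightarrow> 'e \<Rightarrow> int" where
  "crossing_sign G \<rho> t e = (if det2 (vector_derivative \<rho> (at t)) (rvec (dir G e)) > 0 then 1 else -1)"

text \<open>Neither balancing nor a bound on the valence is part of this setting, so that it covers
  graphs subdivided at marked points.\<close>

locale torus_graph =
  fixes \<Lambda> :: "(real \<times> real) set" and b :: "nat \<Rightarrow> real \<times> real" and G :: "('v, 'e) tcurve"
  assumes lattice: "lattice_basis \<Lambda> b"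
    and finite_verts: "finite (verts G)"
    and finite_edges: "finite (edges G)"
    and src_in: "e \<in> edges G \<Longrightarrow> src G e \<in> verts G"
    and tgt_in: "e \<in> edges G \<Longrightarrow> tgt G e \<in> verts G"
    and len_pos: "e \<in> edges G \<Longrightarrow> len G e > 0"
    and wt_pos: "e \<in> edges G \<Longrightarrow> wt G e > 0"
    and dir_nonzero: "e \<in> edges G \<Longrightarrow> dir G e \<noteq> 0"
    and edge_closes: "e \<in> edges G \<Longrightarrow> edge_pt G e (len G e) - pos G (tgt G e) \<in> \<Lambda>"
begin

abbreviation "\<kappa> \<equiv> lattice_coord b"
abbreviation "fibre \<equiv> edge_fibre \<Lambda> G"

lemma det_basis: "det2 (b 0) (b 1) \<noteq> 0"
  using lattice by (simp add: lattice_basis_def)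

lemma displacement_eq: "displacement G e = (len G e * real (wt G e)) *\<^sub>R rvec (dir G e)"
  by (simp add: displacement_def slope_def smul_def rvec_def)

text \<open>Discrete Stokes formula: a cycle pairs to zero with the coboundary of \<open>h\<close>.
  Through it all contributions of vertices to the potential cancel.\<close>

lemma cycle_balance:
  fixes h :: "'v \<Rightarrow> 'a::comm_ring_1"
  assumes "integral_cycle G z"
  shows "(\<Sum>e\<in>edges G. of_int (z e) * h (tgt G e)) = (\<Sum>e\<in>edges G. of_int (z e) * h (src G e))"
proof -
  have *: "(\<Sum>e\<in>edges G. of_int (z e) * h (f e)) = (\<Sum>v\<in>verts G. of_int (\<Sum>e | e \<in> edges G \<and> f e = v. z e) * h v)"
    if "\<And>e. e \<in> edges G \<Longrightarrow> f e \<in> verts G" for f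
  proof -
    have "(\<Sum>e\<in>edges G. of_int (z e) * h (f e)) = (\<Sum>v\<in>verts G. \<Sum>e | e \<in> edges G \<and> f e = v. of_int (z e) * h (f e))"
      by (rule sum.group[symmetric]) (use finite_edges finite_verts that in auto)
    also have "\<dots> = (\<Sum>v\<in>verts G. of_int (\<Sum>e | e \<in> edges G \<and> f e = v. z e) * h v)"
      by (rule sum.cong) (auto simp: of_int_sum sum_distrib_right)
    finally show ?thesis .
  qed
  have "(\<Sum>v\<in>verts G. of_int (\<Sum>e | e \<in> edges G \<and> tgt G e = v. z e) * h v)
      = (\<Sum>v\<in>verts G. of_int (\<Sum>e | e \<in> edges G \<and> src G e = v. z e) * h v)"
    using assms by (intro sum.cong) (auto simp: integral_cycle_def)
  then show ?thesis
    using *[of "tgt G", OF tgt_in] *[of "src G", OF src_in] by simp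
qed

end

text \<open>Without horizontal edges, in lattice coordinates, every edge is parametrized by its
  height, as \<open>edge_count\<close> requires.\<close>

locale transversal_torus_graph = torus_graph \<Lambda> b G
  for \<Lambda> :: "(real \<times> real) set" and b and G :: "('v, 'e) tcurve" +
  assumes not_horizontal: "e \<in> edges G \<Longrightarrow> snd (\<kappa> (displacement G e)) \<noteq> 0"
begin

abbreviation "start e \<equiv> \<kappa> (pos G (src G e))"
abbreviation "step e \<equiv> \<kappa> (displacement G e)"
abbreviation "incl e \<equiv> fst (step e) / snd (step e)"
abbreviation "final e \<equiv> start e + step e"
abbreviation "floors e \<equiv> edge_count (start e) (incl e) (snd (final e))"
abbreviation "shift e \<equiv> final e - \<kappa> (pos G (tgt G e))"

lemma final_eq: "e \<in> edges G \<Longrightarrow> final e = (fst (start e) + (snd (final e) - snd (start e)) * incl e, snd (final e))"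
  using not_horizontal[of e] by (simp add: prod_eq_iff)

lemma shift_int:
  assumes "e \<in> edges G"
  shows "fst (shift e) = of_int \<lfloor>fst (shift e)\<rfloor>" "snd (shift e) = of_int \<lfloor>snd (shift e)\<rfloor>"
proof -
  have "final e = \<kappa> (edge_pt G e (len G e))"
    by (simp add: edge_pt_def displacement_def lattice_coord_add)
  then have "fst (shift e) \<in> \<int>" "snd (shift e) \<in> \<int>"
    using edge_closes[OF assms] lattice_mem_iff[OF lattice] by (auto simp: lattice_coord_diff)
  then show "fst (shift e) = of_int \<lfloor>fst (shift e)\<rfloor>" "snd (shift e) = of_int \<lfloor>snd (shift e)\<rfloor>"
    by (metis Ints_cases floor_of_int)+
qed

text \<open>
  The potential of the periodic lift of the cycle \<open>z\<close>: at \<open>x\<close>, in coordinates given by the basis of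
  \<open>\<Lambda>\<close>, every point of an edge at the height of \<open>x\<close> modulo \<open>1\<close> contributes the regularized number of its
  integer translates to the left of \<open>x\<close>.  The last term corrects the jumps at the heights of
  the vertices, so that the function is locally constant off the graph.
\<close>

definition level :: "('e \<Rightarrow> int) \<Rightarrow> real \<times> real \<Rightarrow> int" where
  "level z x = (\<Sum>e\<in>edges G. z e * (floors e x
      - \<lfloor>fst (shift e)\<rfloor> * \<lfloor>snd x - snd (final e)\<rfloor>))"

text \<open>The potential is only quasi-periodic: its period along an integer vector is the
  determinant of that vector with the class of \<open>z\<close>. This is where homology
  enters.\<close>

lemma level_shift:
  assumes "integral_cycle G z"
  shows "real_of_int (level z (fst x + of_int i, snd x + of_int j)) =
     of_int (level z x) + of_int i * snd (\<kappa> (hclass G z)) - of_int j * fst (\<kappa> (hclass G z))"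
proof -
  let ?pt = "\<lambda>e. \<kappa> (pos G (tgt G e))"
  have fl: "\<lfloor>t - snd (final e)\<rfloor> = \<lfloor>t - snd (?pt e)\<rfloor> - \<lfloor>snd (shift e)\<rfloor>" if "e \<in> edges G" for e t
  proof -
    have "t - snd (final e) = t - snd (?pt e) - of_int \<lfloor>snd (shift e)\<rfloor>"
      using shift_int(2)[OF that] by simp
    then show ?thesis by (metis floor_diff_of_int)
  qed
  have cyc: "(\<Sum>e\<in>edges G. z e * \<lfloor>snd x - snd (?pt e)\<rfloor>) = (\<Sum>e\<in>edges G. z e * \<lfloor>snd x - snd (start e)\<rfloor>)"
    using cycle_balance[OF assms, of "\<lambda>v. \<lfloor>snd x - snd (\<kappa> (pos G v))\<rfloor>"] by simp
  have "level z (fst x + of_int i, snd x + of_int j) = (\<Sum>e\<in>edges G.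
      z e * (floors e x - \<lfloor>fst (shift e)\<rfloor> * \<lfloor>snd x - snd (final e)\<rfloor>)
      + i * (z e * \<lfloor>snd x - snd (start e)\<rfloor>) - i * (z e * \<lfloor>snd x - snd (?pt e)\<rfloor>)
      + i * (z e * \<lfloor>snd (shift e)\<rfloor>) - j * (z e * \<lfloor>fst (shift e)\<rfloor>))"
    unfolding level_def edge_count_shift
  proof (rule sum.cong[OF refl])
    fix e assume e: "e \<in> edges G"
    have "\<lfloor>snd x + of_int j - snd (final e)\<rfloor> = \<lfloor>snd x - snd (final e)\<rfloor> + j"
      by (metis add_diff_eq diff_add_eq floor_add_int)
    then show "z e * (floors e x +
        i * (\<lfloor>snd x - snd (start e)\<rfloor> - \<lfloor>snd x - snd (final e)\<rfloor>) -
        \<lfloor>fst (shift e)\<rfloor> * \<lfloor>snd (fst x + real_of_int i, snd x + real_of_int j) - snd (final e)\<rfloor>) =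
      z e * (floors e x - \<lfloor>fst (shift e)\<rfloor> * \<lfloor>snd x - snd (final e)\<rfloor>)
      + i * (z e * \<lfloor>snd x - snd (start e)\<rfloor>) - i * (z e * \<lfloor>snd x - snd (?pt e)\<rfloor>)
      + i * (z e * \<lfloor>snd (shift e)\<rfloor>) - j * (z e * \<lfloor>fst (shift e)\<rfloor>)"
      using fl[OF e, of "snd x"] by (simp only: snd_conv) (simp add: algebra_simps)
  qed
  also have "\<dots> = level z x + i * (\<Sum>e\<in>edges G. z e * \<lfloor>snd (shift e)\<rfloor>) - j * (\<Sum>e\<in>edges G. z e * \<lfloor>fst (shift e)\<rfloor>)"
    using cyc by (simp add: sum.distrib sum_subtractf level_def sum_distrib_left[symmetric])
  finally have main: "level z (fst x + of_int i, snd x + of_int j) = \<dots>" .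
  \<comment> \<open>The lift of an edge ends at the chosen representative of its target plus
    \<open>shift\<close>. Summed over a cycle the representatives cancel, and the shifts add up to
    the total displacement.\<close>
  have co: "of_int (\<Sum>e\<in>edges G. z e * \<lfloor>f (shift e)\<rfloor>) = f (\<kappa> (hclass G z))"
    if f: "f = fst \<or> f = snd" for f :: "real \<times> real \<Rightarrow> real"
  proof -
    have lin: "f (x + y) = f x + f y" "f (x - y) = f x - f y" "f (r *\<^sub>R x) = r * f x" for x y r
      using f by auto
    have linsum: "f (sum h A) = (\<Sum>e\<in>A. f (h e))" for h :: "'e \<Rightarrow> real \<times> real" and A
      using f by (auto simp: fst_sum snd_sum)
    have "of_int (\<Sum>e\<in>edges G. z e * \<lfloor>f (shift e)\<rfloor>) = (\<Sum>e\<in>edges G. of_int (z e) * f (shift e))"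
      using shift_int f by (auto simp: intro!: sum.cong)
    also have "\<dots> = (\<Sum>e\<in>edges G. of_int (z e) * f (step e)) + 
        ((\<Sum>e\<in>edges G. of_int (z e) * f (start e)) - (\<Sum>e\<in>edges G. of_int (z e) * f (?pt e)))"
      by (simp add: lin sum.distrib[symmetric] sum_subtractf[symmetric] algebra_simps)
    also have "\<dots> = (\<Sum>e\<in>edges G. of_int (z e) * f (step e))"
      using cycle_balance[OF assms, of "\<lambda>v. f (\<kappa> (pos G v))"] by simp
    finally show ?thesis
      by (simp add: hclass_def lattice_coord_sum lattice_coord_scaleR linsum lin)
  qed
  show ?thesis unfolding main by (simp only: of_int_add of_int_diff of_int_mult co[of fst] co[of snd] simp_thms)
qed

abbreviation "hits e x \<equiv> edge_hits (start e) (incl e) (snd (final e)) x"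
abbreviation "offset e k x \<equiv> edge_offset (start e) (incl e) k x"
abbreviation "slant e \<equiv> (if snd (start e) < snd (final e) then 1 else -1 :: int)"

text \<open>Only the translates of edges through \<open>x\<close> contribute to the variation of the
  potential near \<open>x\<close>: the jumps at the heights of vertices are values of a function on
  the vertices, taken at target minus source, and cancel for a cycle.\<close>

lemma eventually_level:
  assumes z: "integral_cycle G z" and X: "X \<notin> lifted_vertices \<Lambda> G"
  defines "x \<equiv> \<kappa> X"
  shows "\<forall>\<^sub>F y in nhds x.
     level z y = level z x - (\<Sum>e\<in>edges G. z e * slant e * (\<Sum>k\<in>hits e x. of_bool (offset e k y < offset e k x))) \<and>
     (\<forall>e\<in>edges G. \<forall>k\<in>hits e y. k \<in> hits e x \<and> offset e k y = offset e k x)"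
proof -
  let ?pt = "\<lambda>e. \<kappa> (pos G (tgt G e))"
  define q where "q e = (fst (start e) + (snd (final e) - snd (start e)) * incl e, snd (final e))" for e
  have q: "q e = final e" if "e \<in> edges G" for e
    unfolding q_def using final_eq[OF that] by simp
  have nv: "\<not> (fst x - fst (\<kappa> (pos G v)) \<in> \<int> \<and> snd x - snd (\<kappa> (pos G v)) \<in> \<int>)"
    if "v \<in> verts G" for v
    using X that lattice_mem_iff[OF lattice, of "X - pos G v"]
    by (auto simp: lifted_vertices_def x_def lattice_coord_diff)
  have sh: "u - fst (final e) = u - fst (?pt e) - of_int \<lfloor>fst (shift e)\<rfloor>"
           "u - snd (final e) = u - snd (?pt e) - of_int \<lfloor>snd (shift e)\<rfloor>" if "e \<in> edges G" for u e
    using shift_int[OF that] by simp_all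
  have shI: "u - fst (final e) \<in> \<int> \<longleftrightarrow> u - fst (?pt e) \<in> \<int>" "u - snd (final e) \<in> \<int> \<longleftrightarrow> u - snd (?pt e) \<in> \<int>"
    if "e \<in> edges G" for u e
    unfolding sh[OF that] by (metis Ints_add Ints_diff Ints_of_int diff_add_cancel)+
  let ?R = "\<lambda>e y. floors e y = floors e x + of_bool (snd y < snd x) *
      (of_bool (snd x - snd (final e) \<in> \<int>) * \<lfloor>fst x - fst (final e)\<rfloor> -
       of_bool (snd x - snd (start e) \<in> \<int>) * \<lfloor>fst x - fst (start e)\<rfloor>)
      - slant e * (\<Sum>k\<in>hits e x. of_bool (offset e k y < offset e k x)) \<and>
     (\<forall>k\<in>hits e y. k \<in> hits e x \<and> offset e k y = offset e k x)"
  let ?H = "\<lambda>e y. \<lfloor>snd y - snd (final e)\<rfloor> =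
      \<lfloor>snd x - snd (final e)\<rfloor> - of_bool (snd y < snd x) * of_bool (snd x - snd (final e) \<in> \<int>)"
  have count: "\<forall>\<^sub>F y in nhds x. ?R e y"
    if e: "e \<in> edges G" for e
  proof -
    have "snd (start e) \<noteq> snd (final e)" using not_horizontal[OF e] by simp
    moreover have "\<not> (fst x - fst (start e) \<in> \<int> \<and> snd x - snd (start e) \<in> \<int>)"
      using nv[OF src_in[OF e]] .
    moreover have "\<not> (fst x - fst (q e) \<in> \<int> \<and> snd x - snd (q e) \<in> \<int>)"
      unfolding q[OF e] shI[OF e] using nv[OF tgt_in[OF e]] .
    ultimately show ?thesis
      using eventually_edge_count[of "start e" "snd (final e)" x "incl e", folded q_def] q[OF e] by simp
  qed
  have fl: "\<forall>\<^sub>F y in nhds x. ?H e y" for e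
  proof -
    have c: "continuous (at x) (\<lambda>y. snd y - snd (final e))" by (intro continuous_intros)
    show ?thesis
    proof (cases "snd x - snd (final e) \<in> \<int>")
      case True
      show ?thesis using eventually_floor_int[OF c True] by eventually_elim (use True in simp)
    next
      case False
      show ?thesis using eventually_floor_nonint[OF c False] by eventually_elim (use False in simp)
    qed
  qed
  have "\<forall>\<^sub>F y in nhds x. \<forall>e\<in>edges G. ?R e y \<and> ?H e y"
    by (rule eventually_ball_finite[OF finite_edges], rule ballI, rule eventually_conj[OF count fl])
  then show ?thesis
  proof eventually_elim
    case (elim y)
    define g where "g v = of_bool (snd x - snd (\<kappa> (pos G v)) \<in> \<int>) * \<lfloor>fst x - fst (\<kappa> (pos G v))\<rfloor>" for v
    have ed: "z e * (floors e y - \<lfloor>fst (shift e)\<rfloor> * \<lfloor>snd y - snd (final e)\<rfloor>)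
       = z e * (floors e x - \<lfloor>fst (shift e)\<rfloor> * \<lfloor>snd x - snd (final e)\<rfloor>)
        + of_bool (snd y < snd x) * (z e * g (tgt G e)) - of_bool (snd y < snd x) * (z e * g (src G e))
        - z e * slant e * (\<Sum>k\<in>hits e x. of_bool (offset e k y < offset e k x))"
      if e: "e \<in> edges G" for e
    proof -
      \<comment> \<open>The end of the lifted edge is an integer translate of the representative of
        the target. The horizontal part of this translation is what the last term of
        \<open>level\<close> compensates.\<close>
      have fe: "\<lfloor>fst x - fst (final e)\<rfloor> = \<lfloor>fst x - fst (?pt e)\<rfloor> - \<lfloor>fst (shift e)\<rfloor>"
        using sh(1)[OF e] by (metis floor_diff_of_int)
      have c: "floors e y =
         floors e x + of_bool (snd y < snd x) *
          (of_bool (snd x - snd (?pt e) \<in> \<int>) * (\<lfloor>fst x - fst (?pt e)\<rfloor> - \<lfloor>fst (shift e)\<rfloor>) - g (src G e))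
         - slant e * (\<Sum>k\<in>hits e x. of_bool (offset e k y < offset e k x))"
        using bspec[OF elim e, THEN conjunct1, THEN conjunct1] unfolding shI(2)[OF e] fe g_def .
      have f: "\<lfloor>snd y - snd (final e)\<rfloor> = \<lfloor>snd x - snd (final e)\<rfloor> -
          of_bool (snd y < snd x) * of_bool (snd x - snd (?pt e) \<in> \<int>)"
        using bspec[OF elim e, THEN conjunct2] unfolding shI(2)[OF e] .
      have alg: "w * (cx + ob * (B * (F - sf) - gs) - sl * S - sf * (fx - ob * B)) =
          w * (cx - sf * fx) + ob * (w * (B * F)) - ob * (w * gs) - w * sl * S"
        for w cx ob B F sf gs sl S fx :: int by (simp add: algebra_simps)
      show ?thesis unfolding c f g_def[of "tgt G e"] by (rule alg)
    qed
    have "level z y = (\<Sum>e\<in>edges G.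
        z e * (floors e x - \<lfloor>fst (shift e)\<rfloor> * \<lfloor>snd x - snd (final e)\<rfloor>)
        + of_bool (snd y < snd x) * (z e * g (tgt G e)) - of_bool (snd y < snd x) * (z e * g (src G e))
        - z e * slant e * (\<Sum>k\<in>hits e x. of_bool (offset e k y < offset e k x)))"
      unfolding level_def by (rule sum.cong[OF refl ed])
    also have "\<dots> = level z x + of_bool (snd y < snd x) * (\<Sum>e\<in>edges G. z e * g (tgt G e))
        - of_bool (snd y < snd x) * (\<Sum>e\<in>edges G. z e * g (src G e))
        - (\<Sum>e\<in>edges G. z e * slant e * (\<Sum>k\<in>hits e x. of_bool (offset e k y < offset e k x)))"
      unfolding level_def by (simp only: sum.distrib sum_subtractf sum_distrib_left)
    finally have "level z y = \<dots>" .
    moreover have "(\<Sum>e\<in>edges G. z e * g (tgt G e)) = (\<Sum>e\<in>edges G. z e * g (src G e))"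
      using cycle_balance[OF z, of g] by simp
    ultimately show ?case using elim by simp
  qed
qed

text \<open>On an edge that is not horizontal the height determines the parameter, so the integers
  \<open>k\<close> label the preimages of \<open>X\<close> on the edge.\<close>

lemma hits_fibre:
  assumes e: "e \<in> edges G"
  shows "bij_betw (\<lambda>k. len G e * (snd (\<kappa> X) + of_int k - snd (start e)) / snd (step e))
      (hits e (\<kappa> X)) {s. (e, s) \<in> fibre X}"
proof -
  let ?x = "\<kappa> X" and ?d = "snd (step e)" and ?L = "len G e"
  have d: "?d \<noteq> 0" and L: "?L > 0" using not_horizontal[OF e] len_pos[OF e] by auto
  have pt: "\<kappa> (edge_pt G e s) = start e + (s / ?L) *\<^sub>R step e" for s
  proof -
    have "edge_pt G e s = pos G (src G e) + (s / ?L) *\<^sub>R displacement G e"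
      using L by (simp add: edge_pt_def displacement_def)
    then show ?thesis by (simp add: lattice_coord_add lattice_coord_scaleR)
  qed
  let ?f = "\<lambda>k. ?L * (snd ?x + of_int k - snd (start e)) / ?d"
  have key: "(e, ?f k) \<in> fibre X \<longleftrightarrow> k \<in> hits e ?x" for k :: int
  proof -
    have s: "?f k / ?L = (snd ?x + of_int k - snd (start e)) / ?d" using L by simp
    have "0 < ?f k \<and> ?f k < ?L \<longleftrightarrow> 0 < ?f k / ?L \<and> ?f k / ?L < 1"
      using L zero_less_divide_iff[of "?f k" ?L] pos_divide_less_eq[of ?L "?f k" 1] by auto
    also have "\<dots> \<longleftrightarrow> (snd (start e) < snd ?x + of_int k \<and> snd ?x + of_int k < snd (final e) \<or>
        snd (final e) < snd ?x + of_int k \<and> snd ?x + of_int k < snd (start e))"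
      unfolding s using d by (cases "?d > 0") (auto simp: zero_less_divide_iff divide_less_eq)
    finally have 1: "0 < ?f k \<and> ?f k < ?L \<longleftrightarrow> \<dots>" .
    have "X - edge_pt G e (?f k) \<in> \<Lambda> \<longleftrightarrow> offset e k ?x \<in> \<int>"
    proof -
      let ?u = "?x - (start e + ((snd ?x + of_int k - snd (start e)) / ?d) *\<^sub>R step e)"
      have "fst ?u = offset e k ?x" by (simp add: edge_offset_def)
      moreover have "snd ?u = - of_int k" using d by simp
      ultimately show ?thesis unfolding lattice_mem_iff[OF lattice] lattice_coord_diff pt s by simp
    qed
    with 1 show ?thesis using e by (auto simp: edge_fibre_def edge_hits_def)
  qed
  have "s \<in> ?f ` hits e ?x" if s: "(e, s) \<in> fibre X" for s
  proof -
    have "X - edge_pt G e s \<in> \<Lambda>" using s by (auto simp: edge_fibre_def)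
    then obtain k where "snd ?x - snd (start e + (s / ?L) *\<^sub>R step e) = of_int k"
      unfolding lattice_mem_iff[OF lattice] lattice_coord_diff pt by (auto elim!: Ints_cases)
    then have sk: "s = ?f (- k)" using d L by (simp add: field_simps)
    have "- k \<in> hits e ?x" using s unfolding sk key .
    with sk show ?thesis by (rule image_eqI)
  qed
  moreover have "inj ?f" using d L by (auto simp: inj_on_def)
  ultimately show ?thesis unfolding bij_betw_def using key by (auto intro: inj_on_subset)
qed

lemma finite_edge_fibre: "finite (fibre X)"
proof -
  have "fibre X \<subseteq> (SIGMA e:edges G. {s. (e, s) \<in> fibre X})"
    by (auto simp: edge_fibre_def)
  moreover have "finite {s. (e, s) \<in> fibre X}" if "e \<in> edges G" for e
    using bij_betw_finite[OF hits_fibre[OF that]] finite_edge_hits by blast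
  ultimately show ?thesis using finite_edges by (meson finite_SigmaI finite_subset)
qed

end

section \<open>Jumps of the potential along a transverse loop\<close>

lemma deriv_sign:
  fixes f :: "real \<Rightarrow> real"
  assumes "(f has_real_derivative l) (at x)" "l \<noteq> 0"
  shows "\<forall>\<^sub>F y in at_right x. f y \<noteq> f x \<and> (f y < f x \<longleftrightarrow> l < 0)"
    and "\<forall>\<^sub>F y in at_left x. f y \<noteq> f x \<and> (f y < f x \<longleftrightarrow> l > 0)"
proof -
  \<comment> \<open>The factor \<open>l\<close> turns the limit into a square, so that both signs of
    \<open>l\<close> are treated at once.\<close>
  have "((\<lambda>y. (f y - f x) / (y - x) * l) \<longlongrightarrow> l * l) (at x)"
    using assms(1) unfolding has_field_derivative_iff by (intro tendsto_mult tendsto_const)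
  moreover have "l * l > 0" using assms(2) not_square_less_zero[of l] by (simp add: less_le)
  ultimately have "\<forall>\<^sub>F y in at x. (f y - f x) / (y - x) * l > 0" by (rule order_tendstoD)
  then have "\<forall>\<^sub>F y in at_right x. (f y - f x) / (y - x) * l > 0" "\<forall>\<^sub>F y in at_left x. (f y - f x) / (y - x) * l > 0"
    by (auto simp: eventually_at_split)
  moreover have "\<forall>\<^sub>F y in at_right x. x < y" "\<forall>\<^sub>F y in at_left x. y < x"
    by (simp_all add: eventually_at_filter)
  ultimately have "\<forall>\<^sub>F y in at_right x. (f y - f x) / (y - x) * l > 0 \<and> x < y"
    "\<forall>\<^sub>F y in at_left x. (f y - f x) / (y - x) * l > 0 \<and> y < x"
    by (auto intro: eventually_conj)
  then show "\<forall>\<^sub>F y in at_right x. f y \<noteq> f x \<and> (f y < f x \<longleftrightarrow> l < 0)"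
    "\<forall>\<^sub>F y in at_left x. f y \<noteq> f x \<and> (f y < f x \<longleftrightarrow> l > 0)"
    by (auto elim!: eventually_mono simp: zero_less_mult_iff mult_less_0_iff zero_less_divide_iff divide_less_0_iff)
qed

text \<open>Transversality is recorded for times in the half-open unit interval; this carries it
  from time 0 to time 1 of a loop.\<close>

lemma has_vector_derivative_translate:
  fixes f :: "real \<Rightarrow> 'a::real_normed_vector"
  assumes "\<And>t. f (t + c) = f t + l"
  shows "(f has_vector_derivative v) (at (t + c)) \<longleftrightarrow> (f has_vector_derivative v) (at t)"
proof -
  have *: "(f has_vector_derivative v) (at t)"
    if f: "\<And>t. f (t + c) = f t + l" and d: "(f has_vector_derivative v) (at (t + c))" for t c l
  proof -
    have "((\<lambda>u. u + c) has_vector_derivative 1) (at t)" by (auto intro!: derivative_eq_intros)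
    from vector_diff_chain_at[OF this d] have "(f \<circ> (\<lambda>u. u + c) has_vector_derivative v) (at t)" by simp
    then have "((\<lambda>u. f u + l - l) has_vector_derivative v - 0) (at t)"
      unfolding o_def f by (rule has_vector_derivative_diff[OF _ has_vector_derivative_const])
    then show ?thesis by simp
  qed
  have "f (u + - c) = f u + - l" for u using assms[of "u - c"] by simp
  from *[of "- c" "- l" "t + c", OF this] *[of c l t, OF assms] show ?thesis by auto
qed

context transversal_torus_graph
begin

text \<open>Multiplied by the height of \<open>step e\<close>, the derivative of the offset is the
  determinant of velocity and edge in lattice coordinates. Returning to standard coordinates
  multiplies determinants by \<open>det2 (b 0) (b 1)\<close>, which accounts for the sign of the
  basis.\<close>

lemma offset_derivative:
  assumes e: "e \<in> edges G" and d: "\<rho> differentiable at t"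
    and nz: "det2 (vector_derivative \<rho> (at t)) (rvec (dir G e)) \<noteq> 0"
  obtains l where "((\<lambda>t. offset e k (\<kappa> (\<rho> t))) has_real_derivative l) (at t)" "l \<noteq> 0"
    "slant e * (of_bool (l > 0) - of_bool (l < 0)) = (if det2 (b 0) (b 1) > 0 then 1 else -1) * crossing_sign G \<rho> t e"
proof -
  let ?v = "vector_derivative \<rho> (at t)" and ?D = "det2 (b 0) (b 1)"
  let ?w = "\<kappa> ?v"
  have "(\<rho> has_vector_derivative ?v) (at t)" using d by (simp add: vector_derivative_works)
  then have r: "((\<lambda>t. \<kappa> (\<rho> t)) has_vector_derivative ?w) (at t)"
    by (rule lattice_coord_vector_derivative)
  have f: "((\<lambda>t. fst (\<kappa> (\<rho> t))) has_real_derivative fst ?w) (at t)"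
    unfolding has_real_derivative_iff_has_vector_derivative
    using bounded_linear.has_vector_derivative[OF bounded_linear_fst r] .
  have s: "((\<lambda>t. snd (\<kappa> (\<rho> t))) has_real_derivative snd ?w) (at t)"
    unfolding has_real_derivative_iff_has_vector_derivative
    using bounded_linear.has_vector_derivative[OF bounded_linear_snd r] .
  define l where "l = fst ?w - snd ?w * incl e"
  have der: "((\<lambda>t. offset e k (\<kappa> (\<rho> t))) has_real_derivative l) (at t)"
    unfolding edge_offset_def l_def using not_horizontal[OF e] by (auto intro!: derivative_eq_intros f s)
  define c where "c = len G e * real (wt G e)"
  have c: "c > 0" using len_pos[OF e] wt_pos[OF e] by (simp add: c_def)
  have st: "snd (step e) \<noteq> 0" using not_horizontal[OF e] .
  have l: "l * snd (step e) = c * det2 ?v (rvec (dir G e)) / ?D"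
  proof -
    have "l * snd (step e) = det2 ?w (step e)" using st by (simp add: l_def det2_def algebra_simps)
    also have "\<dots> = det2 ?v (displacement G e) / ?D" by (rule det2_lattice_coord[where b = b, OF det_basis])
    also have "det2 ?v (displacement G e) = c * det2 ?v (rvec (dir G e))"
      unfolding displacement_eq c_def by (simp add: det2_def algebra_simps)
    finally show ?thesis .
  qed
  then have lnz: "l \<noteq> 0" using nz c det_basis by auto
  have "l * snd (step e) * ?D > 0 \<longleftrightarrow> det2 ?v (rvec (dir G e)) > 0"
    unfolding l using c det_basis by (simp add: zero_less_mult_iff)
  moreover have "l * snd (step e) * ?D > 0 \<longleftrightarrow> ((0 < l) = (0 < snd (step e))) = (0 < ?D)"
    using lnz st det_basis
    by (cases "l > 0"; cases "snd (step e) > 0"; cases "?D > 0") (auto simp: zero_less_mult_iff mult_less_0_iff)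
  ultimately have "slant e * (of_bool (l > 0) - of_bool (l < 0)) = (if ?D > 0 then 1 else -1) * crossing_sign G \<rho> t e"
    using lnz st det_basis unfolding crossing_sign_def
    by auto
  with der lnz show ?thesis using that by blast
qed

text \<open>Every offset of an edge through \<open>\<rho> t\<close> has nonzero derivative at
  \<open>t\<close>, so it falls below its value at \<open>t\<close> on exactly one side. Hence the
  potential is constant on each side, and the two constants differ by the signed coefficients of the
  edges met.\<close>

lemma level_jump:
  assumes z: "integral_cycle G z" and cont: "continuous_on UNIV \<rho>"
    and avoid: "\<rho> t \<notin> lifted_vertices \<Lambda> G"
    and tr: "\<And>e s. (e, s) \<in> fibre (\<rho> t) \<Longrightarrow> \<rho> differentiable at t \<and>
        det2 (vector_derivative \<rho> (at t)) (rvec (dir G e)) \<noteq> 0"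
  shows "\<exists>l r. (\<forall>\<^sub>F u in at_left t. level z (\<kappa> (\<rho> u)) = l \<and> fibre (\<rho> u) = {}) \<and>
      (\<forall>\<^sub>F u in at_right t. level z (\<kappa> (\<rho> u)) = r \<and> fibre (\<rho> u) = {}) \<and>
      r - l = (if det2 (b 0) (b 1) > 0 then 1 else -1) *
      (\<Sum>(e, s)\<in>fibre (\<rho> t). z e * crossing_sign G \<rho> t e)"
proof -
  let ?r = "\<lambda>u. \<kappa> (\<rho> u)"
  let ?sD = "if det2 (b 0) (b 1) > 0 then 1 else -1 :: int"
  \<comment> \<open>The predicate \<open>N\<close> marks the hits whose offset lies below its value
    at \<open>t\<close>; on either side of \<open>t\<close> a single \<open>N\<close> is
    valid.\<close>
  let ?S = "\<lambda>N. level z (?r t) - (\<Sum>e\<in>edges G. z e * slant e * (\<Sum>k\<in>hits e (?r t). of_bool (N e k)))"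
  have "continuous_on UNIV ?r" using cont by (rule lattice_coord_continuous)
  then have "(?r \<longlongrightarrow> ?r t) (at t)" by (simp add: continuous_on_def)
  then have "filterlim ?r (nhds (?r t)) (at t)" .
  from eventually_compose_filterlim[OF eventually_level[OF z avoid] this]
  have ev: "\<forall>\<^sub>F u in at t. level z (?r u) = ?S (\<lambda>e k. offset e k (?r u) < offset e k (?r t)) \<and>
     (\<forall>e\<in>edges G. \<forall>k\<in>hits e (?r u). k \<in> hits e (?r t) \<and> offset e k (?r u) = offset e k (?r t))" .
  have "\<exists>l. ((\<lambda>t. offset e k (?r t)) has_real_derivative l) (at t) \<and> l \<noteq> 0 \<and>
      slant e * (of_bool (l > 0) - of_bool (l < 0)) = ?sD * crossing_sign G \<rho> t e"
    if e: "e \<in> edges G" and k: "k \<in> hits e (?r t)" for e k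
  proof -
    obtain s where "(e, s) \<in> fibre (\<rho> t)"
      using bij_betwE[OF hits_fibre[OF e]] k by blast
    from tr[OF this] offset_derivative[OF e] show ?thesis by metis
  qed
  then obtain l where l: "\<And>e k. e \<in> edges G \<Longrightarrow> k \<in> hits e (?r t) \<Longrightarrow>
      ((\<lambda>t. offset e k (?r t)) has_real_derivative l e k) (at t) \<and> l e k \<noteq> 0 \<and>
      slant e * (of_bool (l e k > 0) - of_bool (l e k < 0)) = ?sD * crossing_sign G \<rho> t e"
    by metis
  have nofib: "fibre (\<rho> u) = {}"
    if "\<forall>e\<in>edges G. \<forall>k\<in>hits e (?r u). k \<in> hits e (?r t) \<and> offset e k (?r u) = offset e k (?r t)"
       "\<forall>e\<in>edges G. \<forall>k\<in>hits e (?r t). offset e k (?r u) \<noteq> offset e k (?r t)" for u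
  proof (rule ccontr)
    assume "fibre (\<rho> u) \<noteq> {}"
    then obtain e s where es: "(e, s) \<in> fibre (\<rho> u)" by auto
    then have e: "e \<in> edges G" by (simp add: edge_fibre_def)
    then obtain k where "k \<in> hits e (?r u)"
      using bij_betw_imp_surj_on[OF hits_fibre[OF e, of "\<rho> u"]] es by blast
    then show False using that e by blast
  qed
  have sgn: "\<forall>\<^sub>F u in F. level z (?r u) = ?S N \<and> fibre (\<rho> u) = {}"
    if F: "F \<le> at t" and N: "\<And>e k. e \<in> edges G \<Longrightarrow> k \<in> hits e (?r t) \<Longrightarrow>
      \<forall>\<^sub>F u in F. offset e k (?r u) \<noteq> offset e k (?r t) \<and> (offset e k (?r u) < offset e k (?r t) \<longleftrightarrow> N e k)"
    for F and N :: "'e \<Rightarrow> int \<Rightarrow> bool"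
  proof -
    have "\<forall>\<^sub>F u in F. \<forall>e\<in>edges G. \<forall>k\<in>hits e (?r t).
       offset e k (?r u) \<noteq> offset e k (?r t) \<and> (offset e k (?r u) < offset e k (?r t) \<longleftrightarrow> N e k)"
      using N by (intro eventually_ball_finite finite_edges finite_edge_hits ballI) auto
    moreover note filter_leD[OF F ev]
    ultimately show ?thesis
    proof eventually_elim
      case (elim u)
      have "?S (\<lambda>e k. offset e k (?r u) < offset e k (?r t)) = ?S N"
        using elim(1)
        by (intro sum.cong arg_cong2[where f = "(*)"] arg_cong2[where f = "(-)"] refl) auto
      with elim nofib[of u] show ?case by auto
    qed
  qed
  have r1: "\<forall>\<^sub>F u in at_right t. level z (?r u) = ?S (\<lambda>e k. l e k < 0) \<and> fibre (\<rho> u) = {}"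
    by (rule sgn) (use l deriv_sign(1)[of "\<lambda>t. offset _ _ (?r t)"] in \<open>blast | simp add: at_le\<close>)+
  have l1: "\<forall>\<^sub>F u in at_left t. level z (?r u) = ?S (\<lambda>e k. l e k > 0) \<and> fibre (\<rho> u) = {}"
    by (rule sgn) (use l deriv_sign(2)[of "\<lambda>t. offset _ _ (?r t)"] in \<open>blast | simp add: at_le\<close>)+
  have "?S (\<lambda>e k. l e k < 0) - ?S (\<lambda>e k. l e k > 0) = (\<Sum>e\<in>edges G. z e * (slant e * (\<Sum>k\<in>hits e (?r t). of_bool (l e k > 0) - of_bool (l e k < 0))))"
    by (simp add: sum_subtractf algebra_simps)
  also have "\<dots> = (\<Sum>e\<in>edges G. z e * (\<Sum>k\<in>hits e (?r t). ?sD * crossing_sign G \<rho> t e))"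
    using l unfolding sum_distrib_left by (intro sum.cong refl) auto
  also have "\<dots> = (\<Sum>e\<in>edges G. ?sD * (z e * (\<Sum>s | (e, s) \<in> fibre (\<rho> t). crossing_sign G \<rho> t e)))"
    using bij_betw_same_card[OF hits_fibre] by (intro sum.cong refl) simp
  also have "\<dots> = ?sD * (\<Sum>e\<in>edges G. \<Sum>s | (e, s) \<in> fibre (\<rho> t). z e * crossing_sign G \<rho> t e)"
    by (simp add: sum_distrib_left mult_ac)
  also have "(\<Sum>e\<in>edges G. \<Sum>s | (e, s) \<in> fibre (\<rho> t). z e * crossing_sign G \<rho> t e)
     = (\<Sum>(e, s)\<in>(SIGMA e:edges G. {s. (e, s) \<in> fibre (\<rho> t)}). z e * crossing_sign G \<rho> t e)"
    by (rule sum.Sigma) (use finite_edges bij_betw_finite[OF hits_fibre] finite_edge_hits in auto)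
  also have "(SIGMA e:edges G. {s. (e, s) \<in> fibre (\<rho> t)}) = fibre (\<rho> t)"
    by (auto simp: edge_fibre_def)
  finally show ?thesis using r1 l1 by blast
qed

text \<open>The change of the potential over one period is computed twice: as the sum of its jumps,
  and from its quasi-periodicity. Finiteness of the crossings comes from the same compactness
  argument as the first computation.\<close>

theorem crossing_number_aux:
  assumes z: "integral_cycle G z" and loop: "loop_in_class \<rho> l" and l: "l \<in> \<Lambda>" and tr: "transverse \<Lambda> G \<rho>"
  shows "finite (crossings \<Lambda> G \<rho>)"
    "of_int (\<Sum>(t, e, s)\<in>crossings \<Lambda> G \<rho>. z e * crossing_sign G \<rho> t e) =
        det2 l (hclass G z) / \<bar>det2 (b 0) (b 1)\<bar>"
proof -
  let ?r = "\<lambda>u. \<kappa> (\<rho> u)"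
  let ?D = "det2 (b 0) (b 1)"
  let ?sD = "if ?D > 0 then 1 else -1 :: int"
  have cont: "continuous_on UNIV \<rho>" and per: "\<rho> (t + 1) = \<rho> t + l" for t
    using loop by (auto simp: loop_in_class_def)
  have avoid: "\<rho> t \<notin> lifted_vertices \<Lambda> G" for t using tr by (auto simp: transverse_def)
  have fibper: "fibre (\<rho> (t + 1)) = fibre (\<rho> t)" for t
  proof -
    have "\<rho> (t + 1) - y \<in> \<Lambda> \<longleftrightarrow> \<rho> t - y \<in> \<Lambda>" for y
    proof -
      have eq: "\<rho> (t + 1) - y = (\<rho> t - y) + l" by (simp add: per)
      have I: "u + v \<in> \<int> \<longleftrightarrow> u \<in> \<int>" if "v \<in> \<int>" for u v :: real
        using that by (metis Ints_add Ints_diff add_diff_cancel_right')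
      show ?thesis using l unfolding eq lattice_mem_iff[OF lattice] by (simp add: lattice_coord_add I)
    qed
    then show ?thesis by (simp add: edge_fibre_def)
  qed
  have trans01: "\<rho> differentiable at t \<and> det2 (vector_derivative \<rho> (at t)) (rvec (dir G e)) \<noteq> 0"
    if es: "(e, s) \<in> fibre (\<rho> t)" and t: "0 \<le> t" "t \<le> 1" for e s t
  proof -
    have *: "\<rho> differentiable at t \<and> det2 (vector_derivative \<rho> (at t)) (rvec (dir G e)) \<noteq> 0"
      if "(e, s) \<in> fibre (\<rho> t)" "0 \<le> t" "t < 1" for t
      using tr that by (force simp: transverse_def crossings_def)
    show ?thesis
    proof (cases "t = 1")
      case True
      have sh: "(\<rho> has_vector_derivative v) (at 1) \<longleftrightarrow> (\<rho> has_vector_derivative v) (at 0)" for v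
        using has_vector_derivative_translate[of \<rho> 1 l v 0] per by simp
      then have "vector_derivative \<rho> (at 1) = vector_derivative \<rho> (at 0)"
        by (simp add: vector_derivative_def)
      moreover have "\<rho> differentiable at 1 \<longleftrightarrow> \<rho> differentiable at 0"
        using sh by (metis differentiableI_vector vector_derivative_works)
      ultimately show ?thesis using *[of 0] es fibper[of 0] True by simp
    qed (use * t es in auto)
  qed
  define J where "J x d p q \<longleftrightarrow> d > 0 \<and>
      (\<forall>u. x - d < u \<and> u < x \<longrightarrow> level z (?r u) = p \<and> fibre (\<rho> u) = {}) \<and>
      (\<forall>u. x < u \<and> u < x + d \<longrightarrow> level z (?r u) = q \<and> fibre (\<rho> u) = {}) \<and>
      q - p = ?sD * (\<Sum>(e, s)\<in>fibre (\<rho> x). z e * crossing_sign G \<rho> x e)" for x d p q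
  have jump: "\<exists>d p q. J x d p q"
    if x: "0 \<le> x" "x \<le> 1" for x
  proof -
    have tx: "\<rho> differentiable at x \<and> det2 (vector_derivative \<rho> (at x)) (rvec (dir G e)) \<noteq> 0"
      if "(e, s) \<in> fibre (\<rho> x)" for e s using trans01[OF that x] .
    have "\<exists>a c. (\<forall>\<^sub>F u in at_left x. level z (?r u) = a \<and> fibre (\<rho> u) = {}) \<and>
       (\<forall>\<^sub>F u in at_right x. level z (?r u) = c \<and> fibre (\<rho> u) = {}) \<and>
       c - a = ?sD * (\<Sum>(e, s)\<in>fibre (\<rho> x). z e * crossing_sign G \<rho> x e)"
      by (rule level_jump[OF z cont avoid]) (erule tx)
    then obtain a c where ac:
      "(\<forall>\<^sub>F u in at_left x. level z (?r u) = a \<and> fibre (\<rho> u) = {}) \<and>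
       (\<forall>\<^sub>F u in at_right x. level z (?r u) = c \<and> fibre (\<rho> u) = {}) \<and>
       c - a = ?sD * (\<Sum>(e, s)\<in>fibre (\<rho> x). z e * crossing_sign G \<rho> x e)"
      by (elim exE) (rule that)
    note ac = conjunct1[OF ac] conjunct1[OF conjunct2[OF ac]] conjunct2[OF conjunct2[OF ac]]
    obtain p q where pq: "p < x" "\<forall>u>p. u < x \<longrightarrow> level z (?r u) = a \<and> fibre (\<rho> u) = {}"
      "q > x" "\<forall>u>x. u < q \<longrightarrow> level z (?r u) = c \<and> fibre (\<rho> u) = {}"
      using ac(1,2) unfolding eventually_at_left_field eventually_at_right_field by blast
    then have "J x (min (x - p) (q - x)) a c" using ac(3) by (auto simp: J_def)
    then show ?thesis by blast
  qed
  \<comment> \<open>The value of the potential just before time \<open>t\<close>. Left limits fit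
    the half-open intervals used below: the jump at \<open>a\<close> is counted between
    \<open>a\<close> and \<open>c\<close>, the one at \<open>c\<close> is not.\<close>
  define L where "L t = (SOME v. \<forall>\<^sub>F u in at_left t. level z (?r u) = v)" for t
  have L: "L t = v" if "p < t" "\<And>u. p < u \<Longrightarrow> u < t \<Longrightarrow> level z (?r u) = v" for t p v
  proof -
    have ev: "\<forall>\<^sub>F u in at_left t. level z (?r u) = v"
      unfolding eventually_at_left_field using that by blast
    then have "\<forall>\<^sub>F u in at_left t. level z (?r u) = L t"
      unfolding L_def by (rule someI)
    with ev have "\<forall>\<^sub>F u in at_left t. L t = v" by eventually_elim simp
    then show ?thesis by simp
  qed
  define Cr where "Cr a c = {(t, e, s). a \<le> t \<and> t < c \<and> (e, s) \<in> fibre (\<rho> t)}" for a c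
  let ?S = "\<lambda>a c. \<Sum>(t, e, s)\<in>Cr a c. z e * crossing_sign G \<rho> t e"
  have "finite (Cr 0 1) \<and> ?sD * ?S 0 1 = L 1 - L 0"
  \<comment> \<open>The property is additive under concatenation of intervals and holds on all short
    intervals around a point, so bisection extends it to the unit interval.\<close>
  proof (rule Bolzano[where P = "\<lambda>a c. finite (Cr a c) \<and> ?sD * ?S a c = L c - L a"])
    fix a c d :: real
    assume 1: "finite (Cr a c) \<and> ?sD * ?S a c = L c - L a" and 2: "finite (Cr c d) \<and> ?sD * ?S c d = L d - L c"
      and le: "a \<le> c" "c \<le> d"
    have un: "Cr a d = Cr a c \<union> Cr c d" and dis: "Cr a c \<inter> Cr c d = {}"
      using le by (auto simp: Cr_def)
    have "?S a d = ?S a c + ?S c d" unfolding un using 1 2 dis by (intro sum.union_disjoint) auto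
    then show "finite (Cr a d) \<and> ?sD * ?S a d = L d - L a"
      using 1 2 un by (simp only: distrib_left) simp
  next
    fix x :: real assume x: "0 \<le> x" "x \<le> 1"
    obtain d p q where J: "J x d p q" using jump[OF x] by blast
    have d: "d > 0"
      and left: "\<And>u. x - d < u \<Longrightarrow> u < x \<Longrightarrow> level z (?r u) = p \<and> fibre (\<rho> u) = {}"
      and right: "\<And>u. x < u \<Longrightarrow> u < x + d \<Longrightarrow> level z (?r u) = q \<and> fibre (\<rho> u) = {}"
      and qp: "q - p = ?sD * (\<Sum>(e, s)\<in>fibre (\<rho> x). z e * crossing_sign G \<rho> x e)"
      using J unfolding J_def by (elim conjE; simp)+
    have "finite (Cr a c) \<and> ?sD * ?S a c = L c - L a" if ac: "a \<le> x \<and> x \<le> c \<and> c - a < d" for a c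
    proof -
      have La: "L a = p" using left ac d by (intro L[of "x - d"]) auto
      show ?thesis
      proof (cases "c = x")
        case True
        have "Cr a c = {}" using left ac True by (fastforce simp: Cr_def)
        moreover have "L c = p" using left True d by (intro L[of "x - d"]) auto
        ultimately show ?thesis using La by simp
      next
        case False
        then have c: "x < c" using ac by simp
        have Lc: "L c = q" using right c ac by (intro L[of x]) auto
        have "Cr a c = Pair x ` fibre (\<rho> x)"
        proof safe
          fix t e s assume t: "(t, e, s) \<in> Cr a c"
          have "t = x"
          proof (rule ccontr)
            assume "t \<noteq> x"
            then have "fibre (\<rho> t) = {}"
              using left[of t] right[of t] t ac by (cases "t < x") (auto simp: Cr_def)
            then show False using t by (auto simp: Cr_def)
          qed
          then show "(t, e, s) \<in> Pair x ` fibre (\<rho> x)" using t by (auto simp: Cr_def)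
        qed (use ac c in \<open>auto simp: Cr_def\<close>)
        moreover have "inj_on (Pair x) (fibre (\<rho> x))" by (simp add: inj_on_def)
        ultimately show ?thesis
          using finite_edge_fibre[of "\<rho> x"] qp La Lc by (simp add: sum.reindex case_prod_beta)
      qed
    qed
    with d show "\<exists>d>0. \<forall>a c. a \<le> x \<and> x \<le> c \<and> c - a < d \<longrightarrow> finite (Cr a c) \<and> ?sD * ?S a c = L c - L a"
      by (intro exI[of _ d] conjI[of "d > 0"] allI impI) assumption
  qed simp
  moreover have "Cr 0 1 = crossings \<Lambda> G \<rho>" by (auto simp: Cr_def crossings_def)
  ultimately have fin: "finite (crossings \<Lambda> G \<rho>)"
    and sum: "?sD * (\<Sum>(t, e, s)\<in>crossings \<Lambda> G \<rho>. z e * crossing_sign G \<rho> t e) = L 1 - L 0" by auto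
  show "finite (crossings \<Lambda> G \<rho>)" by fact
  let ?h = "\<kappa> (hclass G z)" and ?l = "\<kappa> l"
  have "real_of_int (L 1 - L 0) = det2 ?l ?h"
  proof -
    obtain i j where ij: "?l = (of_int i, of_int j)"
      using l unfolding lattice_mem_iff[OF lattice] by (metis Ints_cases prod.collapse)
    obtain d p q where J: "J 0 d p q" using jump[of 0] by auto
    have d: "d > 0" and left: "\<And>u. - d < u \<Longrightarrow> u < 0 \<Longrightarrow> level z (?r u) = p"
      using J unfolding J_def by (elim conjE; simp)+
    have L0: "L 0 = p" using left d by (intro L[of "-d"]) auto
    \<comment> \<open>The value just before time 1, taken at a sample time just before 0 and moved
      by one period.\<close>
    define m where "m = level z (fst (?r (-d/2)) + of_int i, snd (?r (-d/2)) + of_int j)"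
    have sh: "?r (u + 1) = (fst (?r u) + of_int i, snd (?r u) + of_int j)" for u
      by (simp add: per lattice_coord_add ij prod_eq_iff)
    have lev: "real_of_int (level z (?r (u + 1))) = of_int p + det2 ?l ?h" if "-d < u" "u < 0" for u
      unfolding sh level_shift[OF z] using left[of u] that ij by (simp add: det2_def)
    have mm: "level z (?r (u + 1)) = m" if "-d < u" "u < 0" for u
    proof -
      have "real_of_int (level z (?r (u + 1))) = real_of_int m"
        unfolding m_def sh[symmetric] using lev[OF that] lev[of "-d/2"] d by simp
      then show ?thesis by simp
    qed
    have "L 1 = m"
    proof (rule L[of "1 - d"])
      fix u assume "1 - d < u" "u < 1"
      then show "level z (?r u) = m" using mm[of "u - 1"] by simp
    qed (use d in simp)
    moreover have "real_of_int m = of_int p + det2 ?l ?h"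
      unfolding m_def sh[symmetric] using lev[of "-d/2"] d by simp
    ultimately show ?thesis using L0 by simp
  qed
  also have "\<dots> = det2 l (hclass G z) / ?D" by (rule det2_lattice_coord[where b = b, OF det_basis])
  finally have "real_of_int (?sD * (\<Sum>(t, e, s)\<in>crossings \<Lambda> G \<rho>. z e * crossing_sign G \<rho> t e)) = det2 l (hclass G z) / ?D"
    unfolding sum .
  then show "of_int (\<Sum>(t, e, s)\<in>crossings \<Lambda> G \<rho>. z e * crossing_sign G \<rho> t e) =
      det2 l (hclass G z) / \<bar>?D\<bar>"
    by (cases "?D > 0") (auto simp: minus_equation_iff)
qed

end

text \<open>A shear of the basis makes all edges non-horizontal.\<close>

theorem (in torus_graph) crossing_number:
  assumes z: "integral_cycle G z" and loop: "loop_in_class \<rho> l" and l: "l \<in> \<Lambda>" and tr: "transverse \<Lambda> G \<rho>"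
  shows "finite (crossings \<Lambda> G \<rho>)"
    "of_int (\<Sum>(t, e, s)\<in>crossings \<Lambda> G \<rho>. z e * crossing_sign G \<rho> t e) =
        det2 l (hclass G z) / \<bar>det2 (b 0) (b 1)\<bar>"
proof -
  have "displacement G e \<noteq> 0" if "e \<in> edges G" for e
    using len_pos[OF that] wt_pos[OF that] dir_nonzero[OF that]
    by (auto simp: displacement_eq rvec_def prod_eq_iff)
  then have "\<exists>n::int. \<forall>v\<in>displacement G ` edges G. det2 (b 0 + of_int n *\<^sub>R b 1) v \<noteq> 0"
    using finite_edges det_basis by (intro finite_vectors_nonparallel) auto
  then obtain n :: int where n: "\<forall>v\<in>displacement G ` edges G. det2 (b 0 + of_int n *\<^sub>R b 1) v \<noteq> 0" ..
  define b' where "b' = (\<lambda>i. if i = 0 then b 0 + of_int n *\<^sub>R b 1 else b i)"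
  have det: "det2 (b' 0) (b' 1) = det2 (b 0) (b 1)" by (simp add: b'_def det2_def algebra_simps)
  interpret t: transversal_torus_graph \<Lambda> b' G
  proof
    show "lattice_basis \<Lambda> b'" unfolding b'_def by (rule lattice_basis_shear[OF lattice])
    show "snd (lattice_coord b' (displacement G e)) \<noteq> 0" if "e \<in> edges G" for e
      using n that det det_basis by (simp add: lattice_coord_def) (simp add: b'_def)
  qed (use finite_verts finite_edges src_in tgt_in len_pos wt_pos dir_nonzero edge_closes in auto)
  show "finite (crossings \<Lambda> G \<rho>)"
    "of_int (\<Sum>(t, e, s)\<in>crossings \<Lambda> G \<rho>. z e * crossing_sign G \<rho> t e) =
        det2 l (hclass G z) / \<bar>det2 (b 0) (b 1)\<bar>"
    using t.crossing_number_aux[OF z loop l tr] unfolding det by auto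
qed

section \<open>Linear systems in the complex torus\<close>

definition torus :: "(complex \<times> complex) set" where
  "torus = {z. fst z \<noteq> 0 \<and> snd z \<noteq> 0}"

lemma group_Cstar: "group Cstar"
proof (rule groupI)
  show "\<exists>y\<in>carrier Cstar. y \<otimes>\<^bsub>Cstar\<^esub> x = \<one>\<^bsub>Cstar\<^esub>" if "x \<in> carrier Cstar" for x
    using that by (intro bexI[of _ "inverse x"]) (auto simp: Cstar_def)
qed (auto simp: Cstar_def)

lemma comm_group_Cstar: "comm_group Cstar"
  by (intro group.group_comm_groupI[OF group_Cstar]) (simp add: Cstar_def)

lemma carrier_Cstar [simp]: "carrier Cstar = {z. z \<noteq> 0}"
  and mult_Cstar [simp]: "x \<otimes>\<^bsub>Cstar\<^esub> y = x * y"
  and one_Cstar [simp]: "\<one>\<^bsub>Cstar\<^esub> = 1"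
  by (simp_all add: Cstar_def)

lemma inv_Cstar [simp]: "x \<noteq> 0 \<Longrightarrow> inv\<^bsub>Cstar\<^esub> x = inverse x"
  using group.inv_equality[OF group_Cstar, of "inverse x" x] by simp

lemma nat_pow_Cstar [simp]: "x [^]\<^bsub>Cstar\<^esub> (n::nat) = x ^ n"
  by (induction n) (simp_all add: nat_pow_def Cstar_def)

lemma int_pow_Cstar [simp]: "x \<noteq> 0 \<Longrightarrow> x [^]\<^bsub>Cstar\<^esub> (k::int) = x powi k"
  by (simp add: int_pow_def2 power_int_def power_inverse)

lemma finprod_Cstar:
  assumes "finite A" "\<And>x. x \<in> A \<Longrightarrow> f x \<noteq> 0"
  shows "finprod Cstar f A = prod f A"
  using assms
proof (induction A rule: finite_induct)
  case empty
  then show ?case by (simp add: comm_monoid.finprod_empty[OF comm_group.axioms(1)[OF comm_group_Cstar]])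
next
  case (insert x A)
  then show ?case
    by (subst comm_monoid.finprod_insert[OF comm_group.axioms(1)[OF comm_group_Cstar]]) auto
qed

abbreviation "Cstar2 \<equiv> Cstar \<times>\<times> Cstar"

lemma carrier_Cstar2 [simp]: "carrier (Cstar2) = torus"
  by (auto simp: torus_def DirProd_def)

abbreviation dett :: "int \<times> int \<Rightarrow> complex \<times> complex \<Rightarrow> complex" where
  "dett \<equiv> det_tensor Cstar"

lemma dett_eq: "z \<in> torus \<Longrightarrow> dett v z = snd z powi fst v * fst z powi (- snd v)"
  by (simp add: det_tensor_def torus_def)

lemma dett_nonzero: "z \<in> torus \<Longrightarrow> dett v z \<noteq> 0"
  by (simp add: dett_eq torus_def)

lemma dett_0: "z \<in> torus \<Longrightarrow> dett 0 z = 1"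
  by (simp add: dett_eq)

lemma dett_one: "dett v (1, 1) = 1"
  by (simp add: dett_eq torus_def)

lemma dett_add: "z \<in> torus \<Longrightarrow> dett (u + v) z = dett u z * dett v z"
  by (simp add: dett_eq torus_def power_int_add power_int_diff power_int_minus divide_simps)

lemma dett_uminus: "z \<in> torus \<Longrightarrow> dett (- u) z = inverse (dett u z)"
  by (simp add: dett_eq power_int_minus)

lemma dett_smul: "z \<in> torus \<Longrightarrow> dett (smul k u) z = dett u z powi k"
  by (simp add: dett_eq smul_def power_int_mult_distrib power_int_mult[symmetric] mult.commute)

lemma dett_sum: "z \<in> torus \<Longrightarrow> dett (\<Sum>i\<in>A. f i) z = (\<Prod>i\<in>A. dett (f i) z)"
  by (induction A rule: infinite_finite_induct) (auto simp: dett_0 dett_add)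

lemma mult_Cstar2: "z \<otimes>\<^bsub>Cstar2\<^esub> w = (fst z * fst w, snd z * snd w)"
  by (cases z; cases w) simp

lemma dett_mult:
  "z \<in> torus \<Longrightarrow> w \<in> torus \<Longrightarrow> dett v (z \<otimes>\<^bsub>Cstar2\<^esub> w) = dett v z * dett v w"
  unfolding mult_Cstar2
  by (subst (1 2 3) dett_eq) (auto simp: torus_def power_int_mult_distrib)

lemma torus_mult: "z \<in> torus \<Longrightarrow> w \<in> torus \<Longrightarrow> z \<otimes>\<^bsub>Cstar2\<^esub> w \<in> torus"
  by (simp add: mult_Cstar2 torus_def)

section \<open>Pairs of monomial equations and sublattices of the integer plane\<close>

lemma card_powi_eq:
  assumes "n \<noteq> 0" "c \<noteq> 0"
  shows "card {x::complex. x \<noteq> 0 \<and> x powi n = c} = nat \<bar>n\<bar>"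
proof (cases "n > 0")
  case True
  then have "{x::complex. x \<noteq> 0 \<and> x powi n = c} = {x. x ^ nat n = c}"
    using assms by (auto simp: power_int_def zero_power)
  then show ?thesis using card_nth_roots[of c "nat n"] assms True by simp
next
  case False
  then have "{x::complex. x \<noteq> 0 \<and> x powi n = c} = {x. x ^ nat (- n) = inverse c}"
    using assms by (auto simp: power_int_def zero_power power_inverse)
  then show ?thesis using card_nth_roots[of "inverse c" "nat (- n)"] assms False by simp
qed

text \<open>Euclidean algorithm on the first coordinates; likewise for the index below.\<close>

lemma card_dett_system:
  assumes "det2 a b \<noteq> 0" "s \<noteq> 0" "t \<noteq> 0"
  shows "card {z \<in> torus. dett a z = s \<and> dett b z = t} = nat \<bar>det2 a b\<bar>"
  using assms
proof (induction "nat \<bar>fst b\<bar>" arbitrary: a b s t rule: less_induct)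
  case less
  show ?case
  proof (cases "fst b = 0")
    case True
    have nz: "fst a \<noteq> 0" "snd b \<noteq> 0" using less.prems(1) True by (auto simp: det2_def)
    \<comment> \<open>With \<open>fst b = 0\<close> the system is triangular: the second equation
      involves the first coordinate of \<open>z\<close> only.\<close>
    let ?X = "{x::complex. x \<noteq> 0 \<and> x powi (- snd b) = t}"
    let ?Y = "\<lambda>x. {y::complex. y \<noteq> 0 \<and> y powi fst a = s * x powi (snd a)}"
    have "{z \<in> torus. dett a z = s \<and> dett b z = t} = (SIGMA x:?X. ?Y x)"
      using True by (auto simp: torus_def dett_eq power_int_minus field_simps)
    moreover have "card (?Y x) = nat \<bar>fst a\<bar>" if "x \<in> ?X" for x
      using card_powi_eq[of "fst a" "s * x powi snd a"] nz less.prems that by simp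
    moreover have X: "card ?X = nat \<bar>snd b\<bar>"
      using card_powi_eq[of "- snd b" t] nz less.prems by simp
    moreover have "finite ?X" using X nz by (intro card_ge_0_finite) simp
    ultimately show ?thesis
      using True by (simp add: card_SigmaI card_ge_0_finite nz det2_def nat_mult_distrib abs_mult mult.commute)
  next
    case False
    define q where "q = fst a div fst b"
    define a' where "a' = a - smul q b"
    have fa: "fst a' = fst a mod fst b" by (simp add: a'_def smul_def q_def minus_mult_div_eq_mod mult.commute)
    have det: "det2 b a' = - det2 a b" by (simp add: a'_def smul_def det2_def algebra_simps)
    have aa: "a = a' + smul q b" by (simp add: a'_def)
    have "{z \<in> torus. dett a z = s \<and> dett b z = t} = {z \<in> torus. dett b z = t \<and> dett a' z = s * t powi (- q)}"
      using less.prems by (auto simp: aa dett_add dett_smul power_int_minus)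
    moreover have "nat \<bar>fst a'\<bar> < nat \<bar>fst b\<bar>"
      unfolding fa using False abs_mod_less[of "fst b" "fst a"] by simp
    ultimately show ?thesis
      using less.hyps[of a' b t "s * t powi (- q)"] less.prems det by simp
  qed
qed

text \<open>It suffices to test on the torsion points \<open>exp(2 \<pi> \<i> a / D)\<close> and \<open>exp(2 \<pi> \<i> b / D)\<close> with \<open>D = det(a, b)\<close>.\<close>

lemma dett_trivial_imp_dvd:
  assumes D: "det2 a b \<noteq> 0"
    and triv: "\<And>z. z \<in> torus \<Longrightarrow> dett a z = 1 \<Longrightarrow> dett b z = 1 \<Longrightarrow> dett v z = 1"
  shows "det2 a b dvd det2 v a" "det2 a b dvd det2 v b"
proof -
  let ?D = "det2 a b"
  define Z where "Z w = (cis (2 * pi * (of_int (fst w) / of_int ?D)), cis (2 * pi * (of_int (snd w) / of_int ?D)))" for w :: "int \<times> int"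
  have Zt: "Z w \<in> torus" for w by (simp add: Z_def torus_def)
  have dZ: "dett u (Z w) = cis (2 * pi * (of_int (det2 u w) / of_int ?D))" for u w
  proof -
    have *: "cis x powi k = cis (of_int k * x)" for x k
      by (simp add: cis_power_int)
    show ?thesis
      by (subst dett_eq[OF Zt], unfold Z_def fst_conv snd_conv * cis_mult, rule arg_cong[where f = cis])
         (simp add: det2_def[of u w] diff_divide_distrib algebra_simps)
  qed
  have cis1: "cis (2 * pi * (of_int n / of_int ?D)) = 1 \<longleftrightarrow> ?D dvd n" for n
  proof
    assume "cis (2 * pi * (of_int n / of_int ?D)) = 1"
    then obtain k :: int where "2 * pi * (of_int n / of_int ?D) = of_int k * 2 * pi"
      unfolding cis.ctr by (auto simp: complex_eq_iff cos_one_2pi_int)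
    then have "real_of_int n = of_int (k * ?D)" using D by (simp add: field_simps)
    then show "?D dvd n" by (simp only: of_int_eq_iff) simp
  next
    assume "?D dvd n"
    then obtain k where "n = ?D * k" by auto
    then have "real_of_int n / of_int ?D = of_int k" using D by simp
    then show "cis (2 * pi * (of_int n / of_int ?D)) = 1"
      by (simp only:) (simp add: cis_multiple_2pi)
  qed
  have "?D dvd det2 v w" if "?D dvd det2 a w" "?D dvd det2 b w" for w
    using triv[OF Zt, of w] that unfolding dZ cis1 by blast
  moreover have "det2 a a = 0" "det2 b b = 0" "det2 b a = - ?D" by (simp_all add: det2_def)
  ultimately show "?D dvd det2 v a" "?D dvd det2 v b" by simp_all
qed

lemma card_cosets_span:
  assumes "det2 a b \<noteq> (0::int)"
  shows "card (range (\<lambda>x. (\<lambda>y. x + y) ` {smul i a + smul j b | i j. True})) = nat \<bar>det2 a b\<bar>"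
  using assms
proof (induction "nat \<bar>fst b\<bar>" arbitrary: a b rule: less_induct)
  case less
  show ?case
  proof (cases "fst b = 0")
    case True
    have nz: "fst a \<noteq> 0" "snd b \<noteq> 0" using less.prems(1) True by (auto simp: det2_def)
    let ?A = "{smul i a + smul j b | i j. True}"
    let ?c = "\<lambda>x. (\<lambda>y. x + y) ` ?A"
    have grp: "u + v \<in> ?A" "- u \<in> ?A" if u: "u \<in> ?A" and v: "v \<in> ?A" for u v
    proof -
      obtain i j i' j' where "u = smul i a + smul j b" "v = smul i' a + smul j' b" using u v by auto
      then have "u + v = smul (i + i') a + smul (j + j') b" "- u = smul (- i) a + smul (- j) b"
        by (auto simp: smul_def algebra_simps)
      then show "u + v \<in> ?A" "- u \<in> ?A" by blast+
    qed
    have z: "0 \<in> ?A" by (rule CollectI, rule exI[of _ 0], rule exI[of _ 0]) (simp add: smul_def zero_prod_def)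
    have eq: "?c x = ?c y \<longleftrightarrow> x - y \<in> ?A" for x y
    proof
      assume "?c x = ?c y"
      moreover have "x \<in> ?c x" using z by force
      ultimately obtain u where "u \<in> ?A" "x = y + u" by auto
      then show "x - y \<in> ?A" by simp
    next
      assume xy: "x - y \<in> ?A"
      have "x + u \<in> ?c y" if "u \<in> ?A" for u
        using grp(1)[OF xy that] by (intro image_eqI[of _ _ "x - y + u"]) auto
      moreover have "y + u \<in> ?c x" if "u \<in> ?A" for u
        using grp(1)[OF grp(2)[OF xy xy] that] by (intro image_eqI[of _ _ "- (x - y) + u"]) auto
      ultimately show "?c x = ?c y" by (intro equalityI subsetI; elim imageE; simp only:)
    qed
    \<comment> \<open>This rectangle is a fundamental domain: multiples of \<open>a\<close> reduce
      the first coordinate, after which multiples of \<open>b\<close> reduce the second and leave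
      the first unchanged.\<close>
    let ?R = "{0..<\<bar>fst a\<bar>} \<times> {0..<\<bar>snd b\<bar>}"
    have "?c ` ?R = range ?c"
    proof (intro equalityI subsetI)
      fix C assume "C \<in> range ?c"
      then obtain x where C: "C = ?c x" by auto
      define i where "i = sgn (fst a) * (fst x div \<bar>fst a\<bar>)"
      define w where "w = x - smul i a"
      define j where "j = sgn (snd b) * (snd w div \<bar>snd b\<bar>)"
      define r where "r = w - smul j b"
      have "fst w = fst x mod \<bar>fst a\<bar>" unfolding w_def i_def smul_def
        by (simp add: minus_mult_div_eq_mod[symmetric] sgn_if abs_if)
      then have "fst r = fst x mod \<bar>fst a\<bar>" using True by (simp add: r_def smul_def)
      moreover have "snd r = snd w mod \<bar>snd b\<bar>" unfolding r_def j_def smul_def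
        by (simp add: minus_mult_div_eq_mod[symmetric] sgn_if abs_if)
      ultimately have "r \<in> ?R" using nz by (auto simp: mem_Times_iff)
      moreover have "x - r \<in> ?A" unfolding r_def w_def
        by (rule CollectI, rule exI[of _ i], rule exI[of _ j]) simp
      ultimately show "C \<in> ?c ` ?R" unfolding C
        by (intro image_eqI[of _ ?c r, OF iffD2[OF eq]])
    qed auto
    moreover have "inj_on ?c ?R"
    proof (rule inj_onI)
      fix x y assume xy: "x \<in> ?R" "y \<in> ?R" and cc: "?c x = ?c y"
      obtain i j where ij: "x - y = smul i a + smul j b" using iffD1[OF eq cc] by auto
      then have 1: "fst x - fst y = i * fst a" using True by (simp add: smul_def prod_eq_iff)
      then have "\<bar>i\<bar> * \<bar>fst a\<bar> < 1 * \<bar>fst a\<bar>" using xy by (auto simp: mem_Times_iff abs_mult[symmetric])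
      then have i0: "i = 0" using nz by (simp only: mult_less_cancel_right) auto
      then have 2: "snd x - snd y = j * snd b" using ij by (simp add: smul_def prod_eq_iff)
      then have "\<bar>j\<bar> * \<bar>snd b\<bar> < 1 * \<bar>snd b\<bar>" using xy by (auto simp: mem_Times_iff abs_mult[symmetric])
      then have "j = 0" using nz by (simp only: mult_less_cancel_right) auto
      then show "x = y" using 1 2 i0 by (simp add: prod_eq_iff)
    qed
    ultimately have "card (range ?c) = card ?R" using card_image[of ?c ?R] by (simp only:)
    then show ?thesis using True by (simp add: det2_def nat_mult_distrib abs_mult)
  next
    case False
    define q where "q = fst a div fst b"
    define a' where "a' = a - smul q b"
    have fa: "fst a' = fst a mod fst b" by (simp add: a'_def smul_def q_def minus_mult_div_eq_mod mult.commute)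
    have det: "det2 b a' = - det2 a b" by (simp add: a'_def smul_def det2_def algebra_simps)
    have "{smul i a + smul j b | i j. True} = {smul i b + smul j a' | i j. True}"
    proof (intro equalityI subsetI)
      fix x assume "x \<in> {smul i a + smul j b | i j. True}"
      then obtain i j where "x = smul i a + smul j b" by auto
      then have "x = smul (j + q * i) b + smul i a'" by (simp add: a'_def smul_def algebra_simps)
      then show "x \<in> {smul i b + smul j a' | i j. True}" by auto
    next
      fix x assume "x \<in> {smul i b + smul j a' | i j. True}"
      then obtain i j where "x = smul i b + smul j a'" by auto
      then have "x = smul j a + smul (i - q * j) b" by (simp add: a'_def smul_def algebra_simps)
      then show "x \<in> {smul i a + smul j b | i j. True}" by auto
    qed
    moreover have "nat \<bar>fst a'\<bar> < nat \<bar>fst b\<bar>"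
      unfolding fa using False abs_mod_less[of "fst b" "fst a"] by simp
    ultimately show ?thesis using less.hyps[of a' b] less.prems det by simp
  qed
qed

section \<open>Orthogonality of characters and the index of a sublattice\<close>

lemma sum_roots_of_unity:
  fixes x :: complex
  assumes "x ^ w = 1"
  shows "(\<Sum>k<w. x ^ k) = of_nat w * of_bool (x = 1)"
  using assms sum_gp_strict[of x w] by auto

text \<open>Translation by an element \<open>y\<close> with \<open>\<psi> y\<close> different from 1
  multiplies the sum by \<open>\<psi> y\<close> and also leaves it unchanged.\<close>

lemma sum_trivial_character:
  assumes G: "group G" "finite (carrier G)" and \<psi>: "\<psi> \<in> hom G Cstar"
  shows "(\<Sum>x\<in>carrier G. \<psi> x) = of_nat (card (carrier G)) * of_bool (\<forall>x\<in>carrier G. \<psi> x = 1)"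
proof (cases "\<forall>x\<in>carrier G. \<psi> x = 1")
  case False
  then obtain y where y: "y \<in> carrier G" "\<psi> y \<noteq> 1" by auto
  interpret group G by fact
  have "(\<Sum>x\<in>carrier G. \<psi> x) = (\<Sum>x\<in>carrier G. \<psi> (y \<otimes>\<^bsub>G\<^esub> x))"
    by (rule sum.reindex_bij_betw[symmetric])
       (use y inj_on_cmult surj_const_mult in \<open>auto simp: bij_betw_def\<close>)
  also have "\<dots> = \<psi> y * (\<Sum>x\<in>carrier G. \<psi> x)"
    using hom_mult[OF \<psi> y(1)] by (simp add: sum_distrib_left)
  finally have "(\<Sum>x\<in>carrier G. \<psi> x) = 0" using y(2) by simp
  then show ?thesis using False by simp
qed simp

text \<open>Both sides count, by orthogonality of characters, the double sum of
  \<open>\<Prod>e. \<eta> e x ^ k e\<close> over the group elements \<open>x\<close> and the exponents \<open>k\<close>.\<close>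

lemma card_common_kernel:
  fixes w :: "'e \<Rightarrow> nat"
  assumes G: "group G" "finite (carrier G)" and E: "finite E"
    and \<eta>: "\<And>e. e \<in> E \<Longrightarrow> \<eta> e \<in> hom G Cstar"
    and tors: "\<And>e x. e \<in> E \<Longrightarrow> x \<in> carrier G \<Longrightarrow> \<eta> e x ^ w e = 1"
  shows "card {x \<in> carrier G. \<forall>e\<in>E. \<eta> e x = 1} * (\<Prod>e\<in>E. w e) =
     card (carrier G) * card {k \<in> PiE E (\<lambda>e. {..<w e}). \<forall>x\<in>carrier G. (\<Prod>e\<in>E. \<eta> e x ^ k e) = 1}"
proof -
  let ?K = "PiE E (\<lambda>e. {..<w e})"
  have finK: "finite ?K" using E by (intro finite_PiE) auto
  have \<psi>: "(\<lambda>x. \<Prod>e\<in>E. \<eta> e x ^ k e) \<in> hom G Cstar" for k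
    using \<eta> E by (intro homI) (auto simp: hom_def Pi_def power_mult_distrib prod.distrib prod_zero_iff)
  have left: "(\<Sum>k\<in>?K. \<Prod>e\<in>E. \<eta> e x ^ k e) = of_nat (\<Prod>e\<in>E. w e) * of_bool (\<forall>e\<in>E. \<eta> e x = 1)"
    if x: "x \<in> carrier G" for x
  proof -
    have "(\<Sum>k\<in>?K. \<Prod>e\<in>E. \<eta> e x ^ k e) = (\<Prod>e\<in>E. \<Sum>k<w e. \<eta> e x ^ k)"
      by (rule prod_sum_PiE[symmetric]) (use E in auto)
    also have "\<dots> = (\<Prod>e\<in>E. of_nat (w e) * of_bool (\<eta> e x = 1))"
      using tors x by (intro prod.cong refl sum_roots_of_unity) auto
    also have "\<dots> = of_nat (\<Prod>e\<in>E. w e) * of_bool (\<forall>e\<in>E. \<eta> e x = 1)"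
      using E by (auto simp: prod.distrib)
    finally show ?thesis .
  qed
  have "(of_nat (card {x \<in> carrier G. \<forall>e\<in>E. \<eta> e x = 1} * (\<Prod>e\<in>E. w e)) :: complex)
      = (\<Sum>x\<in>carrier G. of_nat (\<Prod>e\<in>E. w e) * of_bool (\<forall>e\<in>E. \<eta> e x = 1))"
    using G(2) by (simp add: sum_distrib_left[symmetric] sum_of_bool_eq Int_def mult.commute del: of_nat_prod)
  also have "\<dots> = (\<Sum>x\<in>carrier G. \<Sum>k\<in>?K. \<Prod>e\<in>E. \<eta> e x ^ k e)"
    using left by (intro sum.cong refl) (simp del: of_nat_prod)
  also have "\<dots> = (\<Sum>k\<in>?K. \<Sum>x\<in>carrier G. \<Prod>e\<in>E. \<eta> e x ^ k e)"
    by (rule sum.swap)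
  also have "\<dots> = (\<Sum>k\<in>?K. of_nat (card (carrier G)) * of_bool (\<forall>x\<in>carrier G. (\<Prod>e\<in>E. \<eta> e x ^ k e) = 1))"
    by (intro sum.cong refl sum_trivial_character G \<psi>)
  also have "\<dots> = of_nat (card (carrier G) * card {k \<in> ?K. \<forall>x\<in>carrier G. (\<Prod>e\<in>E. \<eta> e x ^ k e) = 1})"
    using finK by (simp add: sum_distrib_left[symmetric] sum_of_bool_eq Int_def)
  finally show ?thesis by (simp only: of_nat_eq_iff)
qed

text \<open>The coordinates identify \<Lambda> with the integer plane, where
  \<open>card_cosets_span\<close> counts the cosets.\<close>

lemma subgroup_index_span:
  assumes b: "lattice_basis \<Lambda> b" and h: "lattice_coord b h0 = rvec m0" "lattice_coord b h1 = rvec m1"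
    and D: "det2 m0 m1 \<noteq> 0"
  shows "subgroup_index \<Lambda> {of_int i *\<^sub>R h0 + of_int j *\<^sub>R h1 | i j. True} = nat \<bar>det2 m0 m1\<bar>"
proof -
  have det: "det2 (b 0) (b 1) \<noteq> 0" and L: "\<Lambda> = {of_int i *\<^sub>R b 0 + of_int j *\<^sub>R b 1 | i j :: int. True}"
    using b by (auto simp: lattice_basis_def)
  define T where "T m = real_of_int (fst m) *\<^sub>R b 0 + real_of_int (snd m) *\<^sub>R b 1" for m :: "int \<times> int"
  have coT: "lattice_coord b (T m) = rvec m" for m
    unfolding T_def rvec_def by (rule lattice_coord_combination[OF det])
  have inj: "inj T"
  proof (rule injI)
    fix m n assume "T m = T n"
    then have "rvec m = rvec n" using coT by metis
    then show "m = n" by (simp add: rvec_def prod_eq_iff)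
  qed
  have add: "T (m + n) = T m + T n" and sm: "T (smul k m) = of_int k *\<^sub>R T m" for m n k
    by (simp_all add: T_def smul_def algebra_simps)
  have h01: "h0 = T m0" "h1 = T m1"
    using lattice_coord_eq[where b = b, OF det, of h0] lattice_coord_eq[where b = b, OF det, of h1] h
    by (simp_all add: T_def rvec_def)
  let ?A = "{smul i m0 + smul j m1 | i j. True}"
  have A: "{of_int i *\<^sub>R h0 + of_int j *\<^sub>R h1 | i j :: int. True} = T ` ?A"
    unfolding h01 sm[symmetric] add[symmetric] by blast
  have \<Lambda>: "\<Lambda> = range T"
  proof (intro equalityI subsetI)
    fix x assume "x \<in> \<Lambda>"
    then obtain i j where "x = T (i, j)" unfolding L T_def by auto
    then show "x \<in> range T" by blast
  qed (auto simp: L T_def)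
  have "(\<lambda>x. (\<lambda>a. x + a) ` (T ` ?A)) ` \<Lambda> = image T ` range (\<lambda>x. (\<lambda>y. x + y) ` ?A)"
    unfolding \<Lambda> image_image by (rule image_cong) (auto simp: add image_image)
  moreover have "inj_on (image T) X" for X
    using inj by (simp add: inj_on_image inj_on_def inj_image_eq_iff)
  ultimately show ?thesis
    unfolding subgroup_index_def A using card_cosets_span[OF D] by (simp add: card_image)
qed

section \<open>Flows with complex coefficients\<close>

text \<open>The two terms cancel on a loop, which therefore takes no part in conservation.\<close>

definition incidence_number :: "('e \<Rightarrow> 'v) \<Rightarrow> ('e \<Rightarrow> 'v) \<Rightarrow> 'v \<Rightarrow> 'e \<Rightarrow> int" where
  "incidence_number s t v e = of_bool (t e = v) - of_bool (s e = v)"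

lemma prod_powi_right: "(\<Prod>i\<in>A. f i) powi k = (\<Prod>i\<in>A. f i powi k)"
  for f :: "'a \<Rightarrow> 'b::field"
  by (induction A rule: infinite_finite_induct) (auto simp: power_int_mult_distrib)

lemma powi_sum: "x \<noteq> 0 \<Longrightarrow> x powi (\<Sum>i\<in>A. f i) = (\<Prod>i\<in>A. x powi f i)"
  for x :: "'b::field"
  by (induction A rule: infinite_finite_induct) (auto simp: power_int_add)

text \<open>Universal coefficients for the multiplicative group, by contraction of edges: conservation
  at an endpoint of an edge determines the flow on this edge from the flow on the others.\<close>

lemma fundamental_flows:
  fixes s t :: "'e \<Rightarrow> 'v"
  assumes "finite E"
  shows "\<exists>F (z :: 'e \<Rightarrow> 'e \<Rightarrow> int). F \<subseteq> E \<and> (\<forall>f\<in>F. \<forall>f'\<in>F. z f f' = of_bool (f = f')) \<and>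
     (\<forall>f\<in>F. \<forall>v\<in>S. (\<Sum>e\<in>E. incidence_number s t v e * z f e) = 0) \<and>
     (\<forall>\<mu> :: 'e \<Rightarrow> complex. (\<forall>e\<in>E. \<mu> e \<noteq> 0) \<and> (\<forall>v\<in>S. (\<Prod>e\<in>E. \<mu> e powi incidence_number s t v e) = 1) \<longrightarrow>
      (\<forall>e\<in>E. \<mu> e = (\<Prod>f\<in>F. \<mu> f powi z f e)))"
  using assms
proof (induction "card E" arbitrary: E s t S rule: less_induct)
  case less
  note fin = less.prems
  show ?case
  proof (cases "\<exists>e\<in>E. s e \<noteq> t e \<and> (s e \<in> S \<or> t e \<in> S)")
    case False
    \<comment> \<open>No conservation condition involves any edge, so all edges are free and each
      generates its own flow.\<close>
    then have bd0: "incidence_number s t v e = 0" if "e \<in> E" "v \<in> S" for e v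
      using that by (auto simp: incidence_number_def of_bool_def)
    have "\<mu> e = (\<Prod>f\<in>E. \<mu> f powi of_bool (f = e))" if "e \<in> E" for e and \<mu> :: "'e \<Rightarrow> complex"
    proof -
      have "(\<Prod>f\<in>E. \<mu> f powi of_bool (f = e)) = (\<Prod>f\<in>E. if f = e then \<mu> f else 1)"
        by (rule prod.cong) auto
      then show ?thesis using that fin by simp
    qed
    then show ?thesis
      by (intro exI[of _ E] exI[of _ "\<lambda>f e. of_bool (f = e)"]) (use bd0 in auto)
  next
    case True
    then obtain e0 v w where e0: "e0 \<in> E" and v: "v \<in> S" "v \<noteq> w"
      and ends: "s e0 = v \<and> t e0 = w \<or> s e0 = w \<and> t e0 = v" by metis
    let ?bd = "incidence_number s t"
    \<comment> \<open>The sign of \<open>e0\<close> at \<open>v\<close>; it is its own inverse, so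
      multiplying or raising to the power \<open>c\<close> solves the equation at \<open>v\<close>
      for \<open>e0\<close>.\<close>
    define c where "c = ?bd v e0"
    have c: "c * c = 1" "?bd w e0 = - c" "?bd v e0 = c"
      using ends v by (auto simp: c_def incidence_number_def)
    have bd_other: "?bd u e0 = 0" if "u \<noteq> v" "u \<noteq> w" for u
      using ends that by (auto simp: incidence_number_def)
    \<comment> \<open>Contracting \<open>e0\<close> merges \<open>v\<close> into \<open>w\<close>.
      If \<open>w\<close> lies in \<open>S\<close>, conservation at the merged vertex is the
      combination of the conditions at \<open>v\<close> and \<open>w\<close>, in which
      \<open>e0\<close> cancels; otherwise the condition at \<open>v\<close> alone is spent on
      determining \<open>e0\<close>.\<close>
    define ren where "ren u = (if u = v then w else u)" for u
    let ?bd' = "incidence_number (ren \<circ> s) (ren \<circ> t)"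
    have bd': "?bd' u e = (if u = w then ?bd v e + ?bd w e else ?bd u e)" if "u \<noteq> v" for u e
      using that v by (auto simp: incidence_number_def ren_def)
    let ?E = "E - {e0}"
    have "card ?E < card E" using e0 fin by (meson card_Diff1_less)
    from less.hyps[OF this, of "S - {v}" "ren \<circ> s" "ren \<circ> t"] fin
    obtain F and z' :: "'e \<Rightarrow> 'e \<Rightarrow> int" where F: "F \<subseteq> ?E"
      and unit: "\<forall>f\<in>F. \<forall>f'\<in>F. z' f f' = of_bool (f = f')"
      and cons: "\<forall>f\<in>F. \<forall>u\<in>S - {v}. (\<Sum>e\<in>?E. ?bd' u e * z' f e) = 0"
      and gen: "\<forall>\<mu> :: 'e \<Rightarrow> complex. (\<forall>e\<in>?E. \<mu> e \<noteq> 0) \<and> (\<forall>u\<in>S - {v}. (\<Prod>e\<in>?E. \<mu> e powi ?bd' u e) = 1) \<longrightarrow>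
        (\<forall>e\<in>?E. \<mu> e = (\<Prod>f\<in>F. \<mu> f powi z' f e))"
      by auto
    \<comment> \<open>The value on the contracted edge is the one dictated by conservation at
      \<open>v\<close>.\<close>
    define z where "z f e = (if e = e0 then - c * (\<Sum>e\<in>?E. ?bd v e * z' f e) else z' f e)" for f e
    have sumE: "(\<Sum>e\<in>E. ?bd u e * z f e) = ?bd u e0 * z f e0 + (\<Sum>e\<in>?E. ?bd u e * z' f e)" for u f
    proof -
      have "(\<Sum>e\<in>E. ?bd u e * z f e) = ?bd u e0 * z f e0 + (\<Sum>e\<in>?E. ?bd u e * z f e)"
        by (rule sum.remove[OF fin e0])
      also have "(\<Sum>e\<in>?E. ?bd u e * z f e) = (\<Sum>e\<in>?E. ?bd u e * z' f e)"
        by (rule sum.cong) (auto simp: z_def)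
      finally show ?thesis .
    qed
    have ze0: "z f e0 = - c * (\<Sum>e\<in>?E. ?bd v e * z' f e)" for f by (simp add: z_def)
    have "(\<Sum>e\<in>E. ?bd u e * z f e) = 0" if f: "f \<in> F" and u: "u \<in> S" for f u
    proof -
      consider "u = v" | "u = w" | "u \<noteq> v" "u \<noteq> w" by blast
      then show ?thesis
      proof cases
        case 1
        show ?thesis unfolding sumE ze0 1 c(3) using c(1) by (simp add: mult.assoc[symmetric])
      next
        case 2
        have "(\<Sum>e\<in>?E. ?bd' w e * z' f e) = 0" using cons f u v 2 by auto
        then have "(\<Sum>e\<in>?E. ?bd v e * z' f e) + (\<Sum>e\<in>?E. ?bd w e * z' f e) = 0"
          using v by (simp add: bd' distrib_right sum.distrib)
        then show ?thesis unfolding sumE ze0 2 c(2) using c(1) by (simp add: mult.assoc[symmetric])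
      next
        case 3
        have "(\<Sum>e\<in>?E. ?bd' u e * z' f e) = 0" using cons f u 3 by auto
        then show ?thesis unfolding sumE bd_other[OF 3] using 3 by (simp add: bd')
      qed
    qed
    moreover have "\<forall>e\<in>E. \<mu> e = (\<Prod>f\<in>F. \<mu> f powi z f e)"
      if \<mu>: "\<forall>e\<in>E. \<mu> e \<noteq> 0" "\<forall>u\<in>S. (\<Prod>e\<in>E. \<mu> e powi ?bd u e) = 1" for \<mu> :: "'e \<Rightarrow> complex"
    proof -
      have prodE: "(\<Prod>e\<in>E. \<mu> e powi ?bd u e) = \<mu> e0 powi ?bd u e0 * (\<Prod>e\<in>?E. \<mu> e powi ?bd u e)" for u
        by (rule prod.remove[OF fin e0])
      have m0: "\<mu> e0 \<noteq> 0" using \<mu>(1) e0 by auto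
      have pv: "\<mu> e0 powi c * (\<Prod>e\<in>?E. \<mu> e powi ?bd v e) = 1"
        using \<mu>(2) v prodE[of v] c(3) by auto
      have "(\<Prod>e\<in>?E. \<mu> e powi ?bd' u e) = 1" if u: "u \<in> S - {v}" for u
      proof (cases "u = w")
        case True
        have pw: "\<mu> e0 powi (- c) * (\<Prod>e\<in>?E. \<mu> e powi ?bd w e) = 1"
          using \<mu>(2) u True prodE[of w] c(2) by auto
        have "(\<Prod>e\<in>?E. \<mu> e powi ?bd' u e) = (\<Prod>e\<in>?E. \<mu> e powi ?bd v e) * (\<Prod>e\<in>?E. \<mu> e powi ?bd w e)"
          using \<mu>(1) u True by (simp add: bd' power_int_add prod.distrib)
        also have "\<dots> = (\<mu> e0 powi c * (\<Prod>e\<in>?E. \<mu> e powi ?bd v e)) * (\<mu> e0 powi (- c) * (\<Prod>e\<in>?E. \<mu> e powi ?bd w e))"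
          using m0 by (simp add: power_int_minus field_simps)
        also have "\<dots> = 1" unfolding pv pw by simp
        finally show ?thesis .
      next
        case False
        then have "?bd u e0 = 0" using bd_other u by auto
        then show ?thesis using \<mu>(2) u False prodE[of u] by (auto simp: bd')
      qed
      then have E': "\<mu> e = (\<Prod>f\<in>F. \<mu> f powi z' f e)" if "e \<in> ?E" for e
        using gen \<mu>(1) that by auto
      have "\<mu> e0 = (\<mu> e0 powi c) powi c" using c(1) by (simp add: power_int_mult[symmetric])
      also have "\<mu> e0 powi c = inverse (\<Prod>e\<in>?E. \<mu> e powi ?bd v e)"
        using pv by (metis inverse_unique mult.commute)
      also have "\<dots> powi c = (\<Prod>e\<in>?E. \<mu> e powi ?bd v e) powi (- c)"
        by (simp add: power_int_minus power_int_inverse)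
      also have "\<dots> = (\<Prod>e\<in>?E. \<Prod>f\<in>F. \<mu> f powi (- c * (?bd v e * z' f e)))"
      proof -
        have "(\<mu> e powi ?bd v e) powi (- c) = (\<Prod>f\<in>F. \<mu> f powi (- c * (?bd v e * z' f e)))" if "e \<in> ?E" for e
          by (subst E'[OF that]) (simp add: prod_powi_right power_int_mult[symmetric] mult_ac)
        then show ?thesis unfolding prod_powi_right by (intro prod.cong) auto
      qed
      also have "\<dots> = (\<Prod>f\<in>F. \<Prod>e\<in>?E. \<mu> f powi (- c * (?bd v e * z' f e)))" by (rule prod.swap)
      also have "\<dots> = (\<Prod>f\<in>F. \<mu> f powi z f e0)"
        unfolding ze0 sum_distrib_left using \<mu>(1) F by (intro prod.cong refl powi_sum[symmetric]) auto
      finally have "\<mu> e0 = (\<Prod>f\<in>F. \<mu> f powi z f e0)" .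
      moreover have "\<mu> e = (\<Prod>f\<in>F. \<mu> f powi z f e)" if "e \<in> E" "e \<noteq> e0" for e
        using E'[of e] that by (simp add: z_def)
      ultimately show ?thesis by blast
    qed
    moreover have "\<forall>f\<in>F. \<forall>f'\<in>F. z f f' = of_bool (f = f')" using unit F by (auto simp: z_def)
    ultimately show ?thesis using F by (intro exI[of _ F] exI[of _ z]) auto
  qed
qed

section \<open>Curves with marked points\<close>

lemma primitive_parallel:
  fixes u v :: "int \<times> int"
  assumes u: "coprime (fst u) (snd u)" and v: "coprime (fst v) (snd v)" and d: "det2 u v = 0"
  shows "u = v \<or> u = - v"
proof -
  have "\<bar>fst u\<bar> * \<bar>snd v\<bar> = \<bar>fst v\<bar> * \<bar>snd u\<bar>"
    using d by (simp add: det2_def mult.commute abs_mult[symmetric])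
  then have "\<bar>fst u\<bar> = \<bar>fst v\<bar>" "\<bar>snd v\<bar> = \<bar>snd u\<bar>"
    using coprime_crossproduct_int[OF u v] by simp_all
  then show ?thesis using d by (auto simp: abs_eq_iff det2_def prod_eq_iff)
qed

lemma det2_smul: "det2 (smul j a) (smul k b) = j * k * det2 a b"
  by (simp add: det2_def smul_def algebra_simps)

text \<open>This identifies the image of \<open>N_e\<close> tensored with the multiplicative group
  as the kernel of a single character. Primitivity of \<open>u\<close> supplies Bezout coefficients,
  from which the parameter on the line is recovered.\<close>

lemma line_tensor_Cstar:
  assumes "coprime (fst u) (snd u)"
  shows "line_tensor Cstar u = {z \<in> torus. dett u z = 1}"
proof (intro equalityI subsetI)
  fix z assume "z \<in> line_tensor Cstar u"
  then obtain t where t: "t \<noteq> 0" "z = (t powi fst u, t powi snd u)" by (auto simp: line_tensor_def)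
  then have z: "z \<in> torus" by (simp add: torus_def)
  have "dett u z = 1"
    unfolding dett_eq[OF z] using t
    by (simp add: power_int_mult[symmetric] power_int_add[symmetric] power_int_minus mult.commute)
  then show "z \<in> {z \<in> torus. dett u z = 1}" using z by simp
next
  fix z assume "z \<in> {z \<in> torus. dett u z = 1}"
  then have z: "z \<in> torus" "fst z \<noteq> 0" "snd z \<noteq> 0" and eq: "snd z powi fst u = fst z powi snd u"
    by (auto simp: dett_eq torus_def power_int_minus field_simps)
  obtain a c where ac: "a * fst u + c * snd u = 1" using bezout_int[of "fst u" "snd u"] assms by auto
  define t where "t = fst z powi a * snd z powi c"
  have "t powi fst u = fst z powi (a * fst u) * (snd z powi fst u) powi c"
    by (simp add: t_def power_int_mult_distrib power_int_mult[symmetric] mult.commute)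
  also have "\<dots> = fst z powi (a * fst u + c * snd u)"
    unfolding eq using z by (simp add: power_int_mult[symmetric] power_int_add mult.commute)
  finally have 1: "t powi fst u = fst z" using ac by simp
  have "t powi snd u = (fst z powi snd u) powi a * snd z powi (c * snd u)"
    by (simp add: t_def power_int_mult_distrib power_int_mult[symmetric] mult.commute)
  also have "\<dots> = snd z powi (a * fst u + c * snd u)"
    unfolding eq[symmetric] using z by (simp add: power_int_mult[symmetric] power_int_add mult.commute)
  finally have 2: "t powi snd u = snd z" using ac by simp
  have "t \<noteq> 0" using z by (simp add: t_def)
  then show "z \<in> line_tensor Cstar u"
    unfolding line_tensor_def using 1 2 by (auto intro!: exI[of _ t])
qed

lemma hom_Cstar_mult: "f \<in> hom G Cstar \<Longrightarrow> g \<in> hom G Cstar \<Longrightarrow> (\<lambda>x. f x * g x) \<in> hom G Cstar"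
  by (auto simp: hom_def)

lemma hom_Cstar_divide: "f \<in> hom G Cstar \<Longrightarrow> g \<in> hom G Cstar \<Longrightarrow> (\<lambda>x. f x / g x) \<in> hom G Cstar"
  by (auto simp: hom_def)

lemma hom_Cstar_prod:
  assumes "group G" "\<And>i. i \<in> A \<Longrightarrow> f i \<in> hom G Cstar"
  shows "(\<lambda>x. \<Prod>i\<in>A. f i x) \<in> hom G Cstar"
  using assms(2)
proof (induction A rule: infinite_finite_induct)
  case (insert i A)
  then show ?case by (simp add: hom_Cstar_mult)
qed (auto simp: hom_def)

lemma subgroup_common_kernel:
  assumes "group G" "\<And>h. h \<in> H \<Longrightarrow> h \<in> hom G Cstar"
  shows "subgroup {x \<in> carrier G. \<forall>h\<in>H. h x = 1} G"
proof -
  interpret group G by fact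
  have one: "h \<one>\<^bsub>G\<^esub> = 1" if "h \<in> H" for h
    using hom_one[OF assms(2)[OF that] assms(1) group_Cstar] by simp
  show ?thesis
  proof
    fix x assume x: "x \<in> {x \<in> carrier G. \<forall>h\<in>H. h x = 1}"
    then have "h (inv\<^bsub>G\<^esub> x) = 1" if "h \<in> H" for h
      using hom_mult[OF assms(2)[OF that], of "inv\<^bsub>G\<^esub> x" x] one[OF that] that by auto
    then show "inv\<^bsub>G\<^esub> x \<in> {x \<in> carrier G. \<forall>h\<in>H. h x = 1}" using x by simp
  qed (auto simp: one hom_mult[OF assms(2)])
qed

lemma group_Cstar2: "group (Cstar2)"
  by (intro DirProd_group group_Cstar)

lemma inv_Cstar2: "z \<in> torus \<Longrightarrow> inv\<^bsub>Cstar2\<^esub> z = (inverse (fst z), inverse (snd z))"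
  by (cases z) (simp add: torus_def inv_DirProd[OF group_Cstar group_Cstar])

lemma dett_inv:
  assumes "z \<in> torus"
  shows "dett v (inv\<^bsub>Cstar2\<^esub> z) = inverse (dett v z)"
proof -
  have t: "(inverse (fst z), inverse (snd z)) \<in> torus" using assms by (simp add: torus_def)
  show ?thesis using assms
    by (simp add: inv_Cstar2 dett_eq[OF t] dett_eq[OF assms] power_int_inverse)
qed

text \<open>The setting of the subdivided curve, with \<open>Q\<close> the set of marked vertices.
  The local conditions concern the other vertices: the marked ones are bivalent, and an immersion at
  a trivalent vertex is what makes its multiplicity nonzero.\<close>

locale marked_curve = torus_graph \<Lambda> b G
  for \<Lambda> :: "(real \<times> real) set" and b and G :: "('v, 'e) tcurve" +
  fixes Q :: "'v set" and \<rho> :: "nat \<Rightarrow> real \<Rightarrow> real \<times> real"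
  assumes marked_in: "Q \<subseteq> verts G"
    and edges_nonempty: "edges G \<noteq> {}"
    and coprime_dir: "e \<in> edges G \<Longrightarrow> coprime (fst (dir G e)) (snd (dir G e))"
    and balanced: "v \<in> verts G - Q \<Longrightarrow> (\<Sum>f\<in>flags G v. flag_slope G f) = 0"
    and trivalent: "v \<in> verts G - Q \<Longrightarrow> card (flags G v) = 3"
    and immersed: "v \<in> verts G - Q \<Longrightarrow> inj_on (flag_dir G) (flags G v)"
    and connected: "connected_off G Q"
    and rank2: "free_of_rank (H1_off G Q) 2"
    and inj_hclass: "inj_on (hclass G) (H1_off G Q)"
    and loop: "k < 2 \<Longrightarrow> loop_in_class (\<rho> k) (b k)"
    and transv: "k < 2 \<Longrightarrow> transverse \<Lambda> G (\<rho> k)"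
begin

abbreviation "Dom \<equiv> Psi_dom Cstar G"
abbreviation "cross k \<equiv> crossings \<Lambda> G (\<rho> k)"
abbreviation "csign k \<equiv> crossing_sign G (\<rho> k)"
abbreviation "loopv k \<equiv> loop_value Cstar \<Lambda> G (\<rho> k)"

section \<open>Local analysis at a trivalent vertex\<close>

lemma flag_edge: "f \<in> flags G v \<Longrightarrow> fst f \<in> edges G"
  by (auto simp: flags_def)

lemma coprime_flag_dir: "f \<in> flags G v \<Longrightarrow> coprime (fst (flag_dir G f)) (snd (flag_dir G f))"
  using coprime_dir[OF flag_edge] by (auto simp: flag_dir_def)

text \<open>By balancing, all pairs of flags have the same determinant up to sign. It is not zero:
  distinct parallel primitive directions are opposite, and three distinct directions cannot be
  pairwise opposite.\<close>

lemma vertex_flags: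
  assumes v: "v \<in> verts G - Q"
  obtains f1 f2 f3 where "flags G v = {f1, f2, f3}" "f1 \<noteq> f2" "f2 \<noteq> f3" "f1 \<noteq> f3"
    "flag_slope G f3 = - (flag_slope G f1 + flag_slope G f2)"
    "det2 (flag_slope G f1) (flag_slope G f2) \<noteq> 0"
    "vertex_mult G v = nat \<bar>det2 (flag_slope G f1) (flag_slope G f2)\<bar>"
proof -
  have "\<exists>f1 f2 f3. flags G v = {f1, f2, f3} \<and> f1 \<noteq> f2 \<and> f2 \<noteq> f3 \<and> f1 \<noteq> f3"
    using trivalent[OF v] unfolding card_3_iff .
  then obtain f1 f2 f3 where fl: "flags G v = {f1, f2, f3}" and ne: "f1 \<noteq> f2" "f2 \<noteq> f3" "f1 \<noteq> f3"
    by (elim exE conjE)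
  let ?a = "flag_slope G"
  have "?a f1 + ?a f2 + ?a f3 = 0" using balanced[OF v] fl ne by (simp add: add.assoc)
  then have s3: "?a f3 = - (?a f1 + ?a f2)" by (metis add.commute eq_neg_iff_add_eq_0)
  have dets: "det2 (?a f2) (?a f3) = det2 (?a f1) (?a f2)" "det2 (?a f1) (?a f3) = - det2 (?a f1) (?a f2)"
    unfolding s3 by (simp_all add: det2_def algebra_simps)
  have par: "flag_dir G f = - flag_dir G f'"
    if "f \<in> flags G v" "f' \<in> flags G v" "f \<noteq> f'" "det2 (?a f) (?a f') = 0" for f f'
  proof -
    have "det2 (flag_dir G f) (flag_dir G f') = 0"
      using that(4) wt_pos[OF flag_edge[OF that(1)]] wt_pos[OF flag_edge[OF that(2)]]
      by (simp add: flag_slope_def det2_smul)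
    moreover have "flag_dir G f \<noteq> flag_dir G f'" using immersed[OF v] that by (auto dest: inj_onD)
    ultimately show ?thesis
      using primitive_parallel[OF coprime_flag_dir[OF that(1)] coprime_flag_dir[OF that(2)]] by blast
  qed
  have D: "det2 (?a f1) (?a f2) \<noteq> 0"
  proof
    assume 0: "det2 (?a f1) (?a f2) = 0"
    have "flag_dir G f1 = - flag_dir G f2" "flag_dir G f2 = - flag_dir G f3" "flag_dir G f1 = - flag_dir G f3"
      using par dets 0 ne fl by auto
    then have "flag_dir G f2 = flag_dir G f1" using fl by simp
    then show False using immersed[OF v] fl ne by (auto dest: inj_onD)
  qed
  have swap: "\<bar>det2 x y\<bar> = \<bar>det2 y x\<bar>" for x y :: "int \<times> int"
    by (simp add: det2_def abs_minus_commute mult.commute)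
  have "\<bar>det2 (?a f) (?a f')\<bar> = \<bar>det2 (?a f1) (?a f2)\<bar>"
    if "f \<in> flags G v" "f' \<in> flags G v" "f \<noteq> f'" for f f'
    using that dets swap[of "?a f2" "?a f1"] swap[of "?a f3" "?a f1"] swap[of "?a f3" "?a f2"]
    unfolding fl by (elim insertE emptyE; simp)
  then have uniq: "m = nat \<bar>det2 (?a f1) (?a f2)\<bar>"
    if "\<exists>f\<in>flags G v. \<exists>f'\<in>flags G v. f \<noteq> f' \<and> m = nat \<bar>det2 (?a f) (?a f')\<bar>" for m
    using that by metis
  have vm: "vertex_mult G v = nat \<bar>det2 (?a f1) (?a f2)\<bar>"
    unfolding vertex_mult_def
  proof (rule the_equality)
    show "\<exists>f\<in>flags G v. \<exists>f'\<in>flags G v. f \<noteq> f' \<and> nat \<bar>det2 (?a f1) (?a f2)\<bar> = nat \<bar>det2 (?a f) (?a f')\<bar>"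
      by (rule bexI[of _ f1], rule bexI[of _ f2]) (use fl ne in simp_all)
  qed (rule uniq)
  show ?thesis by (rule that[OF fl ne s3 D vm])
qed

text \<open>Balancing and the product condition make the third equation a consequence of the other
  two, which leaves a system counted by \<open>card_dett_system\<close>.\<close>

lemma card_vertex_solutions:
  assumes v: "v \<in> verts G - Q" and nz: "\<And>f. f \<in> flags G v \<Longrightarrow> \<nu> f \<noteq> 0"
    and p: "(\<Prod>f\<in>flags G v. \<nu> f) = 1"
  shows "card {z \<in> torus. \<forall>f\<in>flags G v. dett (flag_slope G f) z = \<nu> f} = vertex_mult G v"
    and "vertex_mult G v > 0"
proof -
  obtain f1 f2 f3 where fl: "flags G v = {f1, f2, f3}" "f1 \<noteq> f2" "f2 \<noteq> f3" "f1 \<noteq> f3"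
    and s3: "flag_slope G f3 = - (flag_slope G f1 + flag_slope G f2)"
    and D: "det2 (flag_slope G f1) (flag_slope G f2) \<noteq> 0"
    and vm: "vertex_mult G v = nat \<bar>det2 (flag_slope G f1) (flag_slope G f2)\<bar>"
    using vertex_flags[OF v] by blast
  have nz': "\<nu> f1 \<noteq> 0" "\<nu> f2 \<noteq> 0" "\<nu> f3 \<noteq> 0" using nz fl by auto
  have "\<nu> f1 * (\<nu> f2 * \<nu> f3) = 1" using p fl by simp
  then have n3: "\<nu> f3 = inverse (\<nu> f1 * \<nu> f2)" by (metis inverse_unique mult.assoc)
  have "{z \<in> torus. \<forall>f\<in>flags G v. dett (flag_slope G f) z = \<nu> f} =
     {z \<in> torus. dett (flag_slope G f1) z = \<nu> f1 \<and> dett (flag_slope G f2) z = \<nu> f2}"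
    unfolding fl(1) s3 n3 by (auto simp: s3 n3 dett_add dett_uminus simp del: inverse_mult_distrib minus_add_distrib)
  then show "card {z \<in> torus. \<forall>f\<in>flags G v. dett (flag_slope G f) z = \<nu> f} = vertex_mult G v"
    using card_dett_system[OF D nz'(1,2)] vm by simp
  show "vertex_mult G v > 0" using vm D by simp
qed

text \<open>Let \<open>V\<close> be the combination of the slopes with coefficients
  \<open>k / w\<close>. By balancing, its determinants with two of the slopes are differences of
  these fractions times the vertex determinant. Triviality of the character makes them divisible by
  that determinant, so the differences are integers.\<close>

lemma vertex_character:
  assumes v: "v \<in> verts G - Q" and k: "\<And>f. f \<in> flags G v \<Longrightarrow> k (fst f) < wt G (fst f)"
    and triv: "\<And>z. z \<in> torus \<Longrightarrow> \<forall>f\<in>flags G v. dett (flag_slope G f) z = 1 \<Longrightarrow>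
        (\<Prod>f\<in>flags G v. dett (flag_dir G f) z ^ k (fst f)) = 1"
    and ff: "f \<in> flags G v" "f' \<in> flags G v"
  shows "k (fst f) * wt G (fst f') = k (fst f') * wt G (fst f)"
proof -
  obtain f1 f2 f3 where fl: "flags G v = {f1, f2, f3}" "f1 \<noteq> f2" "f2 \<noteq> f3" "f1 \<noteq> f3"
    and s3: "flag_slope G f3 = - (flag_slope G f1 + flag_slope G f2)"
    and D: "det2 (flag_slope G f1) (flag_slope G f2) \<noteq> 0"
    and "vertex_mult G v = nat \<bar>det2 (flag_slope G f1) (flag_slope G f2)\<bar>"
    by (rule vertex_flags[OF v])
  let ?a = "flag_slope G" and ?D = "det2 (flag_slope G f1) (flag_slope G f2)"
  define V where "V = (\<Sum>f\<in>flags G v. smul (int (k (fst f))) (flag_dir G f))"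
  have Vt: "dett V z = 1" if z: "z \<in> torus" "dett (?a f1) z = 1" "dett (?a f2) z = 1" for z
  proof -
    have "\<forall>f\<in>flags G v. dett (?a f) z = 1"
      using z unfolding fl(1) by (auto simp: s3 dett_add dett_uminus simp del: minus_add_distrib)
    then show ?thesis using triv[OF z(1)] unfolding V_def by (simp add: dett_sum dett_smul z(1))
  qed
  have dvd: "?D dvd det2 V (?a f1)" "?D dvd det2 V (?a f2)"
    by (rule dett_trivial_imp_dvd[OF D], erule (2) Vt)+
  define \<kappa> where "\<kappa> f = real (k (fst f)) / real (wt G (fst f))" for f :: "'e \<times> bool"
  have w: "wt G (fst f) > 0" if "f \<in> flags G v" for f using wt_pos[OF flag_edge[OF that]] .
  have \<kappa>: "0 \<le> \<kappa> f" "\<kappa> f < 1" if "f \<in> flags G v" for f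
    using k[OF that] w[OF that] by (auto simp: \<kappa>_def)
  have comp: "real_of_int (c (smul (int (k (fst f))) (flag_dir G f))) = \<kappa> f * real_of_int (c (?a f))"
    if "f \<in> flags G v" "c = fst \<or> c = snd" for f c
    using w[OF that(1)] that(2) by (auto simp: \<kappa>_def flag_slope_def smul_def)
  have V: "real_of_int (c V) = \<kappa> f1 * c (?a f1) + \<kappa> f2 * c (?a f2) + \<kappa> f3 * c (?a f3)"
    if "c = fst \<or> c = snd" for c
  proof -
    have "V = smul (int (k (fst f1))) (flag_dir G f1) + smul (int (k (fst f2))) (flag_dir G f2) + smul (int (k (fst f3))) (flag_dir G f3)"
      using fl by (simp add: V_def add.assoc)
    then have "real_of_int (c V) = real_of_int (c (smul (int (k (fst f1))) (flag_dir G f1)))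
       + real_of_int (c (smul (int (k (fst f2))) (flag_dir G f2))) + real_of_int (c (smul (int (k (fst f3))) (flag_dir G f3)))"
      using that by auto
    then show ?thesis using comp[OF _ that] fl(1) by simp
  qed
  have 1: "real_of_int (det2 V (?a f1)) = (\<kappa> f3 - \<kappa> f2) * of_int ?D"
    by (simp add: det2_def V s3 algebra_simps)
  have 2: "real_of_int (det2 V (?a f2)) = (\<kappa> f1 - \<kappa> f3) * of_int ?D"
    by (simp add: det2_def V s3 algebra_simps)
  have eq: "x = y" if n: "real_of_int n = (x - y) * of_int ?D" "?D dvd n" and xy: "0 \<le> x" "x < 1" "0 \<le> y" "y < 1" for x y n
  proof -
    obtain m where "n = ?D * m" using n(2) by (rule dvdE)
    then have "of_int m * real_of_int ?D = (x - y) * of_int ?D" using n(1) by simp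
    then have m: "of_int m = x - y" using D by simp
    then have "m = 0" using xy by linarith
    then show ?thesis using m by simp
  qed
  have mem: "f1 \<in> flags G v" "f2 \<in> flags G v" "f3 \<in> flags G v" using fl(1) by auto
  \<comment> \<open>Two fractions in the half-open unit interval that differ by an integer are
    equal; this is where \<open>k < w\<close> enters.\<close>
  have "\<kappa> f3 = \<kappa> f2" by (rule eq[OF 1 dvd(1) \<kappa>[OF mem(3)] \<kappa>[OF mem(2)]])
  moreover have "\<kappa> f1 = \<kappa> f3" by (rule eq[OF 2 dvd(2) \<kappa>[OF mem(1)] \<kappa>[OF mem(3)]])
  ultimately have "\<kappa> f = \<kappa> f'" using ff unfolding fl(1) by (elim insertE emptyE; simp)
  then have "real (k (fst f)) * real (wt G (fst f')) = real (k (fst f')) * real (wt G (fst f))"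
    using w ff by (simp add: \<kappa>_def field_simps)
  then show ?thesis by (simp only: of_nat_mult[symmetric] of_nat_eq_iff)
qed

end

section \<open>The enlarged group and the kernel of \<Psi> inside it\<close>

lemma nonzero_pairs [simp]: "{z::complex. z \<noteq> 0} \<times> {z. z \<noteq> 0} = torus"
  by (auto simp: torus_def)

context marked_curve
begin

text \<open>All conditions of the kernel of \<open>\<Psi>\<close>, with the one on an edge raised to the power \<open>w\<^sub>e\<close>.\<close>

definition Phi :: "('v \<Rightarrow> complex \<times> complex) set" where
  "Phi = {\<phi> \<in> carrier Dom. (\<forall>v\<in>Q. \<phi> v = (1, 1)) \<and>
      (\<forall>e\<in>edges G. dett (slope G e) (\<phi> (src G e)) = dett (slope G e) (\<phi> (tgt G e))) \<and>
      (\<forall>k<2. loopv k \<phi> = 1)}"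

definition twist :: "'e \<Rightarrow> ('v \<Rightarrow> complex \<times> complex) \<Rightarrow> complex" where
  "twist e \<phi> = dett (dir G e) (\<phi> (tgt G e)) / dett (dir G e) (\<phi> (src G e))"

definition loop_weight :: "nat \<Rightarrow> ('e \<Rightarrow> complex) \<Rightarrow> complex" where
  "loop_weight k \<mu> = (\<Prod>(t, e, s)\<in>cross k. \<mu> e powi csign k t e)"

lemma carrier_Psi_dom: "carrier Dom = (\<Pi>\<^sub>E v\<in>verts G. torus)"
  by (simp add: Psi_dom_def)

lemma group_Psi_dom: "group (Dom)"
  unfolding Psi_dom_def by (simp add: group_Cstar2)

lemma Psi_dom_torus: "\<phi> \<in> carrier Dom \<Longrightarrow> v \<in> verts G \<Longrightarrow> \<phi> v \<in> torus"
  by (auto simp: carrier_Psi_dom)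

lemma hom_dett_eval:
  assumes "v \<in> verts G"
  shows "(\<lambda>\<phi>. dett u (\<phi> v)) \<in> hom Dom Cstar"
proof (rule homI)
  fix \<phi> \<psi> assume "\<phi> \<in> carrier Dom" "\<psi> \<in> carrier Dom"
  moreover have "(\<phi> \<otimes>\<^bsub>Dom\<^esub> \<psi>) v = \<phi> v \<otimes>\<^bsub>Cstar2\<^esub> \<psi> v"
    using assms by (simp add: Psi_dom_def)
  ultimately show "dett u ((\<phi> \<otimes>\<^bsub>Dom\<^esub> \<psi>) v) = dett u (\<phi> v) \<otimes>\<^bsub>Cstar\<^esub> dett u (\<psi> v)"
    using assms by (simp add: dett_mult Psi_dom_torus)
qed (use assms in \<open>simp add: dett_nonzero Psi_dom_torus\<close>)

lemma lattice_basis_mem: "b 0 \<in> \<Lambda>" "b 1 \<in> \<Lambda>"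
  unfolding lattice_mem_iff[OF lattice]
  using lattice_coord_combination[OF det_basis, of 1 0] lattice_coord_combination[OF det_basis, of 0 1]
  by auto

lemma crossing_number_basis:
  assumes "k < 2" "integral_cycle G z"
  shows "finite (cross k)"
    "of_int (\<Sum>(t, e, s)\<in>cross k. z e * csign k t e) =
        det2 (b k) (hclass G z) / \<bar>det2 (b 0) (b 1)\<bar>"
proof -
  have "k = 0 \<or> k = 1" using assms(1) by auto
  then have "b k \<in> \<Lambda>" using lattice_basis_mem by auto
  then show "finite (cross k)"
    "of_int (\<Sum>(t, e, s)\<in>cross k. z e * csign k t e) =
        det2 (b k) (hclass G z) / \<bar>det2 (b 0) (b 1)\<bar>"
    using crossing_number[OF assms(2) loop[OF assms(1)] _ transv[OF assms(1)]] by auto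
qed

lemma finite_crossings: "k < 2 \<Longrightarrow> finite (cross k)"
  \<comment> \<open>Finiteness of the crossings does not involve the cycle, so the zero cycle may be
    used.\<close>
  by (rule crossing_number_basis(1)[of _ "\<lambda>_. 0"]) (auto simp: integral_cycle_def)

lemma crossing_edge: "(t, e, s) \<in> crossings \<Lambda> G r \<Longrightarrow> e \<in> edges G"
  by (auto simp: crossings_def edge_fibre_def)

lemma loop_value_eq:
  assumes k: "k < 2" and \<phi>: "\<phi> \<in> carrier Dom"
  shows "loopv k \<phi> = (\<Prod>(t, e, s)\<in>cross k.
     if csign k t e = 1 then dett (slope G e) (\<phi> (src G e)) else dett (- slope G e) (\<phi> (tgt G e)))"
proof -
  have "loopv k \<phi> = (\<Prod>(t, e, s)\<in>cross k.
     if det2 (vector_derivative (\<rho> k) (at t)) (rvec (dir G e)) > 0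
      then dett (slope G e) (\<phi> (src G e)) else dett (- slope G e) (\<phi> (tgt G e)))"
    unfolding loop_value_def
    by (rule finprod_Cstar[OF finite_crossings[OF k]])
       (use \<phi> in \<open>auto dest!: crossing_edge simp: dett_nonzero Psi_dom_torus src_in tgt_in split: if_splits\<close>)
  moreover have "det2 (vector_derivative (\<rho> k) (at t)) (rvec (dir G e)) > 0 \<longleftrightarrow> csign k t e = 1" for t e
    by (simp add: crossing_sign_def)
  ultimately show ?thesis by simp
qed

lemma hom_loop_value: "k < 2 \<Longrightarrow> loopv k \<in> hom Dom Cstar"
proof -
  assume k: "k < 2"
  let ?f = "\<lambda>\<phi>. \<Prod>x\<in>cross k. case x of (t, e, s) \<Rightarrow>
     if csign k t e = 1 then dett (slope G e) (\<phi> (src G e)) else dett (- slope G e) (\<phi> (tgt G e))"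
  have "?f \<in> hom Dom Cstar"
  proof (rule hom_Cstar_prod[OF group_Psi_dom])
    fix x assume "x \<in> cross k"
    then obtain t e s where x: "x = (t, e, s)" and e: "e \<in> edges G"
      using crossing_edge by (cases x) blast
    show "(\<lambda>\<phi>. case x of (t, e, s) \<Rightarrow> if csign k t e = 1
        then dett (slope G e) (\<phi> (src G e)) else dett (- slope G e) (\<phi> (tgt G e))) \<in> hom Dom Cstar"
      unfolding x using hom_dett_eval[OF src_in[OF e]] hom_dett_eval[OF tgt_in[OF e]]
      by (cases "csign k t e = 1") simp_all
  qed
  then show ?thesis
    using loop_value_eq[OF k] monoid.m_closed[OF group.is_monoid[OF group_Psi_dom]] by (simp add: hom_def Pi_def)
qed

lemma hom_twist: "e \<in> edges G \<Longrightarrow> twist e \<in> hom Dom Cstar"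
  unfolding twist_def by (intro hom_Cstar_divide hom_dett_eval src_in tgt_in)

lemma torus_eq_one_iff: "z \<in> torus \<Longrightarrow> z = (1, 1) \<longleftrightarrow> (\<forall>u. dett u z = 1)"
proof
  assume z: "z \<in> torus" and u: "\<forall>u. dett u z = 1"
  from u have "dett (1, 0) z = 1" "dett (0, -1) z = 1" by blast+
  then show "z = (1, 1)" using z by (simp add: dett_eq prod_eq_iff)
qed (simp add: dett_one)

lemma subgroup_Phi: "subgroup Phi (Dom)"
proof -
  define H where "H = {\<lambda>\<phi>. dett u (\<phi> v) | u v. v \<in> Q} \<union>
      {\<lambda>\<phi>. dett (slope G e) (\<phi> (src G e)) / dett (slope G e) (\<phi> (tgt G e)) | e. e \<in> edges G} \<union>
      {loopv k | k. k < 2}"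
  have "h \<in> hom Dom Cstar" if "h \<in> H" for h
    using that marked_in unfolding H_def
    by (auto intro!: hom_Cstar_divide hom_dett_eval src_in tgt_in hom_loop_value)
  then have "subgroup {x \<in> carrier Dom. \<forall>h\<in>H. h x = 1} (Dom)"
    by (intro subgroup_common_kernel group_Psi_dom)
  moreover have "{x \<in> carrier Dom. \<forall>h\<in>H. h x = 1} = Phi"
  proof -
    have "(\<forall>h\<in>H. h \<phi> = 1) \<longleftrightarrow> (\<forall>v\<in>Q. \<phi> v = (1, 1)) \<and>
      (\<forall>e\<in>edges G. dett (slope G e) (\<phi> (src G e)) = dett (slope G e) (\<phi> (tgt G e))) \<and>
      (\<forall>k<2. loopv k \<phi> = 1)" if \<phi>: "\<phi> \<in> carrier Dom" for \<phi>
    proof -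
      have 1: "(\<forall>v\<in>Q. \<phi> v = (1, 1)) \<longleftrightarrow> (\<forall>v\<in>Q. \<forall>u. dett u (\<phi> v) = 1)"
        using torus_eq_one_iff[OF Psi_dom_torus[OF \<phi>]] marked_in by blast
      have 2: "dett (slope G e) (\<phi> (src G e)) = dett (slope G e) (\<phi> (tgt G e)) \<longleftrightarrow>
          dett (slope G e) (\<phi> (src G e)) / dett (slope G e) (\<phi> (tgt G e)) = 1" if "e \<in> edges G" for e
        using dett_nonzero[OF Psi_dom_torus[OF \<phi> tgt_in[OF that]]] by simp
      have "(\<forall>h\<in>{\<lambda>\<phi>. dett u (\<phi> v) | u v. v \<in> Q}. h \<phi> = 1) \<longleftrightarrow> (\<forall>v\<in>Q. \<forall>u. dett u (\<phi> v) = 1)" by auto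
      moreover have "(\<forall>h\<in>{\<lambda>\<phi>. dett (slope G e) (\<phi> (src G e)) / dett (slope G e) (\<phi> (tgt G e)) | e. e \<in> edges G}. h \<phi> = 1)
         \<longleftrightarrow> (\<forall>e\<in>edges G. dett (slope G e) (\<phi> (src G e)) = dett (slope G e) (\<phi> (tgt G e)))"
        using 2 by auto
      moreover have "(\<forall>h\<in>{loopv k | k. k < 2}. h \<phi> = 1) \<longleftrightarrow> (\<forall>k<2. loopv k \<phi> = 1)"
        by auto
      ultimately show ?thesis unfolding H_def 1 ball_Un by (simp only: conj_assoc)
    qed
    then show ?thesis unfolding Phi_def by (intro Collect_cong conj_cong refl)
  qed
  ultimately show ?thesis by simp
qed

lemma dett_slope: "z \<in> torus \<Longrightarrow> dett (slope G e) z = dett (dir G e) z ^ wt G e"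
  by (simp add: slope_def dett_smul)

lemma twist_torsion:
  assumes "\<phi> \<in> Phi" "e \<in> edges G"
  shows "twist e \<phi> ^ wt G e = 1"
proof -
  have t: "\<phi> (src G e) \<in> torus" "\<phi> (tgt G e) \<in> torus"
    using assms by (auto simp: Phi_def Psi_dom_torus src_in tgt_in)
  have "dett (slope G e) (\<phi> (src G e)) = dett (slope G e) (\<phi> (tgt G e))"
    using assms by (auto simp: Phi_def)
  then show ?thesis using t dett_nonzero[OF t(1), of "slope G e"]
    by (simp add: twist_def power_divide dett_slope)
qed

text \<open>By \<open>line_tensor_Cstar\<close> the component in the quotient by the line of
  \<open>e\<close> vanishes exactly when \<open>twist e \<phi> = 1\<close>. Its power of exponent
  \<open>wt G e\<close> is then the edge condition of \<open>Phi\<close>.\<close>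

lemma kernel_Psi:
  fixes V :: "nat \<Rightarrow> 'v"
  assumes V: "V ` {..<n} = Q"
  shows "kernel (Dom) (Psi_cod Cstar G n) (Psi Cstar \<Lambda> G n V \<rho>) = {\<phi> \<in> Phi. \<forall>e\<in>edges G. twist e \<phi> = 1}"
proof -
  have one: "\<one>\<^bsub>Psi_cod Cstar G n\<^esub> = ((\<lambda>e\<in>edges G. line_tensor Cstar (dir G e)), (\<lambda>i\<in>{..<n}. (1, 1)), (1, 1))"
    by (simp add: Psi_cod_def FactGroup_def)
  have sg: "subgroup (line_tensor Cstar (dir G e)) (Cstar2)" if e: "e \<in> edges G" for e
  proof -
    have "dett (dir G e) \<in> hom (Cstar2) Cstar"
      by (rule homI) (auto simp: dett_nonzero dett_mult)
    then have "subgroup {z \<in> carrier (Cstar2). \<forall>h\<in>{dett (dir G e)}. h z = 1} (Cstar2)"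
      by (intro subgroup_common_kernel group_Cstar2) auto
    then show ?thesis by (simp add: line_tensor_Cstar[OF coprime_dir[OF e]])
  qed
  have coset: "line_tensor Cstar (dir G e) #>\<^bsub>Cstar2\<^esub> (\<phi> (tgt G e) \<otimes>\<^bsub>Cstar2\<^esub> inv\<^bsub>Cstar2\<^esub> \<phi> (src G e))
      = line_tensor Cstar (dir G e) \<longleftrightarrow> twist e \<phi> = 1"
    if \<phi>: "\<phi> \<in> carrier Dom" and e: "e \<in> edges G" for \<phi> e
  proof -
    interpret K: group "Cstar2" by (rule group_Cstar2)
    have t: "\<phi> (src G e) \<in> torus" "\<phi> (tgt G e) \<in> torus"
      using \<phi> e by (auto simp: Psi_dom_torus src_in tgt_in)
    have ti: "inv\<^bsub>Cstar2\<^esub> \<phi> (src G e) \<in> torus" using K.inv_closed t(1) by simp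
    let ?x = "\<phi> (tgt G e) \<otimes>\<^bsub>Cstar2\<^esub> inv\<^bsub>Cstar2\<^esub> \<phi> (src G e)"
    have x: "?x \<in> carrier (Cstar2)" using torus_mult[OF t(2) ti] by simp
    have "line_tensor Cstar (dir G e) #>\<^bsub>Cstar2\<^esub> ?x = line_tensor Cstar (dir G e) \<longleftrightarrow> ?x \<in> line_tensor Cstar (dir G e)"
      using K.coset_join1[OF _ x sg[OF e]] K.coset_join2[OF x sg[OF e]] by blast
    also have "\<dots> \<longleftrightarrow> dett (dir G e) ?x = 1"
      using x by (simp add: line_tensor_Cstar[OF coprime_dir[OF e]])
    also have "dett (dir G e) ?x = twist e \<phi>"
      by (simp add: dett_mult[OF t(2) ti] dett_inv[OF t(1)] twist_def divide_inverse)
    finally show ?thesis .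
  qed
  have slope: "dett (slope G e) (\<phi> (src G e)) = dett (slope G e) (\<phi> (tgt G e))"
    if \<phi>: "\<phi> \<in> carrier Dom" and e: "e \<in> edges G" and "twist e \<phi> = 1" for \<phi> e
  proof -
    have t: "\<phi> (src G e) \<in> torus" "\<phi> (tgt G e) \<in> torus"
      using \<phi> e by (auto simp: Psi_dom_torus src_in tgt_in)
    then show ?thesis using that dett_nonzero[OF t(1), of "dir G e"] by (simp add: twist_def dett_slope)
  qed
  have eq: "Psi Cstar \<Lambda> G n V \<rho> \<phi> = \<one>\<^bsub>Psi_cod Cstar G n\<^esub> \<longleftrightarrow>
     (\<forall>e\<in>edges G. twist e \<phi> = 1) \<and> (\<forall>v\<in>Q. \<phi> v = (1, 1)) \<and> (\<forall>k<2. loopv k \<phi> = 1)"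
    if \<phi>: "\<phi> \<in> carrier Dom" for \<phi>
  proof -
    have r: "(\<lambda>x\<in>A. f x) = (\<lambda>x\<in>A. g x) \<longleftrightarrow> (\<forall>x\<in>A. f x = g x)" for A and f g :: "'x \<Rightarrow> 'y"
      by (metis restrict_apply' restrict_ext)
    have "(\<forall>k<2. loopv k \<phi> = 1) \<longleftrightarrow>
        loop_value Cstar \<Lambda> G (\<rho> 0) \<phi> = 1 \<and> loop_value Cstar \<Lambda> G (\<rho> 1) \<phi> = 1"
      by (auto simp: less_2_cases_iff)
    then show ?thesis
      unfolding one Psi_def prod.inject r V[symmetric] using coset[OF \<phi>] by auto
  qed
  show ?thesis
  proof (rule Set.set_eqI)
    fix \<phi>
    have "\<phi> \<in> carrier Dom \<and> Psi Cstar \<Lambda> G n V \<rho> \<phi> = \<one>\<^bsub>Psi_cod Cstar G n\<^esub> \<longleftrightarrow>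
        \<phi> \<in> Phi \<and> (\<forall>e\<in>edges G. twist e \<phi> = 1)"
      unfolding Phi_def mem_Collect_eq using eq[of \<phi>] slope[of \<phi>] by blast
    then show "\<phi> \<in> kernel (Dom) (Psi_cod Cstar G n) (Psi Cstar \<Lambda> G n V \<rho>) \<longleftrightarrow>
        \<phi> \<in> {\<phi> \<in> Phi. \<forall>e\<in>edges G. twist e \<phi> = 1}"
      unfolding kernel_def mem_Collect_eq .
  qed
qed

end

section \<open>Fibring the enlarged group over its flows\<close>

lemma (in comm_monoid_set) flags_split:
  assumes "finite (edges \<Gamma>)"
  shows "F h (flags \<Gamma> v) = f (F (\<lambda>e. h (e, True)) {e \<in> edges \<Gamma>. src \<Gamma> e = v})
     (F (\<lambda>e. h (e, False)) {e \<in> edges \<Gamma>. tgt \<Gamma> e = v})"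
proof -
  have "flags \<Gamma> v = (\<lambda>e. (e, True)) ` {e \<in> edges \<Gamma>. src \<Gamma> e = v} \<union> (\<lambda>e. (e, False)) ` {e \<in> edges \<Gamma>. tgt \<Gamma> e = v}"
    by (auto simp: flags_def)
  moreover have "F h ((\<lambda>e. (e, True)) ` {e \<in> edges \<Gamma>. src \<Gamma> e = v} \<union> (\<lambda>e. (e, False)) ` {e \<in> edges \<Gamma>. tgt \<Gamma> e = v})
     = f (F h ((\<lambda>e. (e, True)) ` {e \<in> edges \<Gamma>. src \<Gamma> e = v})) (F h ((\<lambda>e. (e, False)) ` {e \<in> edges \<Gamma>. tgt \<Gamma> e = v}))"
    by (rule union_disjoint) (use assms in auto)
  moreover have "F h ((\<lambda>e. (e, True)) ` A) = F (\<lambda>e. h (e, True)) A" "F h ((\<lambda>e. (e, False)) ` A) = F (\<lambda>e. h (e, False)) A" for A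
    by (subst reindex; simp add: inj_on_def o_def)+
  ultimately show ?thesis by simp
qed

context marked_curve
begin

text \<open>The flow on the edge as read in the direction leaving the vertex.\<close>

definition flag_value :: "('e \<Rightarrow> complex) \<Rightarrow> 'e \<times> bool \<Rightarrow> complex" where
  "flag_value \<mu> f = (if snd f then \<mu> (fst f) else inverse (\<mu> (fst f)))"

definition flow :: "('v \<Rightarrow> complex \<times> complex) \<Rightarrow> 'e \<Rightarrow> complex" where
  "flow \<phi> = (\<lambda>e\<in>edges G. dett (slope G e) (\<phi> (src G e)))"

definition Flows :: "('e \<Rightarrow> complex) set" where
  "Flows = {\<mu> \<in> edges G \<rightarrow>\<^sub>E {x. x \<noteq> 0}.
     (\<forall>e\<in>edges G. src G e \<in> Q \<or> tgt G e \<in> Q \<longrightarrow> \<mu> e = 1) \<and>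
     (\<forall>v\<in>verts G - Q. (\<Prod>f\<in>flags G v. flag_value \<mu> f) = 1) \<and>
     (\<forall>k<2. loop_weight k \<mu> = 1)}"

lemma flag_slope_eq: "flag_slope G f = (if snd f then slope G (fst f) else - slope G (fst f))"
  by (simp add: flag_slope_def slope_def flag_dir_def smul_def)

lemma loop_weight_cong: "(\<And>e. e \<in> edges G \<Longrightarrow> \<mu> e = \<mu>' e) \<Longrightarrow> loop_weight k \<mu> = loop_weight k \<mu>'"
  unfolding loop_weight_def by (rule prod.cong) (auto dest!: crossing_edge)

lemma loop_value_flow:
  assumes k: "k < 2" and \<phi>: "\<phi> \<in> carrier Dom"
    and eq: "\<And>e. e \<in> edges G \<Longrightarrow> dett (slope G e) (\<phi> (src G e)) = dett (slope G e) (\<phi> (tgt G e))"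
  shows "loopv k \<phi> = loop_weight k (flow \<phi>)"
  unfolding loop_value_eq[OF k \<phi>] loop_weight_def
proof (rule prod.cong[OF refl], clarify)
  fix t e s assume "(t, e, s) \<in> cross k"
  then have e: "e \<in> edges G" by (rule crossing_edge)
  have t: "\<phi> (tgt G e) \<in> torus" using \<phi> e by (simp add: Psi_dom_torus tgt_in)
  show "(if csign k t e = 1 then dett (slope G e) (\<phi> (src G e)) else dett (- slope G e) (\<phi> (tgt G e)))
     = flow \<phi> e powi csign k t e"
    using e eq[OF e] dett_uminus[OF t, of "slope G e"] by (simp add: flow_def crossing_sign_def)
qed

text \<open>For a fixed flow the conditions on \<open>\<phi>\<close> decouple; this is the set of
  admissible values at the single vertex \<open>v\<close>.\<close>

definition solutions :: "('e \<Rightarrow> complex) \<Rightarrow> 'v \<Rightarrow> (complex \<times> complex) set" where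
  "solutions \<mu> v = (if v \<in> Q then {(1, 1)} else {z \<in> torus. \<forall>f\<in>flags G v. dett (flag_slope G f) z = flag_value \<mu> f})"

lemma Phi_flow:
  assumes "\<phi> \<in> Phi"
  shows "flow \<phi> \<in> Flows" "\<phi> \<in> (\<Pi>\<^sub>E v\<in>verts G. solutions (flow \<phi>) v)"
proof -
  have \<phi>: "\<phi> \<in> carrier Dom" and one: "\<And>v. v \<in> Q \<Longrightarrow> \<phi> v = (1, 1)"
    and eq: "\<And>e. e \<in> edges G \<Longrightarrow> dett (slope G e) (\<phi> (src G e)) = dett (slope G e) (\<phi> (tgt G e))"
    and lv: "\<And>k. k < 2 \<Longrightarrow> loopv k \<phi> = 1"
    using assms by (auto simp: Phi_def)
  note tor = Psi_dom_torus[OF \<phi>]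
  have fv: "dett (flag_slope G f) (\<phi> v) = flag_value (flow \<phi>) f" if f: "f \<in> flags G v" and v: "v \<in> verts G" for f v
    using f eq tor[OF v] unfolding flag_slope_eq flag_value_def flow_def
    by (auto simp: flags_def dett_uminus)
  have "(\<Prod>f\<in>flags G v. flag_value (flow \<phi>) f) = 1" if v: "v \<in> verts G - Q" for v
  proof -
    have "(\<Prod>f\<in>flags G v. flag_value (flow \<phi>) f) = (\<Prod>f\<in>flags G v. dett (flag_slope G f) (\<phi> v))"
      using fv v by (intro prod.cong) auto
    \<comment> \<open>Conservation of the flow is balancing seen through the character: a product of
      determinants with the slopes is the determinant with their sum.\<close>
    also have "\<dots> = dett (\<Sum>f\<in>flags G v. flag_slope G f) (\<phi> v)"
      by (rule dett_sum[symmetric]) (use tor v in simp)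
    also have "\<dots> = 1" using balanced[OF v] dett_0[OF tor] v by simp
    finally show ?thesis .
  qed
  moreover have "flow \<phi> e = 1" if "e \<in> edges G" "src G e \<in> Q \<or> tgt G e \<in> Q" for e
    using that one eq[OF that(1)] by (auto simp: flow_def dett_one)
  moreover have "flow \<phi> \<in> edges G \<rightarrow>\<^sub>E {x. x \<noteq> 0}"
    using tor src_in by (auto simp: flow_def dett_nonzero)
  moreover have "loop_weight k (flow \<phi>) = 1" if "k < 2" for k
    using loop_value_flow[OF that \<phi> eq] lv[OF that] by simp
  ultimately show "flow \<phi> \<in> Flows" by (simp add: Flows_def)
  show "\<phi> \<in> (\<Pi>\<^sub>E v\<in>verts G. solutions (flow \<phi>) v)"
    using \<phi> one fv unfolding carrier_Psi_dom by (auto simp: solutions_def PiE_iff)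
qed

text \<open>Independent local choices always fit together: each end of an edge reads off the
  prescribed value of the flow, which is 1 at a marked end.\<close>

lemma solutions_Phi:
  assumes \<mu>: "\<mu> \<in> Flows" and s: "\<phi> \<in> (\<Pi>\<^sub>E v\<in>verts G. solutions \<mu> v)"
  shows "\<phi> \<in> Phi" "flow \<phi> = \<mu>"
proof -
  have sol: "\<phi> v \<in> solutions \<mu> v" if "v \<in> verts G" for v using s that by auto
  have t1: "(1, 1) \<in> torus" by (simp add: torus_def)
  have tor: "\<phi> v \<in> torus" if "v \<in> verts G" for v
    using sol[OF that] t1 by (auto simp: solutions_def split: if_splits)
  have \<phi>: "\<phi> \<in> carrier Dom"
    unfolding carrier_Psi_dom using s tor by (auto simp: PiE_iff)
  have one: "\<phi> v = (1, 1)" if "v \<in> Q" for v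
    using sol[of v] that marked_in by (auto simp: solutions_def)
  have src: "dett (slope G e) (\<phi> (src G e)) = \<mu> e" if e: "e \<in> edges G" for e
  proof (cases "src G e \<in> Q")
    case True
    then show ?thesis using one e \<mu> by (auto simp: Flows_def dett_one)
  next
    case False
    have "(e, True) \<in> flags G (src G e)" using e by (auto simp: flags_def)
    then show ?thesis using sol[OF src_in[OF e]] False
      by (auto simp: solutions_def flag_slope_eq flag_value_def)
  qed
  have tgt: "dett (slope G e) (\<phi> (tgt G e)) = \<mu> e" if e: "e \<in> edges G" for e
  proof (cases "tgt G e \<in> Q")
    case True
    then show ?thesis using one e \<mu> by (auto simp: Flows_def dett_one)
  next
    case False
    have "(e, False) \<in> flags G (tgt G e)" using e by (auto simp: flags_def)
    then have "dett (- slope G e) (\<phi> (tgt G e)) = inverse (\<mu> e)" using sol[OF tgt_in[OF e]] False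
      by (auto simp: solutions_def flag_slope_eq flag_value_def)
    then show ?thesis using dett_uminus[OF tor[OF tgt_in[OF e]]] by simp
  qed
  show fl: "flow \<phi> = \<mu>"
  proof (rule ext)
    fix e show "flow \<phi> e = \<mu> e"
      using src \<mu> by (cases "e \<in> edges G") (auto simp: flow_def Flows_def PiE_iff extensional_def)
  qed
  have "loopv k \<phi> = 1" if "k < 2" for k
    using loop_value_flow[OF that \<phi>] src tgt fl that \<mu> by (simp add: Flows_def)
  then show "\<phi> \<in> Phi" using \<phi> one src tgt by (simp add: Phi_def)
qed

text \<open>Over each flow lies a product of local solution sets, and its cardinality is the same
  for all flows.\<close>

lemma card_Phi:
  assumes "finite Flows"
  shows "finite Phi" "card Phi = card Flows * (\<Prod>v\<in>verts G - Q. vertex_mult G v)"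
proof -
  have bij: "bij_betw (\<lambda>\<phi>. (flow \<phi>, \<phi>)) Phi (SIGMA \<mu>:Flows. \<Pi>\<^sub>E v\<in>verts G. solutions \<mu> v)"
    unfolding bij_betw_def
  proof
    show "(\<lambda>\<phi>. (flow \<phi>, \<phi>)) ` Phi = (SIGMA \<mu>:Flows. \<Pi>\<^sub>E v\<in>verts G. solutions \<mu> v)"
    proof (intro equalityI subsetI)
      fix x assume "x \<in> (SIGMA \<mu>:Flows. \<Pi>\<^sub>E v\<in>verts G. solutions \<mu> v)"
      then obtain \<mu> \<phi> where x: "x = (\<mu>, \<phi>)" "\<mu> \<in> Flows" "\<phi> \<in> (\<Pi>\<^sub>E v\<in>verts G. solutions \<mu> v)"
        by (cases x) blast
      then show "x \<in> (\<lambda>\<phi>. (flow \<phi>, \<phi>)) ` Phi"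
        using solutions_Phi[OF x(2,3)] by (intro image_eqI[of _ _ \<phi>]) auto
    qed (use Phi_flow in auto)
  qed (simp add: inj_on_def)
  have cs: "card (solutions \<mu> v) = (if v \<in> Q then 1 else vertex_mult G v)" "finite (solutions \<mu> v)"
    if \<mu>: "\<mu> \<in> Flows" and v: "v \<in> verts G" for \<mu> v
  proof -
    have nz: "flag_value \<mu> f \<noteq> 0" if "f \<in> flags G v" for f
      using \<mu> flag_edge[OF that] by (auto simp: Flows_def flag_value_def)
    show 1: "card (solutions \<mu> v) = (if v \<in> Q then 1 else vertex_mult G v)"
      using card_vertex_solutions[of v "flag_value \<mu>"] v \<mu> nz by (auto simp: solutions_def Flows_def)
    have "card (solutions \<mu> v) > 0"
      unfolding 1 using card_vertex_solutions(2)[of v "flag_value \<mu>"] v \<mu> nz by (auto simp: Flows_def)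
    then show "finite (solutions \<mu> v)" by (rule card_ge_0_finite)
  qed
  have cP: "card (\<Pi>\<^sub>E v\<in>verts G. solutions \<mu> v) = (\<Prod>v\<in>verts G - Q. vertex_mult G v)" if \<mu>: "\<mu> \<in> Flows" for \<mu>
  proof -
    have "card (\<Pi>\<^sub>E v\<in>verts G. solutions \<mu> v) = (\<Prod>v\<in>verts G. if v \<in> Q then 1 else vertex_mult G v)"
      using cs[OF \<mu>] by (simp add: card_PiE[OF finite_verts])
    also have "\<dots> = (\<Prod>v\<in>verts G - Q. if v \<in> Q then 1 else vertex_mult G v)"
      using finite_verts by (intro prod.mono_neutral_right) auto
    also have "\<dots> = (\<Prod>v\<in>verts G - Q. vertex_mult G v)" by (rule prod.cong) auto
    finally show ?thesis .
  qed
  have fin: "finite (\<Pi>\<^sub>E v\<in>verts G. solutions \<mu> v)" if "\<mu> \<in> Flows" for \<mu>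
    using cs[OF that] finite_verts by (intro finite_PiE)
  show "finite Phi" using bij_betw_finite[OF bij] fin assms by blast
  have "card Phi = card (SIGMA \<mu>:Flows. \<Pi>\<^sub>E v\<in>verts G. solutions \<mu> v)"
    by (rule bij_betw_same_card[OF bij])
  also have "\<dots> = card Flows * (\<Prod>v\<in>verts G - Q. vertex_mult G v)"
    using assms fin cP by (simp add: card_SigmaI)
  finally show "card Phi = card Flows * (\<Prod>v\<in>verts G - Q. vertex_mult G v)" .
qed

end

section \<open>Fundamental cycles and the index of their classes\<close>

lemma powi_two_inject:
  assumes "(2::complex) powi m = 2 powi n"
  shows "m = n"
proof -
  have "cmod (2 powi m) = cmod (2 powi n)" using assms by simp
  then have "(2::real) powi m = 2 powi n" by (simp add: norm_power_int)
  then have "(2::real) powr of_int m = 2 powr of_int n" by (simp add: powr_real_of_int')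
  then show ?thesis by (simp add: powr_inj)
qed

context marked_curve
begin

definition inner_edges :: "'e set" where
  "inner_edges = {e \<in> edges G. src G e \<notin> Q \<and> tgt G e \<notin> Q}"

abbreviation "inc \<equiv> incidence_number (src G) (tgt G)"

lemma finite_inner: "finite inner_edges"
  using finite_edges by (simp add: inner_edges_def)

lemma sum_inc:
  assumes "\<And>e. e \<in> edges G \<Longrightarrow> e \<notin> inner_edges \<Longrightarrow> y e = 0"
  shows "(\<Sum>e\<in>inner_edges. inc v e * y e) =
      (\<Sum>e | e \<in> edges G \<and> tgt G e = v. y e) - (\<Sum>e | e \<in> edges G \<and> src G e = v. y e)"
proof -
  have *: "(\<Sum>e\<in>edges G. of_bool (p e) * y e) = (\<Sum>e | e \<in> edges G \<and> p e. y e)" for p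
  proof -
    have "(\<Sum>e\<in>edges G. of_bool (p e) * y e) = (\<Sum>e\<in>edges G. if p e then y e else 0)"
      by (rule sum.cong) auto
    then show ?thesis using finite_edges by (simp add: sum.inter_filter)
  qed
  have "(\<Sum>e\<in>inner_edges. inc v e * y e) = (\<Sum>e\<in>edges G. inc v e * y e)"
    using assms finite_edges by (intro sum.mono_neutral_left) (auto simp: inner_edges_def)
  also have "\<dots> = (\<Sum>e\<in>edges G. of_bool (tgt G e = v) * y e) - (\<Sum>e\<in>edges G. of_bool (src G e = v) * y e)"
    by (simp add: incidence_number_def left_diff_distrib sum_subtractf)
  finally show ?thesis unfolding * .
qed

text \<open>Flags point away from the vertex while incidence numbers count arriving edges
  positively, hence the inverse.\<close>

lemma prod_inc:
  fixes \<mu> :: "'e \<Rightarrow> complex"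
  assumes "\<And>e. e \<in> edges G \<Longrightarrow> e \<notin> inner_edges \<Longrightarrow> \<mu> e = 1" "\<And>e. e \<in> edges G \<Longrightarrow> \<mu> e \<noteq> 0"
  shows "(\<Prod>e\<in>inner_edges. \<mu> e powi inc v e) = inverse (\<Prod>f\<in>flags G v. flag_value \<mu> f)"
proof -
  have "(\<Prod>e\<in>inner_edges. \<mu> e powi inc v e) = (\<Prod>e\<in>edges G. \<mu> e powi inc v e)"
    using assms finite_edges by (intro prod.mono_neutral_left) (auto simp: inner_edges_def)
  also have "\<dots> = (\<Prod>e\<in>edges G. (if tgt G e = v then \<mu> e else 1) * (if src G e = v then inverse (\<mu> e) else 1))"
    using assms(2) by (intro prod.cong) (auto simp: incidence_number_def power_int_minus)
  also have "\<dots> = (\<Prod>e\<in>edges G. if tgt G e = v then \<mu> e else 1) * (\<Prod>e\<in>edges G. if src G e = v then inverse (\<mu> e) else 1)"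
    by (rule prod.distrib)
  also have "\<dots> = (\<Prod>e\<in>{e \<in> edges G. tgt G e = v}. \<mu> e) * (\<Prod>e\<in>{e \<in> edges G. src G e = v}. inverse (\<mu> e))"
    using finite_edges by (simp add: prod.inter_filter)
  also have "\<dots> = inverse (\<Prod>f\<in>flags G v. flag_value \<mu> f)"
  proof -
    have "(\<Prod>e\<in>A. inverse (\<mu> e)) = inverse (prod \<mu> A)" for A
      using prod_inversef[of \<mu> A] by (simp add: o_def)
    then show ?thesis unfolding prod.flags_split[OF finite_edges] by (simp add: flag_value_def)
  qed
  finally show ?thesis .
qed

lemma H1_off_iff:
  "y \<in> H1_off G Q \<longleftrightarrow> (\<forall>e. y e \<noteq> 0 \<longrightarrow> e \<in> inner_edges) \<and> (\<forall>v\<in>verts G. (\<Sum>e\<in>inner_edges. inc v e * y e) = 0)"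
proof -
  have "(\<forall>v\<in>verts G. (\<Sum>e\<in>inner_edges. inc v e * y e) = 0) \<longleftrightarrow> (\<forall>v\<in>verts G.
      (\<Sum>e | e \<in> edges G \<and> tgt G e = v. y e) = (\<Sum>e | e \<in> edges G \<and> src G e = v. y e))"
    if y: "\<forall>e. y e \<noteq> 0 \<longrightarrow> e \<in> inner_edges"
  proof -
    have "(\<Sum>e\<in>inner_edges. inc v e * y e) =
      (\<Sum>e | e \<in> edges G \<and> tgt G e = v. y e) - (\<Sum>e | e \<in> edges G \<and> src G e = v. y e)" for v
      by (rule sum_inc) (use y in auto)
    then show ?thesis by simp
  qed
  then show ?thesis by (auto simp: H1_off_def inner_edges_def)
qed

lemma H1_off_cycle: "y \<in> H1_off G Q \<Longrightarrow> integral_cycle G y"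
  by (auto simp: H1_off_def integral_cycle_def)

lemma hclass_combination:
  "hclass G (\<lambda>e. \<Sum>i\<in>A. c i * y i e) = (\<Sum>i\<in>A. of_int (c i) *\<^sub>R hclass G (y i))"
  unfolding hclass_def scaleR_sum_right
  by (subst sum.swap) (simp add: scaleR_sum_left)

lemma H1_off_combination:
  assumes "\<And>i. i \<in> A \<Longrightarrow> y i \<in> H1_off G Q"
  shows "(\<lambda>e. \<Sum>i\<in>A. c i * y i e) \<in> H1_off G Q"
proof -
  have "e \<in> inner_edges" if "(\<Sum>i\<in>A. c i * y i e) \<noteq> 0" for e
  proof -
    from that obtain i where "i \<in> A" "c i * y i e \<noteq> 0" using sum.not_neutral_contains_not_neutral by blast
    then show ?thesis using assms[of i] by (auto simp: H1_off_iff)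
  qed
  moreover have "(\<Sum>e\<in>inner_edges. inc v e * (\<Sum>i\<in>A. c i * y i e)) = 0" if "v \<in> verts G" for v
  proof -
    have "(\<Sum>e\<in>inner_edges. inc v e * (\<Sum>i\<in>A. c i * y i e)) = (\<Sum>i\<in>A. c i * (\<Sum>e\<in>inner_edges. inc v e * y i e))"
      unfolding sum_distrib_left by (subst sum.swap) (simp add: mult_ac)
    also have "\<dots> = 0" using assms that by (simp add: H1_off_iff)
    finally show ?thesis .
  qed
  ultimately show ?thesis unfolding H1_off_iff by blast
qed

definition crossing_sum :: "nat \<Rightarrow> ('e \<Rightarrow> int) \<Rightarrow> int" where
  "crossing_sum k y = (\<Sum>(t, e, s)\<in>cross k. y e * csign k t e)"

text \<open>The coordinates of the class of \<open>y\<close> in the basis of \<Lambda>. Written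
  through crossing numbers they are integers by construction; Cramer's rule and the orientation of
  the basis give the signs.\<close>

definition class_coord :: "('e \<Rightarrow> int) \<Rightarrow> int \<times> int" where
  "class_coord y = (let s = if det2 (b 0) (b 1) > 0 then 1 else -1 in (- s * crossing_sum 1 y, s * crossing_sum 0 y))"

lemma lattice_coord_hclass:
  assumes "y \<in> H1_off G Q"
  shows "lattice_coord b (hclass G y) = rvec (class_coord y)"
proof -
  let ?h = "hclass G y" and ?D = "det2 (b 0) (b 1)"
  have cs: "of_int (crossing_sum k y) = det2 (b k) ?h / \<bar>?D\<bar>" if "k < 2" for k
    using crossing_number_basis(2)[OF that H1_off_cycle[OF assms]] by (simp add: crossing_sum_def)
  have "det2 ?h (b 1) = - det2 (b 1) ?h" by (simp add: det2_def)
  then show ?thesis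
    using cs[of 0] cs[of 1] by (auto simp: lattice_coord_def rvec_def class_coord_def Let_def)
qed

lemma det2_class_coord:
  "\<bar>det2 (class_coord y) (class_coord y')\<bar> = \<bar>crossing_sum 0 y * crossing_sum 1 y' - crossing_sum 1 y * crossing_sum 0 y'\<bar>"
  by (simp add: det2_def class_coord_def Let_def abs_minus_commute algebra_simps)

text \<open>The family from \<open>fundamental_flows\<close> has exactly two members: at least two
  since the cycles have rank 2, and at most two since they embed in \<Lambda>, where any three
  classes are dependent.\<close>

lemma fundamental_cycles:
  obtains f1 f2 and z1 z2 :: "'e \<Rightarrow> int" where
    "f1 \<in> inner_edges" "f2 \<in> inner_edges" "f1 \<noteq> f2" "z1 \<in> H1_off G Q" "z2 \<in> H1_off G Q"
    "z1 f1 = 1" "z1 f2 = 0" "z2 f1 = 0" "z2 f2 = 1"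
    "det2 (class_coord z1) (class_coord z2) \<noteq> 0"
    "\<forall>\<mu> :: 'e \<Rightarrow> complex. (\<forall>e\<in>inner_edges. \<mu> e \<noteq> 0) \<and>
       (\<forall>v\<in>verts G. (\<Prod>e\<in>inner_edges. \<mu> e powi inc v e) = 1) \<longrightarrow>
       (\<forall>e\<in>inner_edges. \<mu> e = \<mu> f1 powi z1 e * \<mu> f2 powi z2 e)"
    "\<forall>y\<in>H1_off G Q. y = (\<lambda>e. y f1 * z1 e + y f2 * z2 e)"
proof -
  obtain F and z :: "'e \<Rightarrow> 'e \<Rightarrow> int" where F: "F \<subseteq> inner_edges"
    and unit: "\<forall>f\<in>F. \<forall>f'\<in>F. z f f' = of_bool (f = f')"
    and cons: "\<forall>f\<in>F. \<forall>v\<in>verts G. (\<Sum>e\<in>inner_edges. inc v e * z f e) = 0"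
    and gen: "\<forall>\<mu> :: 'e \<Rightarrow> complex. (\<forall>e\<in>inner_edges. \<mu> e \<noteq> 0) \<and>
        (\<forall>v\<in>verts G. (\<Prod>e\<in>inner_edges. \<mu> e powi inc v e) = 1) \<longrightarrow>
        (\<forall>e\<in>inner_edges. \<mu> e = (\<Prod>f\<in>F. \<mu> f powi z f e))"
    using fundamental_flows[OF finite_inner, of "verts G" "src G" "tgt G"] by (elim exE conjE) (rule that)
  \<comment> \<open>The flows are controlled only on the inner edges; cycles of the complement of
    \<open>Q\<close> must vanish elsewhere.\<close>
  define z0 where "z0 f e = (if e \<in> inner_edges then z f e else 0)" for f e
  have finF: "finite F" using F finite_inner by (rule finite_subset)
  have z0_eq: "z0 f e = z f e" if "e \<in> inner_edges" for f e using that by (simp add: z0_def)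
  have z0: "z0 f \<in> H1_off G Q" if "f \<in> F" for f
  proof -
    have "(\<Sum>e\<in>inner_edges. inc v e * z0 f e) = (\<Sum>e\<in>inner_edges. inc v e * z f e)" for v
      by (rule sum.cong) (auto simp: z0_def)
    then show ?thesis using cons that by (auto simp: H1_off_iff z0_def split: if_splits)
  qed
  have z0_unit: "z0 f f' = of_bool (f = f')" if "f \<in> F" "f' \<in> F" for f f'
    using that unit F by (auto simp: z0_def)
  have span: "y e = (\<Sum>f\<in>F. y f * z0 f e)" if y: "y \<in> H1_off G Q" for y e
  proof (cases "e \<in> inner_edges")
    case True
    \<comment> \<open>As 2 has infinite order, powers of 2 embed the integral cycles into the flows,
      so the generation property for complex flows also yields integral generation.\<close>
    let ?\<mu> = "\<lambda>e. (2::complex) powi y e"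
    have "(\<Prod>e\<in>inner_edges. ?\<mu> e powi inc v e) = 1" if v: "v \<in> verts G" for v
    proof -
      have "(\<Prod>e\<in>inner_edges. ?\<mu> e powi inc v e) = 2 powi (\<Sum>e\<in>inner_edges. inc v e * y e)"
        by (simp add: powi_sum power_int_mult[symmetric] mult.commute)
      then show ?thesis using y v by (simp add: H1_off_iff)
    qed
    then have "?\<mu> e = (\<Prod>f\<in>F. ?\<mu> f powi z f e)" using gen True by auto
    also have "\<dots> = 2 powi (\<Sum>f\<in>F. y f * z f e)"
      by (simp add: powi_sum power_int_mult[symmetric])
    finally have "y e = (\<Sum>f\<in>F. y f * z f e)" by (rule powi_two_inject)
    then show ?thesis using True by (simp add: z0_eq)
  next
    case False
    then have "y e = 0" using y by (auto simp: H1_off_iff)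
    then show ?thesis using False by (simp add: z0_def)
  qed
  have indep: "c f = 0" if c: "(\<Sum>f\<in>F. smul (c f) (class_coord (z0 f))) = 0" and f: "f \<in> F" for c f
  proof -
    let ?y = "\<lambda>e. \<Sum>f\<in>F. c f * z0 f e"
    have y: "?y \<in> H1_off G Q" by (rule H1_off_combination) (rule z0)
    have "lattice_coord b (hclass G ?y) = (\<Sum>f\<in>F. of_int (c f) *\<^sub>R rvec (class_coord (z0 f)))"
      unfolding hclass_combination lattice_coord_sum lattice_coord_scaleR
      by (rule sum.cong) (simp_all add: lattice_coord_hclass z0)
    also have "\<dots> = rvec (\<Sum>f\<in>F. smul (c f) (class_coord (z0 f)))"
      by (simp add: rvec_def smul_def prod_eq_iff fst_sum snd_sum)
    finally have "lattice_coord b (hclass G ?y) = 0" unfolding c by (simp add: rvec_def zero_prod_def)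
    then have "hclass G ?y = hclass G (\<lambda>e. 0)"
      using lattice_coord_eq[where b = b, OF det_basis, of "hclass G ?y"] by (simp add: hclass_def)
    moreover have "(\<lambda>e. 0) \<in> H1_off G Q" by (simp add: H1_off_def)
    ultimately have "?y = (\<lambda>e. 0)" using inj_hclass y by (auto dest: inj_onD)
    \<comment> \<open>Evaluation on the edge \<open>f\<close> isolates the coefficient
      \<open>c f\<close>, because the cycles are unit vectors on \<open>F\<close>.\<close>
    then have "(\<Sum>f'\<in>F. c f' * z0 f' f) = 0" by meson
    moreover have "(\<Sum>f'\<in>F. c f' * z0 f' f) = (\<Sum>f'\<in>F. if f' = f then c f' else 0)"
      by (rule sum.cong) (use z0_unit f in auto)
    ultimately show "c f = 0" using finF f by simp
  qed
  have indep2: "det2 (class_coord (z0 f)) (class_coord (z0 f')) \<noteq> 0" if f: "f \<in> F" "f' \<in> F" "f \<noteq> f'" for f f'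
  proof
    let ?u = "class_coord (z0 f)" and ?v = "class_coord (z0 f')"
    assume D: "det2 ?u ?v = 0"
    have two: "p = 0 \<and> q = 0" if pq: "smul p ?u + smul q ?v = 0" for p q
    proof -
      define c where "c g = (if g = f then p else if g = f' then q else 0)" for g
      have "(\<Sum>g\<in>F. smul (c g) (class_coord (z0 g))) = (\<Sum>g\<in>{f, f'}. smul (c g) (class_coord (z0 g)))"
        using finF f by (intro sum.mono_neutral_right) (auto simp: c_def smul_def zero_prod_def)
      also have "\<dots> = 0" using f pq by (simp add: c_def)
      finally have "c f = 0" "c f' = 0" using indep f by blast+
      then show ?thesis using f by (auto simp: c_def)
    qed
    have "fst ?u * snd ?v = snd ?u * fst ?v" using D by (simp add: det2_def)
    then have "smul (fst ?v) ?u + smul (- fst ?u) ?v = 0" "smul (snd ?v) ?u + smul (- snd ?u) ?v = 0"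
      by (simp_all add: smul_def prod_eq_iff algebra_simps)
    then have "?u = 0" using two[of "fst ?v" "- fst ?u"] two[of "snd ?v" "- snd ?u"]
      by (simp add: prod_eq_iff)
    then have "smul 1 ?u + smul 0 ?v = 0" by (simp add: smul_def zero_prod_def)
    then show False using two[of 1 0] by simp
  qed
  have "\<not> F \<subseteq> {f}" for f
  proof
    assume sub: "F \<subseteq> {f}"
    \<comment> \<open>All cycles would be multiples of this one; the default value 0 covers an empty
      \<open>F\<close>.\<close>
    define Z where "Z e = (if f \<in> F then z0 f e else 0)" for e
    have yZ: "y e = y f * Z e" if "y \<in> H1_off G Q" for y e
      using span[OF that, of e] sub by (cases "f \<in> F") (auto simp: Z_def subset_singleton_iff)
    let ?A = "{a :: nat \<Rightarrow> int. \<forall>i\<ge>2. a i = 0}"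
    obtain c :: "nat \<Rightarrow> 'e \<Rightarrow> int" where c: "bij_betw (\<lambda>a e. \<Sum>i<2. a i * c i e) ?A (H1_off G Q)"
      using rank2 unfolding free_of_rank_def by (elim exE) (rule that)
    let ?m = "\<lambda>a e. \<Sum>i<2. a i * c i e"
    define a where "a p q = (\<lambda>i::nat. if i = 0 then p else if i = 1 then q else (0::int))" for p q
    have aA: "a p q \<in> ?A" for p q by (auto simp: a_def)
    have m: "?m (a p q) = (\<lambda>e. p * c 0 e + q * c 1 e)" for p q
      by (simp add: a_def numeral_2_eq_2)
    have inj: "p = p' \<and> q = q'" if "?m (a p q) = ?m (a p' q')" for p q p' q'
    proof -
      have "a p q = a p' q'" using c aA that by (auto simp: bij_betw_def dest: inj_onD)
      then have "a p q 0 = a p' q' 0" "a p q 1 = a p' q' 1" by simp_all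
      then show ?thesis by (simp add: a_def)
    qed
    have mem: "?m (a p q) \<in> H1_off G Q" for p q using c aA by (auto simp: bij_betw_def)
    have c0: "c 0 \<in> H1_off G Q" and c1: "c 1 \<in> H1_off G Q"
      using mem[of 1 0] mem[of 0 1] unfolding m by simp_all
    \<comment> \<open>Two multiples of one cycle satisfy this relation. Uniqueness of coordinates
      forces \<open>c 0 f = 0\<close>, hence \<open>c 0\<close> vanishes, contradicting uniqueness
      once more.\<close>
    have "c 1 f * c 0 e + (- c 0 f) * c 1 e = 0" for e
      unfolding yZ[OF c0, of e] yZ[OF c1, of e] by simp
    then have "?m (a (c 1 f) (- c 0 f)) = ?m (a 0 0)" unfolding m by simp
    from inj[OF this] have "c 0 f = 0" by simp
    then have "c 0 e = 0" for e using yZ[OF c0, of e] by simp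
    then have "?m (a 1 0) = ?m (a 0 0)" unfolding m by simp
    from inj[OF this] show False by simp
  qed
  then obtain f1 f2 where f12: "f1 \<in> F" "f2 \<in> F" "f1 \<noteq> f2" by blast
  have "F = {f1, f2}"
  proof (rule ccontr)
    assume "F \<noteq> {f1, f2}"
    then obtain f3 where f3: "f3 \<in> F" "f3 \<noteq> f1" "f3 \<noteq> f2" using f12 by blast
    let ?u = "\<lambda>f. class_coord (z0 f)"
    \<comment> \<open>The Cramer relation between three vectors of the plane.\<close>
    define c where "c g = (if g = f1 then det2 (?u f2) (?u f3) else if g = f2 then det2 (?u f3) (?u f1)
        else if g = f3 then det2 (?u f1) (?u f2) else 0)" for g
    have "(\<Sum>g\<in>F. smul (c g) (?u g)) = (\<Sum>g\<in>{f1, f2, f3}. smul (c g) (?u g))"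
      using finF f12 f3 by (intro sum.mono_neutral_right) (auto simp: c_def smul_def zero_prod_def)
    also have "\<dots> = 0" using f12 f3 by (simp add: c_def smul_def det2_def prod_eq_iff algebra_simps)
    finally have "c f3 = 0" using indep f3 by blast
    then show False using indep2[OF f12] f12 f3 by (simp add: c_def)
  qed
  note F2 = this
  show ?thesis
  proof (rule that[of f1 f2 "z0 f1" "z0 f2"])
    show "det2 (class_coord (z0 f1)) (class_coord (z0 f2)) \<noteq> 0" using indep2[OF f12] .
    show "\<forall>\<mu> :: 'e \<Rightarrow> complex. (\<forall>e\<in>inner_edges. \<mu> e \<noteq> 0) \<and>
       (\<forall>v\<in>verts G. (\<Prod>e\<in>inner_edges. \<mu> e powi inc v e) = 1) \<longrightarrow>
       (\<forall>e\<in>inner_edges. \<mu> e = \<mu> f1 powi z0 f1 e * \<mu> f2 powi z0 f2 e)"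
      using gen f12(3) z0_eq unfolding F2 by simp
    show "\<forall>y\<in>H1_off G Q. y = (\<lambda>e. y f1 * z0 f1 e + y f2 * z0 f2 e)"
    proof (intro ballI ext)
      fix y e assume y: "y \<in> H1_off G Q"
      show "y e = y f1 * z0 f1 e + y f2 * z0 f2 e"
        using span[OF y, of e] f12 unfolding F2 by simp
    qed
  qed (use f12 F z0 z0_unit in auto)
qed

end

lemma prod_powi_powi:
  fixes x :: complex
  assumes "x \<noteq> 0"
  shows "(\<Prod>i\<in>A. (x powi f i) powi g i) = x powi (\<Sum>i\<in>A. f i * g i)"
  using assms by (simp add: powi_sum power_int_mult[symmetric])

context marked_curve
begin

text \<open>A flow is determined by its values on the two fundamental edges, where the loop
  conditions become two monomial equations. Their matrix consists of the crossing numbers of the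
  loops with the fundamental cycles, so its determinant is, up to sign, that of the classes in
  \<Lambda>, which is also the index.\<close>

lemma card_Flows:
  shows "finite Flows" "card Flows = subgroup_index \<Lambda> (hclass G ` H1_off G Q)"
proof -
  obtain f1 f2 and z1 z2 :: "'e \<Rightarrow> int" where
    f: "f1 \<in> inner_edges" "f2 \<in> inner_edges" "f1 \<noteq> f2" and z: "z1 \<in> H1_off G Q" "z2 \<in> H1_off G Q"
    and unit: "z1 f1 = 1" "z1 f2 = 0" "z2 f1 = 0" "z2 f2 = 1"
    and D: "det2 (class_coord z1) (class_coord z2) \<noteq> 0"
    and gen: "\<forall>\<mu> :: 'e \<Rightarrow> complex. (\<forall>e\<in>inner_edges. \<mu> e \<noteq> 0) \<and>
       (\<forall>v\<in>verts G. (\<Prod>e\<in>inner_edges. \<mu> e powi inc v e) = 1) \<longrightarrow>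
       (\<forall>e\<in>inner_edges. \<mu> e = \<mu> f1 powi z1 e * \<mu> f2 powi z2 e)"
    and span: "\<forall>y\<in>H1_off G Q. y = (\<lambda>e. y f1 * z1 e + y f2 * z2 e)"
    by (rule fundamental_cycles)
  \<comment> \<open>Swapped and with a sign, because \<open>dett v z\<close> raises
    \<open>snd z\<close> to \<open>fst v\<close> and \<open>fst z\<close> to
    \<open>- snd v\<close>.\<close>
  let ?u = "\<lambda>k. (crossing_sum k z2, - crossing_sum k z1)"
  let ?S = "{\<zeta> \<in> torus. dett (?u 0) \<zeta> = 1 \<and> dett (?u 1) \<zeta> = 1}"
  have Du: "\<bar>det2 (?u 0) (?u 1)\<bar> = \<bar>det2 (class_coord z1) (class_coord z2)\<bar>"
    unfolding det2_class_coord by (simp add: det2_def algebra_simps)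
  then have "det2 (?u 0) (?u 1) \<noteq> 0" using D by auto
  from card_dett_system[OF this, of 1 1] Du
  have cS: "card ?S = nat \<bar>det2 (class_coord z1) (class_coord z2)\<bar>" by simp
  have finS: "finite ?S" by (rule card_ge_0_finite) (use cS D in simp)
  have fe: "f1 \<in> edges G" "f2 \<in> edges G" using f by (auto simp: inner_edges_def)
  have z_outer: "z1 e = 0" "z2 e = 0" if "e \<notin> inner_edges" for e
    using z that by (auto simp: H1_off_iff)
  have lw: "loop_weight k \<mu> = dett (?u k) (\<mu> f1, \<mu> f2)"
    if nz: "\<mu> f1 \<noteq> 0" "\<mu> f2 \<noteq> 0" and \<mu>: "\<And>e. e \<in> edges G \<Longrightarrow> \<mu> e = \<mu> f1 powi z1 e * \<mu> f2 powi z2 e" for \<mu> k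
  proof -
    have t: "(\<mu> f1, \<mu> f2) \<in> torus" using nz by (simp add: torus_def)
    have "loop_weight k \<mu> = (\<Prod>x\<in>cross k. case x of (t, e, s) \<Rightarrow>
        (\<mu> f1 powi z1 e) powi csign k t e * (\<mu> f2 powi z2 e) powi csign k t e)"
      unfolding loop_weight_def
    proof (rule prod.cong[OF refl], clarify)
      fix t e s assume "(t, e, s) \<in> cross k"
      then have e: "e \<in> edges G" by (rule crossing_edge)
      show "\<mu> e powi csign k t e =
        (\<mu> f1 powi z1 e) powi csign k t e * (\<mu> f2 powi z2 e) powi csign k t e"
        by (subst \<mu>[OF e]) (rule power_int_mult_distrib)
    qed
    also have "\<dots> = \<mu> f1 powi crossing_sum k z1 * \<mu> f2 powi crossing_sum k z2"
      unfolding crossing_sum_def case_prod_beta prod.distrib using nz by (simp add: prod_powi_powi)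
    finally show ?thesis by (simp add: dett_eq[OF t] mult.commute)
  qed
  have cons: "(\<Prod>e\<in>inner_edges. \<mu> e powi inc v e) = 1"
    if \<mu>: "\<mu> \<in> Flows" and v: "v \<in> verts G" for \<mu> v
  proof (cases "v \<in> Q")
    case True
    \<comment> \<open>No inner edge meets a marked vertex, so conservation is empty there.\<close>
    then have "inc v e = 0" if "e \<in> inner_edges" for e
      using that by (auto simp: inner_edges_def incidence_number_def)
    then show ?thesis by simp
  next
    case False
    have "(\<Prod>e\<in>inner_edges. \<mu> e powi inc v e) = inverse (\<Prod>f\<in>flags G v. flag_value \<mu> f)"
      by (rule prod_inc) (use \<mu> in \<open>auto simp: Flows_def inner_edges_def\<close>)
    then show ?thesis using \<mu> v False by (simp add: Flows_def)
  qed
  have gen': "\<mu> e = \<mu> f1 powi z1 e * \<mu> f2 powi z2 e" if \<mu>: "\<mu> \<in> Flows" and e: "e \<in> edges G" for \<mu> e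
  proof (cases "e \<in> inner_edges")
    case True
    have "\<forall>e\<in>inner_edges. \<mu> e \<noteq> 0" using \<mu> by (auto simp: Flows_def inner_edges_def)
    then show ?thesis using gen cons[OF \<mu>] True by blast
  next
    case False
    then show ?thesis using \<mu> e z_outer[OF False] by (auto simp: Flows_def inner_edges_def)
  qed
  have "bij_betw (\<lambda>\<mu>. (\<mu> f1, \<mu> f2)) Flows ?S"
  proof (rule bij_betw_imageI)
    show "inj_on (\<lambda>\<mu>. (\<mu> f1, \<mu> f2)) Flows"
    proof (rule inj_onI, rule ext)
      fix \<mu> \<nu> e assume m: "\<mu> \<in> Flows" "\<nu> \<in> Flows" "(\<mu> f1, \<mu> f2) = (\<nu> f1, \<nu> f2)"
      show "\<mu> e = \<nu> e"
      proof (cases "e \<in> edges G")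
        case True
        show ?thesis using gen'[OF m(1) True] gen'[OF m(2) True] m(3) by simp
      next
        case False
        then show ?thesis using m by (auto simp: Flows_def PiE_iff extensional_def)
      qed
    qed
    show "(\<lambda>\<mu>. (\<mu> f1, \<mu> f2)) ` Flows = ?S"
    proof (intro equalityI subsetI)
      fix x assume "x \<in> (\<lambda>\<mu>. (\<mu> f1, \<mu> f2)) ` Flows"
      then obtain \<mu> where x: "x = (\<mu> f1, \<mu> f2)" and \<mu>: "\<mu> \<in> Flows" by blast
      have nz: "\<mu> f1 \<noteq> 0" "\<mu> f2 \<noteq> 0" using \<mu> fe by (auto simp: Flows_def)
      have "dett (?u k) x = 1" if "k < 2" for k
        unfolding x using lw[OF nz gen'[OF \<mu>]] \<mu> that by (auto simp: Flows_def)
      moreover have "x \<in> torus" unfolding x using nz by (simp add: torus_def)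
      ultimately show "x \<in> ?S" by simp
    next
      fix x assume x: "x \<in> ?S"
      then have nz: "fst x \<noteq> 0" "snd x \<noteq> 0" by (auto simp: torus_def)
      define \<mu> where "\<mu> = (\<lambda>e\<in>edges G. fst x powi z1 e * snd x powi z2 e)"
      have \<mu>f: "\<mu> f1 = fst x" "\<mu> f2 = snd x" using unit fe by (simp_all add: \<mu>_def)
      have \<mu>nz: "\<mu> e \<noteq> 0" if "e \<in> edges G" for e using that nz by (simp add: \<mu>_def)
      have outer: "\<mu> e = 1" if "e \<in> edges G" "e \<notin> inner_edges" for e
        using that z_outer by (simp add: \<mu>_def)
      have "(\<Prod>f\<in>flags G v. flag_value \<mu> f) = 1" if v: "v \<in> verts G - Q" for v
      proof -
        have ps: "(\<Prod>e\<in>inner_edges. (y powi w e) powi inc v e) = 1" if "y \<noteq> 0" "w \<in> H1_off G Q" for y :: complex and w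
          unfolding prod_powi_powi[OF that(1)] using that(2) v by (simp add: H1_off_iff mult.commute)
        have "(\<Prod>e\<in>inner_edges. \<mu> e powi inc v e) =
           (\<Prod>e\<in>inner_edges. (fst x powi z1 e) powi inc v e * (snd x powi z2 e) powi inc v e)"
          by (rule prod.cong) (auto simp: \<mu>_def inner_edges_def power_int_mult_distrib)
        also have "\<dots> = 1" unfolding prod.distrib using ps nz z by simp
        finally have "inverse (\<Prod>f\<in>flags G v. flag_value \<mu> f) = 1"
          using prod_inc[of \<mu> v] outer \<mu>nz by simp
        then show ?thesis using inverse_eq_1_iff by blast
      qed
      moreover have "loop_weight k \<mu> = 1" if "k < 2" for k
      proof -
        have "loop_weight k \<mu> = dett (?u k) (\<mu> f1, \<mu> f2)"
          by (rule lw) (use nz \<mu>f in \<open>auto simp: \<mu>_def\<close>)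
        also have "\<dots> = 1" unfolding \<mu>f prod.collapse using x that less_2_cases by fastforce
        finally show ?thesis .
      qed
      ultimately have "\<mu> \<in> Flows"
        using outer \<mu>nz unfolding Flows_def by (auto simp: \<mu>_def inner_edges_def)
      then show "x \<in> (\<lambda>\<mu>. (\<mu> f1, \<mu> f2)) ` Flows" using \<mu>f by (intro image_eqI[of _ _ \<mu>]) simp_all
    qed
  qed
  note bij = this
  show "finite Flows" using bij_betw_finite[OF bij] finS by blast
  have "hclass G ` H1_off G Q = {of_int i *\<^sub>R hclass G z1 + of_int j *\<^sub>R hclass G z2 | i j. True}"
  proof -
    have lin: "hclass G (\<lambda>e. i * z1 e + j * z2 e) = of_int i *\<^sub>R hclass G z1 + of_int j *\<^sub>R hclass G z2" for i j
      using hclass_combination[where A = "{True, False}" and c = "\<lambda>c. if c then i else j" and y = "\<lambda>c. if c then z1 else z2"] by simp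
    have mem: "(\<lambda>e. i * z1 e + j * z2 e) \<in> H1_off G Q" for i j
      using H1_off_combination[where A = "{True, False}" and c = "\<lambda>c. if c then i else j" and y = "\<lambda>c. if c then z1 else z2"] z by simp
    show ?thesis
    proof (intro equalityI subsetI)
      fix x assume "x \<in> hclass G ` H1_off G Q"
      then obtain y where "y \<in> H1_off G Q" "x = hclass G y" by blast
      then have "x = of_int (y f1) *\<^sub>R hclass G z1 + of_int (y f2) *\<^sub>R hclass G z2"
        using bspec[OF span, of y] lin[of "y f1" "y f2"] by simp
      then show "x \<in> {of_int i *\<^sub>R hclass G z1 + of_int j *\<^sub>R hclass G z2 | i j. True}" by blast
    next
      fix x assume "x \<in> {of_int i *\<^sub>R hclass G z1 + of_int j *\<^sub>R hclass G z2 | i j. True}"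
      then obtain i j where "x = hclass G (\<lambda>e. i * z1 e + j * z2 e)" unfolding lin by blast
      then show "x \<in> hclass G ` H1_off G Q" using mem by blast
    qed
  qed
  then have "subgroup_index \<Lambda> (hclass G ` H1_off G Q) = nat \<bar>det2 (class_coord z1) (class_coord z2)\<bar>"
    using subgroup_index_span[OF lattice lattice_coord_hclass[OF z(1)] lattice_coord_hclass[OF z(2)] D] by simp
  then show "card Flows = subgroup_index \<Lambda> (hclass G ` H1_off G Q)"
    using bij_betw_same_card[OF bij] cS by simp
qed

section \<open>Exponents for which the product of the twists is trivial\<close>

lemma prod_twist:
  assumes \<phi>: "\<phi> \<in> carrier Dom"
  shows "(\<Prod>e\<in>edges G. twist e \<phi> ^ k e) * (\<Prod>v\<in>verts G. \<Prod>f\<in>flags G v. dett (flag_dir G f) (\<phi> v) ^ k (fst f)) = 1"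
proof -
  note tor = Psi_dom_torus[OF \<phi>]
  let ?s = "\<lambda>e. dett (dir G e) (\<phi> (src G e)) ^ k e" and ?t = "\<lambda>e. dett (dir G e) (\<phi> (tgt G e)) ^ k e"
  have nz: "dett (dir G e) (\<phi> (src G e)) \<noteq> 0" "dett (dir G e) (\<phi> (tgt G e)) \<noteq> 0" if "e \<in> edges G" for e
    using tor src_in[OF that] tgt_in[OF that] by (simp_all add: dett_nonzero)
  have "(\<Prod>v\<in>verts G. \<Prod>f\<in>flags G v. dett (flag_dir G f) (\<phi> v) ^ k (fst f)) =
     (\<Prod>v\<in>verts G. (\<Prod>e | e \<in> edges G \<and> src G e = v. ?s e) * (\<Prod>e | e \<in> edges G \<and> tgt G e = v. inverse (?t e)))"
  proof (rule prod.cong[OF refl])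
    fix v assume v: "v \<in> verts G"
    show "(\<Prod>f\<in>flags G v. dett (flag_dir G f) (\<phi> v) ^ k (fst f)) =
      (\<Prod>e | e \<in> edges G \<and> src G e = v. ?s e) * (\<Prod>e | e \<in> edges G \<and> tgt G e = v. inverse (?t e))"
      unfolding prod.flags_split[OF finite_edges]
      using dett_uminus[OF tor[OF v]]
      by (intro arg_cong2[where f="(*)"] prod.cong) (auto simp: flag_dir_def power_inverse)
  qed
  \<comment> \<open>Multiplicative summation by parts: every edge occurs once at its source and
    once, reversed, at its target.\<close>
  also have "\<dots> = (\<Prod>e\<in>edges G. ?s e) * (\<Prod>e\<in>edges G. inverse (?t e))"
    unfolding prod.distrib
    by (intro arg_cong2[where f="(*)"] prod.group) (use finite_edges finite_verts src_in tgt_in in auto)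
  finally have "(\<Prod>e\<in>edges G. twist e \<phi> ^ k e) * (\<Prod>v\<in>verts G. \<Prod>f\<in>flags G v. dett (flag_dir G f) (\<phi> v) ^ k (fst f))
     = (\<Prod>e\<in>edges G. twist e \<phi> ^ k e * (?s e * inverse (?t e)))"
    by (simp add: prod.distrib)
  also have "\<dots> = (\<Prod>e\<in>edges G. 1)"
    using nz by (intro prod.cong refl) (simp add: twist_def power_divide field_simps)
  finally show ?thesis by simp
qed

text \<open>A property passed on between edges sharing an unmarked vertex spreads along chains of
  cells. A vertex cell carries it when some edge at the vertex does.\<close>

lemma edges_linked:
  assumes step: "\<And>v e e'. v \<in> verts G - Q \<Longrightarrow> e \<in> edges G \<Longrightarrow> e' \<in> edges G \<Longrightarrow> v = src G e \<or> v = tgt G e \<Longrightarrow>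
      v = src G e' \<or> v = tgt G e' \<Longrightarrow> P e \<Longrightarrow> P e'"
    and e: "e \<in> edges G" "P e" "e' \<in> edges G"
  shows "P e'"
proof -
  let ?R = "incidence G Q \<union> (incidence G Q)\<inverse>"
  define good where "good x = (case x of Inl v \<Rightarrow> v \<in> verts G - Q \<and>
      (\<exists>e\<in>edges G. (v = src G e \<or> v = tgt G e) \<and> P e) | Inr e \<Rightarrow> P e)" for x :: "'v + 'e"
  have "(Inr e, Inr e') \<in> ?R\<^sup>*"
    using connected e by (auto simp: connected_off_def cells_def)
  then have "good (Inr e')"
  proof (induction rule: rtrancl_induct)
    case base
    then show ?case using e by (simp add: good_def)
  next
    case (step x y)
    from step.hyps(2) consider
      v e where "x = Inl v" "y = Inr e" "v \<in> verts G - Q" "e \<in> edges G" "v = src G e \<or> v = tgt G e"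
    | v e where "y = Inl v" "x = Inr e" "v \<in> verts G - Q" "e \<in> edges G" "v = src G e \<or> v = tgt G e"
      by (auto simp: incidence_def)
    then show ?case
    proof cases
      case 1
      then show ?thesis using step.IH assms(1) by (auto simp: good_def)
    next
      case 2
      then show ?thesis using step.IH by (auto simp: good_def)
    qed
  qed
  then show ?thesis by (simp add: good_def)
qed

end

lemma card_proportional:
  fixes w :: "'e \<Rightarrow> nat"
  assumes E: "E \<noteq> {}" and w: "\<And>e. e \<in> E \<Longrightarrow> w e > 0"
  shows "card {k \<in> PiE E (\<lambda>e. {..<w e}). \<forall>e\<in>E. \<forall>e'\<in>E. k e * w e' = k e' * w e} = Gcd (w ` E)"
proof -
  let ?d = "Gcd (w ` E)"
  have dv: "?d dvd w e" if "e \<in> E" for e using that by (intro Gcd_dvd) auto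
  obtain e0 where e0: "e0 \<in> E" using E by auto
  have d0: "?d > 0" using dv[OF e0] w[OF e0] by (metis dvd_0_left gr0I less_irrefl)
  have q0: "w e div ?d > 0" if "e \<in> E" for e
    using dv[OF that] w[OF that] d0 by (auto elim!: dvdE)
  let ?f = "\<lambda>j. \<lambda>e\<in>E. j * (w e div ?d)"
  let ?K = "{k \<in> PiE E (\<lambda>e. {..<w e}). \<forall>e\<in>E. \<forall>e'\<in>E. k e * w e' = k e' * w e}"
  have "bij_betw ?f {..<?d} ?K"
  proof (rule bij_betw_imageI)
    show "inj_on ?f {..<?d}"
    proof (rule inj_onI)
      fix i j assume "?f i = ?f j"
      then have "?f i e0 = ?f j e0" by simp
      then show "i = j" using e0 q0[OF e0] by simp
    qed
    show "?f ` {..<?d} = ?K"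
    proof (intro equalityI subsetI)
      fix k assume "k \<in> ?f ` {..<?d}"
      then obtain j where j: "j < ?d" and k: "k = ?f j" by auto
      have "j * (w e div ?d) < w e" if e: "e \<in> E" for e
      proof -
        have "j * (w e div ?d) < ?d * (w e div ?d)" using j q0[OF e] by simp
        then show ?thesis using dv[OF e] by simp
      qed
      moreover have "j * (w e div ?d) * w e' = j * (w e' div ?d) * w e" if e: "e \<in> E" "e' \<in> E" for e e'
        using dv[OF e(1)] dv[OF e(2)] d0 by (auto elim!: dvdE)
      ultimately show "k \<in> ?K" unfolding k by auto
    next
      fix k assume k: "k \<in> ?K"
      let ?g = "gcd (k e0) (w e0)"
      have g0: "?g > 0" using w[OF e0] by simp
      obtain p q where pq: "k e0 = ?g * p" "w e0 = ?g * q" "coprime p q"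
        using gcd_coprime_exists[of "k e0" "w e0"] g0 by (metis less_irrefl mult.commute)
      have qw: "k e * q = p * w e" if e: "e \<in> E" for e
      proof -
        have "k e * w e0 = k e0 * w e" using k e e0 by blast
        then have "?g * (k e * q) = ?g * (p * w e)" using pq(1,2) by (metis mult.assoc mult.left_commute)
        then show ?thesis using nat_mult_eq_cancel1[OF g0] by blast
      qed
      have "q dvd w e" if e: "e \<in> E" for e
      proof -
        have "q dvd p * w e" using qw[OF e] by (metis dvd_triv_right)
        then show ?thesis using pq(3) by (simp add: coprime_commute coprime_dvd_mult_right_iff)
      qed
      then have "q dvd ?d" by (auto intro: Gcd_greatest)
      then obtain m where m: "?d = q * m" by (rule dvdE)
      have q: "q > 0" and m0: "m > 0" using m d0 by (auto intro: gr0I)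
      have "?g * p < ?g * q" using k e0 pq(1,2) by (metis (no_types, lifting) PiE_mem lessThan_iff mem_Collect_eq)
      then have "p < q" by simp
      then have "p * m < ?d" using m m0 by simp
      moreover have "k = ?f (p * m)"
      proof (rule ext)
        fix e show "k e = ?f (p * m) e"
        proof (cases "e \<in> E")
          case True
          obtain r where r: "w e = ?d * r" using dv[OF True] by (rule dvdE)
          have "k e * q = p * m * r * q" using qw[OF True] unfolding r m by (simp add: mult_ac)
          then have "k e = p * m * r" using q by simp
          then show ?thesis using True r d0 by simp
        next
          case False
          then show ?thesis using k by (auto simp: PiE_iff extensional_def)
        qed
      qed
      ultimately show "k \<in> ?f ` {..<?d}" by blast
    qed
  qed
  from bij_betw_same_card[OF this] show ?thesis by simp
qed

context marked_curve
begin

text \<open>It suffices to test on elements of \<open>Phi\<close> supported at a single unmarked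
  vertex. Their flow is trivial, so the loop conditions hold by themselves and only the character at
  that vertex is left.\<close>

lemma trivial_exponents_proportional:
  assumes k: "\<And>e. e \<in> edges G \<Longrightarrow> k e < wt G e"
    and triv: "\<And>\<phi>. \<phi> \<in> Phi \<Longrightarrow> (\<Prod>e\<in>edges G. twist e \<phi> ^ k e) = 1"
    and e: "e \<in> edges G" "e' \<in> edges G"
  shows "k e * wt G e' = k e' * wt G e"
proof (rule edges_linked[where P = "\<lambda>e'. k e * wt G e' = k e' * wt G e"])
  fix v e1 e2 assume v: "v \<in> verts G - Q" and e12: "e1 \<in> edges G" "e2 \<in> edges G"
    and at: "v = src G e1 \<or> v = tgt G e1" "v = src G e2 \<or> v = tgt G e2"
    and P: "k e * wt G e1 = k e1 * wt G e"
  obtain f1 where f1: "f1 \<in> flags G v" "fst f1 = e1"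
    using at(1) e12(1) by (auto simp: flags_def intro: that[of "(e1, True)"] that[of "(e1, False)"])
  obtain f2 where f2: "f2 \<in> flags G v" "fst f2 = e2"
    using at(2) e12(2) by (auto simp: flags_def intro: that[of "(e2, True)"] that[of "(e2, False)"])
  have "k (fst f1) * wt G (fst f2) = k (fst f2) * wt G (fst f1)"
  proof (rule vertex_character[OF v _ _ f1(1) f2(1)])
    show "k (fst f) < wt G (fst f)" if "f \<in> flags G v" for f using k flag_edge[OF that] by blast
    fix z assume z: "z \<in> torus" and fz: "\<forall>f\<in>flags G v. dett (flag_slope G f) z = 1"
    define \<phi> where "\<phi> = (\<lambda>u\<in>verts G. if u = v then z else (1, 1))"
    have \<phi>: "\<phi> \<in> carrier Dom"
      unfolding carrier_Psi_dom \<phi>_def using z by (auto simp: torus_def)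
    have src: "dett (slope G e) (\<phi> (src G e)) = 1" if e: "e \<in> edges G" for e
    proof (cases "src G e = v")
      case True
      then have "(e, True) \<in> flags G v" using e by (auto simp: flags_def)
      then have "dett (flag_slope G (e, True)) z = 1" using fz by blast
      then show ?thesis using True v by (simp add: \<phi>_def flag_slope_eq)
    qed (use src_in[OF e] in \<open>simp add: \<phi>_def dett_one\<close>)
    have tgt: "dett (slope G e) (\<phi> (tgt G e)) = 1" if e: "e \<in> edges G" for e
    proof (cases "tgt G e = v")
      case True
      then have "(e, False) \<in> flags G v" using e by (auto simp: flags_def)
      then have "dett (flag_slope G (e, False)) z = 1" using fz by blast
      then show ?thesis using True v dett_uminus[OF z, of "slope G e"] by (simp add: \<phi>_def flag_slope_eq)
    qed (use tgt_in[OF e] in \<open>simp add: \<phi>_def dett_one\<close>)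
    have "loopv k \<phi> = 1" if "k < 2" for k
    proof -
      have "loopv k \<phi> = loop_weight k (flow \<phi>)"
        by (rule loop_value_flow[OF that \<phi>]) (simp add: src tgt)
      also have "\<dots> = loop_weight k (\<lambda>_. 1)"
        by (rule loop_weight_cong) (simp add: flow_def src)
      finally show ?thesis by (simp add: loop_weight_def)
    qed
    then have "\<phi> \<in> Phi" using \<phi> src tgt v marked_in by (auto simp: Phi_def \<phi>_def)
    from triv[OF this] prod_twist[OF \<phi>, of k]
    have "(\<Prod>u\<in>verts G. \<Prod>f\<in>flags G u. dett (flag_dir G f) (\<phi> u) ^ k (fst f)) = 1" by simp
    also have "(\<Prod>u\<in>verts G. \<Prod>f\<in>flags G u. dett (flag_dir G f) (\<phi> u) ^ k (fst f)) =
        (\<Prod>u\<in>{v}. \<Prod>f\<in>flags G u. dett (flag_dir G f) (\<phi> u) ^ k (fst f))"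
      using v finite_verts by (intro prod.mono_neutral_right) (auto simp: \<phi>_def dett_one)
    finally show "(\<Prod>f\<in>flags G v. dett (flag_dir G f) z ^ k (fst f)) = 1"
      using v by (simp add: \<phi>_def)
  qed
  then have *: "k e1 * wt G e2 = k e2 * wt G e1" using f1 f2 by simp
  have "wt G e1 * (k e * wt G e2) = (k e * wt G e1) * wt G e2" by (simp add: mult_ac)
  also have "\<dots> = wt G e * (k e1 * wt G e2)" unfolding P by (simp add: mult_ac)
  also have "\<dots> = wt G e1 * (k e2 * wt G e)" unfolding * by (simp add: mult_ac)
  finally show "k e * wt G e2 = k e2 * wt G e"
    using nat_mult_eq_cancel1[OF wt_pos[OF e12(1)]] by blast
qed (use e in auto)

text \<open>If all \<open>k e\<close> are the same fraction of the weights, the character at each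
  unmarked vertex is that fraction of the balancing sum, which is zero; multiplying by
  \<open>wt G e0\<close> avoids denominators.\<close>

lemma proportional_exponents_trivial:
  assumes proportional: "\<And>e e'. e \<in> edges G \<Longrightarrow> e' \<in> edges G \<Longrightarrow> k e * wt G e' = k e' * wt G e"
    and \<phi>: "\<phi> \<in> Phi"
  shows "(\<Prod>e\<in>edges G. twist e \<phi> ^ k e) = 1"
proof -
  have \<phi>': "\<phi> \<in> carrier Dom" and one: "\<And>v. v \<in> Q \<Longrightarrow> \<phi> v = (1, 1)"
    using \<phi> by (auto simp: Phi_def)
  obtain e0 where e0: "e0 \<in> edges G" using edges_nonempty by auto
  have "(\<Prod>f\<in>flags G v. dett (flag_dir G f) (\<phi> v) ^ k (fst f)) = 1" if v: "v \<in> verts G" for v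
  proof (cases "v \<in> Q")
    case True
    then show ?thesis by (simp add: one dett_one)
  next
    case False
    note tor = Psi_dom_torus[OF \<phi>' v]
    define V where "V = (\<Sum>f\<in>flags G v. smul (int (k (fst f))) (flag_dir G f))"
    have "smul (int (wt G e0)) V = (\<Sum>f\<in>flags G v. smul (int (k e0)) (flag_slope G f))"
    proof -
      have "smul (int (wt G e0)) (smul (int (k (fst f))) (flag_dir G f)) = smul (int (k e0)) (flag_slope G f)"
        if "f \<in> flags G v" for f
      proof -
        have "int (wt G e0) * int (k (fst f)) = int (k e0) * int (wt G (fst f))"
          using proportional[OF flag_edge[OF that] e0] by (metis mult.commute of_nat_mult)
        then show ?thesis unfolding flag_slope_def smul_def by (simp add: mult.assoc[symmetric])
      qed
      moreover have "smul c (sum h A) = (\<Sum>f\<in>A. smul c (h f))" for c h and A :: "('e \<times> bool) set"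
        by (simp add: smul_def prod_eq_iff fst_sum snd_sum sum_distrib_left)
      ultimately show ?thesis unfolding V_def by simp
    qed
    also have "\<dots> = smul (int (k e0)) (\<Sum>f\<in>flags G v. flag_slope G f)"
      by (simp add: smul_def prod_eq_iff fst_sum snd_sum sum_distrib_left)
    also have "\<dots> = 0" using balanced[of v] v False by (simp add: smul_def zero_prod_def)
    finally have "V = 0" using wt_pos[OF e0] by (simp add: smul_def prod_eq_iff)
    moreover have "dett V (\<phi> v) = (\<Prod>f\<in>flags G v. dett (flag_dir G f) (\<phi> v) ^ k (fst f))"
      unfolding V_def dett_sum[OF tor] by (simp add: dett_smul[OF tor])
    ultimately show ?thesis using dett_0[OF tor] by simp
  qed
  then show ?thesis using prod_twist[OF \<phi>', of k] by simp
qed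

theorem complex_mult_formula:
  fixes V :: "nat \<Rightarrow> 'v"
  assumes V: "V ` {..<n} = Q"
  shows "complex_mult \<Lambda> G n V \<rho> =
     weight_gcd G * subgroup_index \<Lambda> (hclass G ` H1_off G Q) * (\<Prod>v\<in>verts G - Q. vertex_mult G v)"
proof -
  define H where "H = (Dom)\<lparr>carrier := Phi\<rparr>"
  have grp: "group H" unfolding H_def by (rule subgroup.subgroup_is_group[OF subgroup_Phi group_Psi_dom])
  have hom: "twist e \<in> hom H Cstar" if "e \<in> edges G" for e
    using hom_twist[OF that] subgroup.subset[OF subgroup_Phi] unfolding hom_def H_def by auto
  note Phi = card_Phi[OF card_Flows(1)]
  have "complex_mult \<Lambda> G n V \<rho> = card {\<phi> \<in> carrier H. \<forall>e\<in>edges G. twist e \<phi> = 1} * (\<Prod>e\<in>edges G. wt G e)"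
    unfolding complex_mult_def kernel_Psi[OF V] by (simp add: H_def)
  also have "\<dots> = card (carrier H) *
      card {k \<in> PiE (edges G) (\<lambda>e. {..<wt G e}). \<forall>\<phi>\<in>carrier H. (\<Prod>e\<in>edges G. twist e \<phi> ^ k e) = 1}"
    by (rule card_common_kernel[OF grp _ finite_edges hom]) (use Phi(1) twist_torsion in \<open>auto simp: H_def\<close>)
  also have "{k \<in> PiE (edges G) (\<lambda>e. {..<wt G e}). \<forall>\<phi>\<in>carrier H. (\<Prod>e\<in>edges G. twist e \<phi> ^ k e) = 1} =
      {k \<in> PiE (edges G) (\<lambda>e. {..<wt G e}). \<forall>e\<in>edges G. \<forall>e'\<in>edges G. k e * wt G e' = k e' * wt G e}"
  proof (rule Collect_cong, rule conj_cong[OF refl])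
    fix k assume k: "k \<in> PiE (edges G) (\<lambda>e. {..<wt G e})"
    then have "k e < wt G e" if "e \<in> edges G" for e using that by auto
    then show "(\<forall>\<phi>\<in>carrier H. (\<Prod>e\<in>edges G. twist e \<phi> ^ k e) = 1) \<longleftrightarrow>
        (\<forall>e\<in>edges G. \<forall>e'\<in>edges G. k e * wt G e' = k e' * wt G e)"
      using trivial_exponents_proportional[of k] proportional_exponents_trivial[of k]
      by (simp add: H_def) blast
  qed
  also have "card \<dots> = weight_gcd G"
    unfolding weight_gcd_def by (rule card_proportional[OF edges_nonempty wt_pos])
  finally show ?thesis by (simp add: H_def Phi(2) card_Flows(2) mult_ac)
qed

end

section \<open>Subdivision at the marked points\<close>

lemma subdivide_sel [simp]:
  "verts (subdivide \<Gamma> n mk) = Inl ` verts \<Gamma> \<union> Inr ` {..<n}"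
  "edges (subdivide \<Gamma> n mk) = {(e, None) | e. e \<in> edges \<Gamma>} \<union> {(fst (mk i), Some i) | i. i < n}"
  "src (subdivide \<Gamma> n mk) p = (case snd p of None \<Rightarrow> Inl (src \<Gamma> (fst p)) | Some i \<Rightarrow> Inr i)"
  "tgt (subdivide \<Gamma> n mk) p =
     (if later_marks n mk p = {} then Inl (tgt \<Gamma> (fst p)) else Inr (next_mark n mk p))"
  "len (subdivide \<Gamma> n mk) p =
     (if later_marks n mk p = {} then len \<Gamma> (fst p) else snd (mk (next_mark n mk p))) - piece_start mk p"
  "wt (subdivide \<Gamma> n mk) p = wt \<Gamma> (fst p)"
  "dir (subdivide \<Gamma> n mk) p = dir \<Gamma> (fst p)"
  "pos (subdivide \<Gamma> n mk) u =
     (case u of Inl v \<Rightarrow> pos \<Gamma> v | Inr i \<Rightarrow> edge_pt \<Gamma> (fst (mk i)) (snd (mk i)))"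
  by (simp_all add: subdivide_def)

lemma slope_subdivide [simp]: "slope (subdivide \<Gamma> n mk) p = slope \<Gamma> (fst p)"
  by (simp add: slope_def)

lemma finite_later_marks: "finite (later_marks n mk p)"
  by (simp add: later_marks_def)

lemma next_mark_in: "later_marks n mk p \<noteq> {} \<Longrightarrow> next_mark n mk p \<in> later_marks n mk p"
  using arg_min_if_finite(1)[OF finite_later_marks, of n mk p "\<lambda>j. snd (mk j)"]
  by (simp add: next_mark_def arg_min_on_def)

text \<open>The marking provided by genericity and the given one agree only on the indices below
  \<open>n\<close>, whereas \<open>subdivide\<close> takes the whole function as an
  argument.\<close>

lemma subdivide_cong:
  assumes mk: "\<And>i. i < n \<Longrightarrow> mk i = mk' i"
  shows "edges (subdivide \<Gamma> n mk) = edges (subdivide \<Gamma> n mk')"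
    and "p \<in> edges (subdivide \<Gamma> n mk) \<Longrightarrow> tgt (subdivide \<Gamma> n mk) p = tgt (subdivide \<Gamma> n mk') p"
    and "p \<in> edges (subdivide \<Gamma> n mk) \<Longrightarrow> len (subdivide \<Gamma> n mk) p = len (subdivide \<Gamma> n mk') p"
proof -
  show "edges (subdivide \<Gamma> n mk) = edges (subdivide \<Gamma> n mk')" using mk by auto
  assume p: "p \<in> edges (subdivide \<Gamma> n mk)"
  have st: "piece_start mk p = piece_start mk' p"
    using p mk by (auto simp: piece_start_def)
  have lm: "later_marks n mk p = later_marks n mk' p"
    unfolding later_marks_def st using mk by auto
  \<comment> \<open>The next mark is selected by a choice operator, so the defining predicates must
    agree for every candidate.\<close>
  have "is_arg_min (\<lambda>j. snd (mk j)) (\<lambda>j. j \<in> later_marks n mk p) x \<longleftrightarrow>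
      is_arg_min (\<lambda>j. snd (mk' j)) (\<lambda>j. j \<in> later_marks n mk' p) x" for x
    unfolding is_arg_min_def lm[symmetric] using mk by (auto simp: later_marks_def)
  then have nm: "next_mark n mk p = next_mark n mk' p"
    by (simp add: next_mark_def arg_min_def)
  show "tgt (subdivide \<Gamma> n mk) p = tgt (subdivide \<Gamma> n mk') p" by (simp add: lm nm)
  have "later_marks n mk' p \<noteq> {} \<Longrightarrow> next_mark n mk' p < n"
    using next_mark_in[of n mk' p] by (auto simp: later_marks_def)
  then show "len (subdivide \<Gamma> n mk) p = len (subdivide \<Gamma> n mk') p"
    using st by (simp add: lm nm mk)
qed

lemma H1_off_subdivide_cong:
  assumes mk: "\<And>i. i < n \<Longrightarrow> mk i = mk' i"
  shows "H1_off (subdivide \<Gamma> n mk) Q = H1_off (subdivide \<Gamma> n mk') Q"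
    and "hclass (subdivide \<Gamma> n mk) z = hclass (subdivide \<Gamma> n mk') z"
proof -
  let ?A = "subdivide \<Gamma> n mk" and ?B = "subdivide \<Gamma> n mk'"
  have c: "edges ?A = edges ?B"
    "p \<in> edges ?A \<Longrightarrow> tgt ?A p = tgt ?B p" "p \<in> edges ?A \<Longrightarrow> len ?A p = len ?B p" for p
    by (rule subdivide_cong; use mk in blast)+
  have v: "verts ?A = verts ?B" by simp
  have s: "src ?A e = src ?B e" for e by simp
  have t: "e \<in> edges ?A \<and> tgt ?A e = u \<longleftrightarrow> e \<in> edges ?B \<and> tgt ?B e = u"
    "e \<in> edges ?A \<and> src ?A e \<notin> Q \<and> tgt ?A e \<notin> Q \<longleftrightarrow> e \<in> edges ?B \<and> src ?B e \<notin> Q \<and> tgt ?B e \<notin> Q" for e u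
    using c(1) c(2)[where p = e] s[of e] by (auto simp del: subdivide_sel)
  have s': "e \<in> edges ?A \<and> src ?A e = u \<longleftrightarrow> e \<in> edges ?B \<and> src ?B e = u" for e u
    using c(1) by (simp del: subdivide_sel(2))
  show "H1_off ?A Q = H1_off ?B Q"
    unfolding H1_off_def v s' t ..
  have "displacement ?A e = displacement ?B e" if "e \<in> edges ?A" for e
    using c(3)[OF that] unfolding displacement_def slope_subdivide by simp
  then show "hclass ?A z = hclass ?B z"
    unfolding hclass_def c(1)[symmetric] by (intro sum.cong) auto
qed

locale subdivided_curve =
  fixes \<Lambda> :: "(real \<times> real) set" and \<Gamma> :: "('v, 'e) tcurve" and n P mk
  assumes curve: "parametrized_curve \<Lambda> \<Gamma>" and marks: "marking \<Lambda> \<Gamma> n P mk"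
begin

abbreviation "\<Gamma>' \<equiv> subdivide \<Gamma> n mk"

lemma mark: "i < n \<Longrightarrow> fst (mk i) \<in> edges \<Gamma>" "i < n \<Longrightarrow> 0 < snd (mk i)" "i < n \<Longrightarrow> snd (mk i) < len \<Gamma> (fst (mk i))"
proof -
  assume "i < n"
  then have "mk i \<in> edge_fibre \<Lambda> \<Gamma> (P i)" using marks by (auto simp: marking_def)
  then show "fst (mk i) \<in> edges \<Gamma>" "0 < snd (mk i)" "snd (mk i) < len \<Gamma> (fst (mk i))"
    by (auto simp: edge_fibre_def)
qed

lemma edge_proj: "p \<in> edges \<Gamma>' \<Longrightarrow> fst p \<in> edges \<Gamma>"
  using mark(1) by auto

lemma edge_proj_image: "fst ` edges \<Gamma>' = edges \<Gamma>"
  using mark(1) by force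

text \<open>The piece after the farthest mark is the only one that reaches the original target;
  distinctness of the marks gives uniqueness.\<close>

lemma last_piece:
  assumes e: "e \<in> edges \<Gamma>"
  shows "\<exists>!m. (e, m) \<in> edges \<Gamma>' \<and> later_marks n mk (e, m) = {}"
proof (cases "\<exists>i<n. fst (mk i) = e")
  case False
  then show ?thesis using e by (intro ex1I[of _ None]) (auto simp: later_marks_def)
next
  case True
  define M where "M = {i. i < n \<and> fst (mk i) = e}"
  have M: "finite M" "M \<noteq> {}" using True by (auto simp: M_def)
  obtain i where i: "i \<in> M" "\<And>j. j \<in> M \<Longrightarrow> snd (mk j) \<le> snd (mk i)"
  proof -
    have "Max ((\<lambda>j. snd (mk j)) ` M) \<in> (\<lambda>j. snd (mk j)) ` M" using M by (intro Max_in) auto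
    then obtain i where "i \<in> M" "Max ((\<lambda>j. snd (mk j)) ` M) = snd (mk i)" by blast
    moreover have "snd (mk j) \<le> Max ((\<lambda>j. snd (mk j)) ` M)" if "j \<in> M" for j
      using M that by (intro Max_ge) auto
    ultimately show ?thesis using that by metis
  qed
  show ?thesis
  proof (rule ex1I[of _ "Some i"])
    have "\<not> snd (mk i) < snd (mk j)" if "j < n" "fst (mk j) = e" for j
      using i(2)[of j] that by (auto simp: M_def)
    then show "(e, Some i) \<in> edges \<Gamma>' \<and> later_marks n mk (e, Some i) = {}"
      using i(1) by (auto simp: M_def later_marks_def piece_start_def)
    fix m assume m: "(e, m) \<in> edges \<Gamma>' \<and> later_marks n mk (e, m) = {}"
    show "m = Some i"
    proof (cases m)
      case None
      then have "i \<in> later_marks n mk (e, m)"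
        using i(1) mark(2)[of i] by (auto simp: later_marks_def piece_start_def M_def)
      then show ?thesis using m by simp
    next
      case (Some j)
      then have j: "j \<in> M" using m by (auto simp: M_def)
      have "i \<notin> later_marks n mk (e, m)" using m by simp
      then have "snd (mk i) \<le> snd (mk j)"
        using i(1) Some by (auto simp: later_marks_def piece_start_def M_def not_less)
      then have "mk i = mk j" using i(2)[OF j] i(1) j by (auto simp: M_def prod_eq_iff)
      then show ?thesis using marks i(1) j Some by (auto simp: marking_def M_def dest: inj_onD)
    qed
  qed
qed

text \<open>At an original vertex, an edge leaving it is represented by its first piece and an edge
  arriving there by its last one, so forgetting the subdivision loses nothing.\<close>

lemma bij_flags: "bij_betw (\<lambda>f. (fst (fst f), snd f)) (flags \<Gamma>' (Inl v)) (flags \<Gamma> v)"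
proof (rule bij_betw_imageI)
  have T: "(p, True) \<in> flags \<Gamma>' (Inl v) \<longleftrightarrow> snd p = None \<and> (fst p, True) \<in> flags \<Gamma> v" for p
    by (cases p) (auto simp: flags_def split: option.splits)
  have F: "(p, False) \<in> flags \<Gamma>' (Inl v) \<longleftrightarrow> p \<in> edges \<Gamma>' \<and> later_marks n mk p = {} \<and> (fst p, False) \<in> flags \<Gamma> v" for p
    using edge_proj[of p] by (cases p) (simp add: flags_def del: subdivide_sel(2), blast)
  show "inj_on (\<lambda>f. (fst (fst f), snd f)) (flags \<Gamma>' (Inl v))"
  proof (rule inj_onI)
    fix f f' assume f: "f \<in> flags \<Gamma>' (Inl v)" "f' \<in> flags \<Gamma>' (Inl v)"
      and eq: "(fst (fst f), snd f) = (fst (fst f'), snd f')"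
    obtain p p' c where pp: "f = (p, c)" "f' = (p', c)" "fst p = fst p'"
      using eq by (metis prod.collapse prod.inject)
    show "f = f'"
    proof (cases c)
      case True
      then show ?thesis using f pp T by (auto simp: prod_eq_iff)
    next
      case False
      have 1: "p \<in> edges \<Gamma>' \<and> later_marks n mk p = {}" "p' \<in> edges \<Gamma>' \<and> later_marks n mk p' = {}"
        using f pp False F by auto
      then have "snd p = snd p'"
        using last_piece[OF edge_proj[of p]] pp(3) by (metis prod.collapse)
      then show ?thesis using pp by (simp add: prod_eq_iff)
    qed
  qed
  show "(\<lambda>f. (fst (fst f), snd f)) ` flags \<Gamma>' (Inl v) = flags \<Gamma> v"
  proof (intro equalityI subsetI)
    fix f assume "f \<in> (\<lambda>f. (fst (fst f), snd f)) ` flags \<Gamma>' (Inl v)"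
    then obtain p c where "(p, c) \<in> flags \<Gamma>' (Inl v)" "f = (fst p, c)" by auto
    then show "f \<in> flags \<Gamma> v" using T F by (cases c) auto
  next
    fix f assume f: "f \<in> flags \<Gamma> v"
    obtain e c where ec: "f = (e, c)" by (cases f)
    have e: "e \<in> edges \<Gamma>" using f ec by (auto simp: flags_def)
    obtain p where "(p, c) \<in> flags \<Gamma>' (Inl v)" "fst p = e"
    proof (cases c)
      case True
      then have "((e, None), c) \<in> flags \<Gamma>' (Inl v)" using f ec T by simp
      then show thesis by (rule that) simp
    next
      case False
      obtain m where "(e, m) \<in> edges \<Gamma>' \<and> later_marks n mk (e, m) = {}" using last_piece[OF e] by blast
      then have "((e, m), c) \<in> flags \<Gamma>' (Inl v)" using f ec False F by simp
      then show thesis by (rule that) simp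
    qed
    then show "f \<in> (\<lambda>f. (fst (fst f), snd f)) ` flags \<Gamma>' (Inl v)"
      unfolding ec by (intro image_eqI[of _ _ "(p, c)"]) auto
  qed
qed

lemma flag_dir_subdivide: "flag_dir \<Gamma>' f = flag_dir \<Gamma> (fst (fst f), snd f)"
  and flag_slope_subdivide: "flag_slope \<Gamma>' f = flag_slope \<Gamma> (fst (fst f), snd f)"
  by (simp_all add: flag_dir_def flag_slope_def)

lemma vertex_mult_subdivide: "vertex_mult \<Gamma>' (Inl v) = vertex_mult \<Gamma> v"
proof -
  let ?r = "\<lambda>f :: ('e \<times> nat option) \<times> bool. (fst (fst f), snd f)"
  have im: "flags \<Gamma> v = ?r ` flags \<Gamma>' (Inl v)" and inj: "inj_on ?r (flags \<Gamma>' (Inl v))"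
    using bij_flags by (auto simp: bij_betw_def)
  have "(\<exists>a\<in>flags \<Gamma>' (Inl v). \<exists>b\<in>flags \<Gamma>' (Inl v). a \<noteq> b \<and> m = nat \<bar>det2 (flag_slope \<Gamma>' a) (flag_slope \<Gamma>' b)\<bar>) \<longleftrightarrow>
      (\<exists>a\<in>flags \<Gamma> v. \<exists>b\<in>flags \<Gamma> v. a \<noteq> b \<and> m = nat \<bar>det2 (flag_slope \<Gamma> a) (flag_slope \<Gamma> b)\<bar>)" for m
    unfolding im bex_simps(7) flag_slope_subdivide using inj_on_eq_iff[OF inj] by blast
  then show ?thesis unfolding vertex_mult_def by simp
qed

lemma weight_gcd_subdivide: "weight_gcd \<Gamma>' = weight_gcd \<Gamma>"
proof -
  have "wt \<Gamma>' ` edges \<Gamma>' = wt \<Gamma> ` (fst ` edges \<Gamma>')"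
    unfolding image_image by (rule image_cong) (simp_all del: subdivide_sel(2))
  then show ?thesis unfolding weight_gcd_def edge_proj_image by simp
qed

lemma curve_mult_subdivide: "(\<Prod>v\<in>verts \<Gamma>' - Inr ` {..<n}. vertex_mult \<Gamma>' v) = curve_mult \<Gamma>"
proof -
  have "verts \<Gamma>' - Inr ` {..<n} = Inl ` verts \<Gamma>" by auto
  then have "(\<Prod>v\<in>verts \<Gamma>' - Inr ` {..<n}. vertex_mult \<Gamma>' v) = (\<Prod>v\<in>verts \<Gamma>. vertex_mult \<Gamma>' (Inl v))"
    by (simp add: prod.reindex)
  then show ?thesis by (simp add: vertex_mult_subdivide curve_mult_def)
qed

lemma edge_pt_subdivide:
  assumes "p \<in> edges \<Gamma>'"
  shows "edge_pt \<Gamma>' p t = edge_pt \<Gamma> (fst p) (piece_start mk p + t)"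
  using assms by (auto simp: edge_pt_def piece_start_def algebra_simps)

lemma torus_graph_subdivide:
  assumes b: "lattice_basis \<Lambda> b"
  shows "torus_graph \<Lambda> b \<Gamma>'"
proof
  have c: "finite (verts \<Gamma>)" "finite (edges \<Gamma>)"
    "\<And>e. e \<in> edges \<Gamma> \<Longrightarrow> src \<Gamma> e \<in> verts \<Gamma> \<and> tgt \<Gamma> e \<in> verts \<Gamma> \<and> len \<Gamma> e > 0 \<and> wt \<Gamma> e \<ge> 1 \<and>
        coprime (fst (dir \<Gamma> e)) (snd (dir \<Gamma> e)) \<and> edge_pt \<Gamma> e (len \<Gamma> e) - pos \<Gamma> (tgt \<Gamma> e) \<in> \<Lambda>"
    using curve by (auto simp: parametrized_curve_def)
  show "lattice_basis \<Lambda> b" by fact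
  show "finite (verts \<Gamma>')" using c by simp
  show "finite (edges \<Gamma>')" using c by simp
  fix p assume p: "p \<in> edges \<Gamma>'"
  note cp = c(3)[OF edge_proj[OF p]]
  have nm: "next_mark n mk p < n \<and> fst (mk (next_mark n mk p)) = fst p \<and> snd (mk (next_mark n mk p)) > piece_start mk p"
    if "later_marks n mk p \<noteq> {}"
    using next_mark_in[OF that] by (simp add: later_marks_def)
  have st: "piece_start mk p < len \<Gamma> (fst p)"
    using p mark(3) cp by (auto simp: piece_start_def)
  show "src \<Gamma>' p \<in> verts \<Gamma>'" using p cp by auto
  show "tgt \<Gamma>' p \<in> verts \<Gamma>'" using nm cp by auto
  show "len \<Gamma>' p > 0" using nm st by auto
  show "wt \<Gamma>' p > 0" using cp by simp
  show "dir \<Gamma>' p \<noteq> 0" using cp by auto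
  show "edge_pt \<Gamma>' p (len \<Gamma>' p) - pos \<Gamma>' (tgt \<Gamma>' p) \<in> \<Lambda>"
  proof (cases "later_marks n mk p = {}")
    case True
    then show ?thesis using cp by (simp add: edge_pt_subdivide[OF p])
  next
    case False
    \<comment> \<open>A piece that ends at a marked point ends exactly at the chosen representative,
      without any lattice translation.\<close>
    have "0 \<in> \<Lambda>" unfolding lattice_mem_iff[OF b] by (simp add: lattice_coord_0)
    then show ?thesis using False nm[OF False] by (simp add: edge_pt_subdivide[OF p])
  qed
qed

lemma marked_curve_subdivide:
  assumes b: "lattice_basis \<Lambda> b" and simple: "simple_curve \<Gamma>"
    and conn: "connected_off \<Gamma>' (Inr ` {..<n})"
    and rank: "free_of_rank (H1_off \<Gamma>' (Inr ` {..<n})) 2"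
    and inj: "inj_on (hclass \<Gamma>') (H1_off \<Gamma>' (Inr ` {..<n}))"
    and loops: "\<forall>k<2. loop_in_class (\<rho> k) (b k) \<and> transverse \<Lambda> \<Gamma>' (\<rho> k)"
  shows "marked_curve \<Lambda> b \<Gamma>' (Inr ` {..<n}) \<rho>"
proof (rule marked_curve.intro[OF torus_graph_subdivide[OF b]], unfold_locales)
  show "Inr ` {..<n} \<subseteq> verts \<Gamma>'" by simp
  have cop: "coprime (fst (dir \<Gamma> e)) (snd (dir \<Gamma> e))" if "e \<in> edges \<Gamma>" for e
    using curve that by (auto simp: parametrized_curve_def)
  obtain v where "v \<in> verts \<Gamma>" using curve by (auto simp: parametrized_curve_def)
  then have "valence \<Gamma> v \<ge> 3" using curve by (auto simp: parametrized_curve_def)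
  then have "flags \<Gamma> v \<noteq> {}" by (auto simp: valence_def)
  then have "edges \<Gamma> \<noteq> {}" by (auto simp: flags_def)
  then show "edges \<Gamma>' \<noteq> {}" using edge_proj_image by blast
  show "coprime (fst (dir \<Gamma>' p)) (snd (dir \<Gamma>' p))" if "p \<in> edges \<Gamma>'" for p
    using cop[OF edge_proj[OF that]] by simp
  fix u assume "u \<in> verts \<Gamma>' - Inr ` {..<n}"
  then obtain v where u: "u = Inl v" and v: "v \<in> verts \<Gamma>" by auto
  show "(\<Sum>f\<in>flags \<Gamma>' u. flag_slope \<Gamma>' f) = 0"
    unfolding u flag_slope_subdivide sum.reindex_bij_betw[OF bij_flags]
    using curve v by (auto simp: parametrized_curve_def)
  show "card (flags \<Gamma>' u) = 3"
    unfolding u bij_betw_same_card[OF bij_flags] using simple v by (simp add: simple_curve_def valence_def)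
  show "inj_on (flag_dir \<Gamma>') (flags \<Gamma>' u)"
  proof -
    have "inj_on (flag_dir \<Gamma> \<circ> (\<lambda>f. (fst (fst f), snd f))) (flags \<Gamma>' (Inl v))"
      using bij_flags[of v] simple v by (intro comp_inj_on) (auto simp: bij_betw_def simple_curve_def)
    then show ?thesis unfolding u by (simp add: inj_on_def flag_dir_subdivide)
  qed
qed (use conn rank inj loops in auto)

end

theorem theorem3p11:
  fixes g :: nat
    and \<Lambda> :: "(real \<times> real) set"
    and b :: "nat \<Rightarrow> real \<times> real"
    and c :: "real \<times> real \<Rightarrow> int \<times> int"
    and \<beta> :: "real \<times> real \<Rightarrow> real"
    and C :: "(real \<times> real) \<times> (real \<times> real)"
    and P :: "nat \<Rightarrow> real \<times> real"
    and \<Gamma> :: "(nat, nat) tcurve"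
    and \<Gamma>' :: "(nat + nat, nat \<times> nat option) tcurve"
    and mk :: "nat \<Rightarrow> nat \<times> real"
    and VS :: "(nat + nat) set"
    and ES :: "(nat \<times> nat option) set"
    and \<rho> :: "nat \<Rightarrow> real \<Rightarrow> real \<times> real"
  assumes "g \<ge> 2"
    and "lattice_basis \<Lambda> b"
    and "tropical_line_bundle \<Lambda> c \<beta>"
    and "C \<in> \<Lambda> \<times> \<Lambda>"
    and "generic_config \<Lambda> c \<beta> g C P"
    and "irreducible_curve \<Lambda> g C \<Gamma>"
    and "in_linear_system \<Lambda> c \<beta> \<Gamma>"
    and "passes_through \<Lambda> \<Gamma> (g - 2) P"
    and "marking \<Lambda> \<Gamma> (g - 2) P mk"
    and "\<Gamma>' = subdivide \<Gamma> (g - 2) mk"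
    and "retracts_onto \<Gamma>' (marked_vertices (g - 2)) VS ES"
    and "genus_off (sub_curve \<Gamma>' VS ES) {} 2"
    and "\<forall>k<2. loop_in_class (\<rho> k) (b k) \<and> transverse \<Lambda> \<Gamma>' (\<rho> k)"
  shows "complex_mult \<Lambda> \<Gamma>' (g - 2) Inr \<rho> =
           weight_gcd \<Gamma> *
           subgroup_index \<Lambda> (hclass (sub_curve \<Gamma>' VS ES) ` H1_off (sub_curve \<Gamma>' VS ES) {}) *
           curve_mult \<Gamma>"
proof -
  let ?n = "g - 2"
  let ?Q = "Inr ` {..<?n} :: (nat + nat) set"
  have curve: "parametrized_curve \<Lambda> \<Gamma>" using assms(6) by (simp add: irreducible_curve_def)
  interpret s: subdivided_curve \<Lambda> \<Gamma> ?n P mk by unfold_locales fact+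
  have gen: "simple_curve \<Gamma> \<and> (\<exists>mk. marking \<Lambda> \<Gamma> ?n P mk \<and>
      connected_off (subdivide \<Gamma> ?n mk) ?Q \<and> genus_off (subdivide \<Gamma> ?n mk) ?Q 2 \<and>
      inj_on (hclass (subdivide \<Gamma> ?n mk)) (H1_off (subdivide \<Gamma> ?n mk) ?Q))"
    using assms(5-8) unfolding generic_config_def by blast
  then obtain mk' where mk': "marking \<Lambda> \<Gamma> ?n P mk'"
    and inj': "inj_on (hclass (subdivide \<Gamma> ?n mk')) (H1_off (subdivide \<Gamma> ?n mk') ?Q)" by blast
  \<comment> \<open>Each point of the configuration has a single preimage, so two markings agree at
    every index in range.\<close>
  have mk: "mk i = mk' i" if "i < ?n" for i
    using assms(9) mk' that by (auto simp: marking_def)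
  have inj: "inj_on (hclass \<Gamma>') (H1_off \<Gamma>' ?Q)"
    using inj' H1_off_subdivide_cong(1)[where n = ?n and mk = mk and mk' = mk' and \<Gamma> = \<Gamma> and Q = ?Q, OF mk]
      H1_off_subdivide_cong(2)[where n = ?n and mk = mk and mk' = mk' and \<Gamma> = \<Gamma>, OF mk]
    unfolding assms(10) by (simp add: inj_on_def)
  have ret: "connected_off \<Gamma>' ?Q" "H1_off (sub_curve \<Gamma>' VS ES) {} = H1_off \<Gamma>' ?Q" "ES \<subseteq> edges \<Gamma>'"
    using assms(11) by (auto simp: retracts_onto_def)
  have mc: "marked_curve \<Lambda> b \<Gamma>' ?Q \<rho>"
    unfolding assms(10)
    by (rule s.marked_curve_subdivide)
       (use assms(2,10,12,13) gen ret inj in \<open>auto simp: genus_off_def\<close>)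
  interpret m: marked_curve \<Lambda> b \<Gamma>' ?Q \<rho> by (rule mc)
  \<comment> \<open>Cycles of the subgraph vanish outside \<open>ES\<close>, so the sum over all
    edges has the same value.\<close>
  have "hclass (sub_curve \<Gamma>' VS ES) z = hclass \<Gamma>' z" if z: "z \<in> H1_off (sub_curve \<Gamma>' VS ES) {}" for z
  proof -
    have "displacement (sub_curve \<Gamma>' VS ES) e = displacement \<Gamma>' e" for e
      by (simp add: displacement_def slope_def sub_curve_def)
    moreover have "\<forall>e. z e \<noteq> 0 \<longrightarrow> e \<in> ES" using z by (simp add: H1_off_def sub_curve_def)
    ultimately show ?thesis
      unfolding hclass_def using ret(3) m.finite_edges
      by (intro sum.mono_neutral_cong_left) (auto simp: sub_curve_def)
  qed
  then have im: "hclass (sub_curve \<Gamma>' VS ES) ` H1_off (sub_curve \<Gamma>' VS ES) {} = hclass \<Gamma>' ` H1_off \<Gamma>' ?Q"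
    unfolding ret(2) by (rule image_cong[OF refl])
  show ?thesis
    unfolding im m.complex_mult_formula[OF refl]
    unfolding assms(10) s.weight_gcd_subdivide s.curve_mult_subdivide ..
qed

end
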